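(* Let $h(X_1,\dots,X_n)=1+\sum_{j=1}^r a_j\mathbf X^{\boldsymbol\alpha_{\cdot j}}\in\mathbb Z[X_1,\dots,X_n]$ be a polynomial that is not cyclotomic and has no cyclotomic factor, and let $Z(\mathbf s)=\prod_p h(p^{-s_1},\dots,p^{-s_n})$, viewed as a meromorphic function on $\mathbf W(0)$. Suppose that $\mathcal F(\boldsymbol\alpha_{\cdot e})$ is a non-degenerate face of $\partial\mathbf W(0)$. Let $\mathcal B\subset\mathbb C^n$ be any open ball centered at any point $\mathbf s^0\in\mathcal F(\boldsymbol\alpha_{\cdot e})$. Then $Z(\mathbf s)$ cannot be extended as a meromorphic function to any domain that contains $\mathcal B$; that is, there is no meromorphic function on $\mathcal B$ that coincides with $Z$ on $\mathcal B\cap\mathbf W(0)$.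
   Context: Here $n,r\ge 1$, the $a_j$ are nonzero integers, and $\boldsymbol\alpha_{\cdot j}={}^t(\alpha_{1j},\dots,\alpha_{nj})\in\mathbb N^n$ ($j=1,\dots,r$) are pairwise distinct nonzero vectors; $\mathbf X^{\boldsymbol\alpha_{\cdot j}}=X_1^{\alpha_{1j}}\cdots X_n^{\alpha_{nj}}$. For $\mathbf s=(s_1,\dots,s_n)\in\mathbb C^n$ write $\mathbf s\cdot\boldsymbol\alpha_{\cdot j}=\sum_{\ell}s_\ell\alpha_{\ell j}$ and $\boldsymbol\sigma=\Re(\mathbf s)$ (componentwise). Products over $p$ run over all primes. Cyclotomic: a polynomial (or rational fraction) $Q$ in $X_1,\dots,X_n$ over $\mathbb Z$ is cyclotomic if there are a finite set $I\subset\mathbb N^n\setminus\{\mathbf 0\}$ and integers $\gamma(\boldsymbol\lambda)\in\mathbb Z$ with $Q=\prod_{\boldsymbol\lambda\in I}(1-X_1^{\lambda_1}\cdots X_n^{\lambda_n})^{\gamma(\boldsymbol\lambda)}$. "No cyclotomic factor" means that no nonconstant cyclotomic polynomial divides $h$ in $\mathbb Z[X_1,\dots,X_n]$. For $\delta\ge 0$, $\mathbf W(\delta)=\{\mathbf s\in\mathbb C^n:\boldsymbol\sigma\cdot\boldsymbol\alpha_{\cdot j}>\delta\ \ \forall j\in\{1,\dots,r\}\}$. The Euler product $Z(\mathbf s)$ converges absolutely on $\mathbf W(1)$ and is known to extend meromorphically to $\mathbf W(0)$; $Z$ denotes this extension. Faces: $\overline{\mathbf W(0)}=\{\mathbf s:\Re(\mathbf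 s\cdot\boldsymbol\alpha_{\cdot j})\ge 0\ \forall j\}$; a face of $\partial\mathbf W(0)$ is a set $\mathcal F(\boldsymbol\alpha_{\cdot e})=\{\mathbf s\in\overline{\mathbf W(0)}:\Re(\mathbf s\cdot\boldsymbol\alpha_{\cdot e})=0\}$, $e\in\{1,\dots,r\}$, which is a codimension-one face of this polyhedral cone (i.e. $\mathcal F(\boldsymbol\alpha_{\cdot e})\cap\mathbb R^n$ has dimension $n-1$). Non-degenerate: let $\widehat{\boldsymbol\alpha}_{\cdot e}\in\mathbb N^n$ be the vector in $\mathbb Q_{>0}\boldsymbol\alpha_{\cdot e}$ whose nonzero components are relatively prime (gcd equal to $1$). For each $j$ with $\boldsymbol\alpha_{\cdot j}\in\mathbb Q\boldsymbol\alpha_{\cdot e}$ let $q_j\in\mathbb N^*$ be given by $\boldsymbol\alpha_{\cdot j}=q_j\widehat{\boldsymbol\alpha}_{\cdot e}$. Put $\widetilde{[h]_e}(T)=1+\sum_{j:\ \boldsymbol\alpha_{\cdot j}\in\mathbb Q\boldsymbol\alpha_{\cdot e}}a_jT^{q_j}\in\mathbb Z[T]$. The face $\mathcal F(\boldsymbol\alpha_{\cdot e})$ is non-degenerate if $\widetilde{[h]_e}(T)$ has no multiple root. *)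

theory Defs
  imports
    "HOL-Analysis.Analysis"
    "HOL-Library.Poly_Mapping"
    "HOL-Computational_Algebra.Primes"
    "HOL-Computational_Algebra.Polynomial"
begin

unbundle no fps_syntax

section \<open>Polynomials over the integers in finitely many variables\<close>

text \<open>An element of this type is a finitely supported map from exponent vectors to
  coefficients; its multiplication is convolution. The variables are indexed by \<open>'n\<close>.\<close>

type_synonym 'n int_mpoly = "(nat ^ 'n) \<Rightarrow>\<^sub>0 int"

definition mono_pow :: "nat ^ 'n \<Rightarrow> 'n int_mpoly" where
  "mono_pow \<mu> = Poly_Mapping.single \<mu> 1"

definition nonconstant :: "('n::finite) int_mpoly \<Rightarrow> bool" where
  "nonconstant Q \<longleftrightarrow> \<not> Poly_Mapping.keys Q \<subseteq> {0}"

definition eval_mpoly :: "('n::finite) int_mpoly \<Rightarrow> complex ^ 'n \<Rightarrow> complex" where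
  "eval_mpoly Q x =
     (\<Sum>\<beta>\<in>Poly_Mapping.keys Q. of_int (Poly_Mapping.lookup Q \<beta>) * (\<Prod>i\<in>UNIV. (x $ i) ^ (\<beta> $ i)))"

text \<open>The identity \<open>Q = (\<Prod>\<mu>\<in>I. (1 - X\<^sup>\<mu>) powi \<gamma> \<mu>)\<close> of rational fractions is
  stated with the factors of negative exponent moved to the left-hand side.\<close>

definition cyclotomic_mpoly :: "('n::finite) int_mpoly \<Rightarrow> bool" where
  "cyclotomic_mpoly Q \<longleftrightarrow>
     (\<exists>(I :: (nat ^ 'n) set) (\<gamma> :: nat ^ 'n \<Rightarrow> int). finite I \<and> 0 \<notin> I \<and>
        Q * (\<Prod>\<mu>\<in>I. (1 - mono_pow \<mu>) ^ nat (- \<gamma> \<mu>)) = (\<Prod>\<mu>\<in>I. (1 - mono_pow \<mu>) ^ nat (\<gamma> \<mu>)))"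

definition has_cyclotomic_factor :: "('n::finite) int_mpoly \<Rightarrow> bool" where
  "has_cyclotomic_factor h \<longleftrightarrow> (\<exists>Q. cyclotomic_mpoly Q \<and> nonconstant Q \<and> Q dvd h)"

definition h_poly :: "nat \<Rightarrow> (nat \<Rightarrow> int) \<Rightarrow> (nat \<Rightarrow> nat ^ 'n) \<Rightarrow> ('n::finite) int_mpoly" where
  "h_poly r a \<alpha> = 1 + (\<Sum>j=1..r. Poly_Mapping.single (\<alpha> j) (a j))"


section \<open>Meromorphic functions of several complex variables\<close>

definition holomorphic_several :: "(complex ^ 'n \<Rightarrow> complex) \<Rightarrow> (complex ^ 'n) set \<Rightarrow> bool" where
  "holomorphic_several f U \<longleftrightarrow>
     (\<forall>z\<in>U. \<exists>D. (f has_derivative D) (at z) \<and> (\<forall>c v. D (c *s v) = c * D v))"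

text \<open>A meromorphic function on the open set \<open>U\<close> is locally a quotient of holomorphic functions
  whose denominator does not vanish identically. It is represented by a total function whose
  values at the zeros of the denominators are irrelevant; accordingly, two meromorphic functions
  are the same on \<open>U\<close> if their representatives agree on an open dense subset of \<open>U\<close>.\<close>

definition meromorphic_several :: "(complex ^ 'n \<Rightarrow> complex) \<Rightarrow> (complex ^ 'n) set \<Rightarrow> bool" where
  "meromorphic_several F U \<longleftrightarrow>
     (\<forall>z\<in>U. \<exists>V f g. open V \<and> connected V \<and> z \<in> V \<and> V \<subseteq> U \<and>
        holomorphic_several f V \<and> holomorphic_several g V \<and> (\<exists>w\<in>V. g w \<noteq> 0) \<and>
        (\<forall>w\<in>V. g w \<noteq> 0 \<longrightarrow> F w = f w / g w))"

definition coincide_on ::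
    "(complex ^ 'n) set \<Rightarrow> (complex ^ 'n \<Rightarrow> complex) \<Rightarrow> (complex ^ 'n \<Rightarrow> complex) \<Rightarrow> bool" where
  "coincide_on U F G \<longleftrightarrow>
     (\<exists>D. open D \<and> D \<subseteq> U \<and> U \<subseteq> closure D \<and> (\<forall>w\<in>D. F w = G w))"


section \<open>The Euler product and its domains\<close>

definition sdot :: "complex ^ 'n \<Rightarrow> nat ^ 'n \<Rightarrow> complex" where
  "sdot s \<beta> = (\<Sum>l\<in>UNIV. s $ l * of_nat (\<beta> $ l))"

definition W :: "nat \<Rightarrow> (nat \<Rightarrow> nat ^ 'n) \<Rightarrow> real \<Rightarrow> (complex ^ 'n) set" where
  "W r \<alpha> \<delta> = {s. \<forall>j\<in>{1..r}. Re (sdot s (\<alpha> j)) > \<delta>}"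

definition euler_product :: "('n::finite) int_mpoly \<Rightarrow> complex ^ 'n \<Rightarrow> complex" where
  "euler_product h s =
     prodinf (\<lambda>p::nat. if prime p then eval_mpoly h (\<chi> l. of_nat p powr (- (s $ l))) else 1)"

definition euler_extension ::
    "nat \<Rightarrow> (nat \<Rightarrow> int) \<Rightarrow> (nat \<Rightarrow> nat ^ 'n) \<Rightarrow> (complex ^ ('n::finite) \<Rightarrow> complex) \<Rightarrow> bool" where
  "euler_extension r a \<alpha> Z \<longleftrightarrow>
     meromorphic_several Z (W r \<alpha> 0) \<and>
     coincide_on (W r \<alpha> 1) Z (euler_product (h_poly r a \<alpha>))"


section \<open>Faces\<close>

definition face_set :: "nat \<Rightarrow> (nat \<Rightarrow> nat ^ 'n) \<Rightarrow> nat \<Rightarrow> (complex ^ 'n) set" where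
  "face_set r \<alpha> e = {s \<in> closure (W r \<alpha> 0). Re (sdot s (\<alpha> e)) = 0}"

definition is_face :: "nat \<Rightarrow> (nat \<Rightarrow> nat ^ 'n) \<Rightarrow> nat \<Rightarrow> bool" where
  "is_face r \<alpha> e \<longleftrightarrow> e \<in> {1..r} \<and>
     aff_dim {\<sigma> :: real ^ 'n. (\<chi> l. complex_of_real (\<sigma> $ l)) \<in> face_set r \<alpha> e} = int CARD('n) - 1"

definition in_rat_span :: "nat ^ 'n \<Rightarrow> nat ^ 'n \<Rightarrow> bool" where
  "in_rat_span \<beta> \<alpha> \<longleftrightarrow> (\<exists>c::rat. \<forall>l. of_nat (\<beta> $ l) = c * of_nat (\<alpha> $ l))"

definition primitive_vec :: "nat ^ 'n \<Rightarrow> nat ^ 'n" where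
  "primitive_vec \<alpha> = (THE v. (\<exists>c::rat. c > 0 \<and> (\<forall>l. of_nat (v $ l) = c * of_nat (\<alpha> $ l))) \<and>
                            Gcd {v $ l |l. v $ l \<noteq> 0} = 1)"

definition ray_index :: "nat ^ 'n \<Rightarrow> nat ^ 'n \<Rightarrow> nat" where
  "ray_index \<alpha> \<beta> = (THE q. q \<ge> 1 \<and> (\<forall>l. \<beta> $ l = q * primitive_vec \<alpha> $ l))"

definition face_poly :: "nat \<Rightarrow> (nat \<Rightarrow> int) \<Rightarrow> (nat \<Rightarrow> nat ^ 'n) \<Rightarrow> nat \<Rightarrow> int poly" where
  "face_poly r a \<alpha> e =
     1 + (\<Sum>j\<in>{j\<in>{1..r}. in_rat_span (\<alpha> j) (\<alpha> e)}. monom (a j) (ray_index (\<alpha> e) (\<alpha> j)))"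

definition nondegenerate_face ::
    "nat \<Rightarrow> (nat \<Rightarrow> int) \<Rightarrow> (nat \<Rightarrow> nat ^ 'n) \<Rightarrow> nat \<Rightarrow> bool" where
  "nondegenerate_face r a \<alpha> e \<longleftrightarrow>
     (\<forall>z::complex. order z (map_poly of_int (face_poly r a \<alpha> e)) \<le> 1)"

end

theory Submission
  imports Defs "HOL-Complex_Analysis.Complex_Analysis"
    "HOL-Computational_Algebra.Fundamental_Theorem_Algebra"
begin

unbundle no fps_syntax

text \<open>For \<open>\<delta> > 0\<close>, finitely many factors \<open>\<zeta>(\<beta> \<sdot> s)\<close> and their inverses turn \<open>Z\<close> into a product that converges
  on \<open>W(\<delta>)\<close>. Hence a meromorphic extension of \<open>Z\<close> across a boundary point has a numerator that vanishes at
  every zero \<open>s\<close> of a single Euler factor \<open>h(p\<^sup>-\<^sup>s)\<close>, unless some \<open>\<beta> \<sdot> s\<close> is \<open>1\<close> or a zero of \<open>\<zeta>\<close>. On a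
  complex line where the numerator is not identically zero, such zeros cannot accumulate at the face.

  Group the exponents of \<open>h\<close> into lines parallel to the primitive normal \<open>w\<close> of the face. The line
  through \<open>0\<close> gives the face polynomial \<open>H\<close>, and the others contribute terms that are exponentially
  small in \<open>log p\<close>. A simple root \<open>\<tau>\<close> of \<open>H\<close> with \<open>\<bar>\<tau>\<bar> < 1\<close>, and also one with \<open>\<bar>\<tau>\<bar> = 1\<close> after a choice of
  phase, produces for infinitely many \<open>p\<close> zeros accumulating at the face from inside \<open>W(0)\<close>. If some
  other line does not vanish at \<open>\<tau>\<close>, the zero is not an affine function of the slice parameter and a
  generic slice avoids all hyperplanes \<open>\<beta> \<sdot> s = const\<close> in question. If all of them vanish at \<open>\<tau>\<close> and
  \<open>\<bar>\<tau>\<bar> < 1\<close>, the zeros are explicit and more numerous than the zeros of the zeta factors that could cancel them.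

  In the remaining case all roots of \<open>H\<close> lie on the unit circle and annihilate every line, so that
  \<open>H\<close> is cyclotomic and \<open>H(X\<^sup>w)\<close> divides \<open>h\<close>, which is excluded.\<close>

section \<open>Holomorphic and meromorphic functions on complex lines\<close>

text \<open>Cancellation shapes the proof: a zero of one Euler factor may be hidden by a zeta factor
  in the denominator that vanishes at the same point. Multiplicities are not compared; a zero is
  sought at which \<zeta>(\<beta> \<sdot> s) is finite and nonzero for every nonzero exponent
  \<beta> with Re (\<beta> \<sdot> s) > 0. All \<beta> are excluded at once because the list of zeta
  factors depends on \<delta>, which has to shrink as the zeros approach the face. The zeros of
  \<zeta> then enter only through their countability and a Jensen bound on their number.

  Non-degeneracy enters twice: a simple zero survives a perturbation with a controlled displacement,
  and a polynomial vanishing at all roots of \<open>H\<close> is a multiple of \<open>H\<close> when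
  these roots are simple.

  A root of \<open>H\<close> determines its logarithm only up to multiples of 2\<pi>i; this free
  integer steers the zeros to any prescribed height, so the accumulation point on the face can be
  fixed beforehand. The constant coefficient 1 bounds the product of the moduli of the roots by 1,
  so that without a root inside the disc all roots lie on the circle.\<close>

definition line_holomorphic :: "(complex ^ 'n \<Rightarrow> complex) \<Rightarrow> (complex ^ 'n) set \<Rightarrow> bool" where
  "line_holomorphic f U \<longleftrightarrow> (\<forall>a d. (\<lambda>t. f (a + t *s d)) holomorphic_on {t. a + t *s d \<in> U})"

lemma has_derivative_line:
  fixes a d :: "complex ^ ('n::finite)"
  shows "((\<lambda>t. a + t *s d) has_derivative (\<lambda>t. t *s d)) (at t0)"
proof -
  have "bounded_linear (\<lambda>t::complex. t *s d)"
  proof (unfold linear_conv_bounded_linear[symmetric], rule linearI)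
    show "(b1 + b2) *s d = b1 *s d + b2 *s d" for b1 b2 :: complex
      by (simp add: vec_eq_iff algebra_simps)
    show "(r *\<^sub>R b) *s d = r *\<^sub>R (b *s d)" for r and b :: complex
      by (simp add: vec_eq_iff)
  qed
  thus ?thesis
    by (auto intro!: derivative_eq_intros bounded_linear_imp_has_derivative)
qed

lemma continuous_on_line:
  fixes a d :: "complex ^ ('n::finite)"
  shows "continuous_on S (\<lambda>t. a + t *s d)"
  by (intro continuous_at_imp_continuous_on ballI) (rule has_derivative_continuous[OF has_derivative_line])

lemma open_line_preimage:
  fixes a d :: "complex ^ ('n::finite)"
  assumes "open U"
  shows "open {t. a + t *s d \<in> U}"
  using open_vimage[OF assms continuous_on_line[of UNIV a d]] by (simp add: vimage_def)

lemma convex_line_preimage: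
  fixes a d :: "complex ^ ('n::finite)"
  assumes "convex U"
  shows "convex {t. a + t *s d \<in> U}"
proof (rule convexI)
  fix x y :: complex and u v :: real
  assume h: "x \<in> {t. a + t *s d \<in> U}" "y \<in> {t. a + t *s d \<in> U}" "0 \<le> u" "0 \<le> v" "u + v = 1"
  have "a = (u + v) *\<^sub>R a" using h by simp
  hence "a + (u *\<^sub>R x + v *\<^sub>R y) *s d = u *\<^sub>R (a + x *s d) + v *\<^sub>R (a + y *s d)"
    by (simp add: vec_eq_iff algebra_simps)
  also have "\<dots> \<in> U" using convexD[OF assms] h by auto
  finally show "u *\<^sub>R x + v *\<^sub>R y \<in> {t. a + t *s d \<in> U}" by simp
qed

lemma line_holomorphic_subset:
  "line_holomorphic f U \<Longrightarrow> V \<subseteq> U \<Longrightarrow> line_holomorphic f V"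
  unfolding line_holomorphic_def by (meson Collect_mono holomorphic_on_subset subsetD)

lemma line_holomorphic_mult:
  "line_holomorphic f U \<Longrightarrow> line_holomorphic g U \<Longrightarrow> line_holomorphic (\<lambda>z. f z * g z) U"
  unfolding line_holomorphic_def by (auto intro!: holomorphic_intros)

lemma line_holomorphic_diff:
  "line_holomorphic f U \<Longrightarrow> line_holomorphic g U \<Longrightarrow> line_holomorphic (\<lambda>z. f z - g z) U"
  unfolding line_holomorphic_def by (auto intro!: holomorphic_intros)

lemma holomorphic_several_imp_line_holomorphic:
  fixes f :: "complex ^ ('n::finite) \<Rightarrow> complex"
  assumes "holomorphic_several f U"
  shows "line_holomorphic f U"
  unfolding line_holomorphic_def holomorphic_on_def
proof (intro allI ballI)
  fix a d :: "complex ^ 'n" and t assume "t \<in> {t. a + t *s d \<in> U}"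
  then obtain D where D: "(f has_derivative D) (at (a + t *s d))" "\<And>c v. D (c *s v) = c * D v"
    using assms unfolding holomorphic_several_def by blast
  have "((\<lambda>t. f (a + t *s d)) has_derivative (\<lambda>t. D (t *s d))) (at t)"
    using has_derivative_compose[OF has_derivative_line D(1)] .
  hence "((\<lambda>t. f (a + t *s d)) has_field_derivative (D d)) (at t)"
    by (rule has_derivative_imp_has_field_derivative) (simp add: D(2) mult.commute)
  thus "(\<lambda>t. f (a + t *s d)) field_differentiable at t within {t. a + t *s d \<in> U}"
    using field_differentiable_at_within field_differentiable_def by blast
qed

lemma holomorphic_several_continuous_on:
  fixes f :: "complex ^ ('n::finite) \<Rightarrow> complex"
  shows "holomorphic_several f U \<Longrightarrow> continuous_on U f"
  unfolding holomorphic_several_def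
  by (meson continuous_at_imp_continuous_on has_derivative_continuous)

lemma holomorphic_several_subset:
  "holomorphic_several f U \<Longrightarrow> V \<subseteq> U \<Longrightarrow> holomorphic_several f V"
  unfolding holomorphic_several_def by blast

text \<open>A complex line through a point of \<open>A\<close> and through \<open>x\<close> meets a
  convex set in a connected set, so the one-variable identity theorem applies. Holomorphy on lines
  suffices for this, and it is what one-variable theorems deliver for infinite products.\<close>

lemma line_holomorphic_identity:
  fixes f :: "complex ^ ('n::finite) \<Rightarrow> complex"
  assumes "line_holomorphic f U" "open U" "convex U" "open A" "A \<noteq> {}" "A \<subseteq> U"
    and zero: "\<And>z. z \<in> A \<Longrightarrow> f z = 0" and "x \<in> U"
  shows "f x = 0"
proof -
  obtain a where a: "a \<in> A" using assms by auto
  define S where "S = {t. a + t *s (x - a) \<in> U}"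
  have "(\<lambda>t. f (a + t *s (x - a))) 1 = 0"
  proof (rule analytic_continuation_open[where s = "{t. a + t *s (x - a) \<in> A}" and s' = S and g = "\<lambda>_. 0"
      and f = "\<lambda>t. f (a + t *s (x - a))" and z = 1])
    show "open {t. a + t *s (x - a) \<in> A}" "open S"
      unfolding S_def using assms open_line_preimage by blast+
    show "{t. a + t *s (x - a) \<in> A} \<noteq> {}" using a by (auto intro!: exI[of _ 0])
    show "connected S" unfolding S_def using assms convex_line_preimage convex_connected by blast
    show "{t. a + t *s (x - a) \<in> A} \<subseteq> S" using assms by (auto simp: S_def)
    show "(\<lambda>t. f (a + t *s (x - a))) holomorphic_on S"
      using assms(1) unfolding line_holomorphic_def S_def by blast
    show "1 \<in> S" using assms by (simp add: S_def)
  qed (use zero in auto)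
  thus ?thesis by simp
qed

text \<open>Without convexity, vanishing near a point is propagated along the connected set through
  balls, each of which is convex.\<close>

lemma holomorphic_several_identity:
  fixes f :: "complex ^ ('n::finite) \<Rightarrow> complex"
  assumes "holomorphic_several f V" "open V" "connected V" "open A" "A \<noteq> {}" "A \<subseteq> V"
    and zero: "\<And>z. z \<in> A \<Longrightarrow> f z = 0" and "x \<in> V"
  shows "f x = 0"
proof -
  define P where "P = (\<lambda>x. \<exists>B. open B \<and> x \<in> B \<and> B \<subseteq> V \<and> (\<forall>z\<in>B. f z = 0))"
  obtain a where a: "a \<in> A" using assms by auto
  have "P x"
  proof (rule connected_induction_simple[OF assms(3)])
    show "a \<in> V" "x \<in> V" "P a" using a assms by (auto simp: P_def)
    fix y assume "y \<in> V"
    then obtain e where e: "e > 0" "ball y e \<subseteq> V" using \<open>open V\<close> openE by blast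
    have "P v" if "u \<in> ball y e" "v \<in> ball y e" "P u" for u v
    proof -
      obtain B where B: "open B" "u \<in> B" "\<forall>z\<in>B. f z = 0" using \<open>P u\<close> by (auto simp: P_def)
      have "f z = 0" if "z \<in> ball y e" for z
      proof (rule line_holomorphic_identity[where A = "B \<inter> ball y e" and U = "ball y e"])
        show "line_holomorphic f (ball y e)"
          using assms(1) e holomorphic_several_imp_line_holomorphic line_holomorphic_subset by blast
        show "B \<inter> ball y e \<noteq> {}" using B \<open>u \<in> ball y e\<close> by blast
      qed (use B \<open>z \<in> ball y e\<close> in auto)
      hence "\<forall>z\<in>ball y e. f z = 0" by blast
      thus ?thesis unfolding P_def using e \<open>v \<in> ball y e\<close> by (intro exI[of _ "ball y e"]) simp
    qed
    hence "\<forall>u\<in>ball y e. \<forall>v\<in>ball y e. P u \<longrightarrow> P v" by blast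
    moreover have "openin (top_of_set V) (ball y e)"
      using e by (simp add: open_subset)
    moreover have "y \<in> ball y e" using e by simp
    ultimately show "\<exists>T. openin (top_of_set V) T \<and> y \<in> T \<and> (\<forall>x\<in>T. \<forall>y\<in>T. P x \<longrightarrow> P y)"
      by (intro exI[of _ "ball y e"] conjI)
  qed
  thus ?thesis by (auto simp: P_def)
qed

text \<open>The identity theorem turns a denominator that is not identically zero on
  \<open>V\<close> into one that is nonzero somewhere in every nonempty open subset. In this form
  the condition survives shrinking \<open>V\<close> to a ball or to part of a ball.\<close>

lemma meromorphic_several_local_quotient:
  fixes F :: "complex ^ ('n::finite) \<Rightarrow> complex"
  assumes "meromorphic_several F B" "z \<in> B"
  obtains \<eta> f g where "\<eta> > 0" "ball z \<eta> \<subseteq> B" "holomorphic_several f (ball z \<eta>)"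
    "holomorphic_several g (ball z \<eta>)"
    "\<And>A. open A \<Longrightarrow> A \<noteq> {} \<Longrightarrow> A \<subseteq> ball z \<eta> \<Longrightarrow> \<exists>w\<in>A. g w \<noteq> 0"
    "\<And>w. w \<in> ball z \<eta> \<Longrightarrow> g w \<noteq> 0 \<Longrightarrow> F w = f w / g w"
proof -
  obtain V f g where V: "open V" "connected V" "z \<in> V" "V \<subseteq> B"
    "holomorphic_several f V" "holomorphic_several g V" "\<exists>w\<in>V. g w \<noteq> 0"
    "\<And>w. w\<in>V \<Longrightarrow> g w \<noteq> 0 \<Longrightarrow> F w = f w / g w"
    using assms unfolding meromorphic_several_def by meson
  obtain \<eta> where \<eta>: "\<eta> > 0" "ball z \<eta> \<subseteq> V" using V openE by blast
  show ?thesis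
  proof (rule that[of \<eta> f g])
    show "\<exists>w\<in>A. g w \<noteq> 0" if "open A" "A \<noteq> {}" "A \<subseteq> ball z \<eta>" for A
      using holomorphic_several_identity[OF V(6,1,2), of A] that \<eta> V(7) by blast
    show "holomorphic_several f (ball z \<eta>)" "holomorphic_several g (ball z \<eta>)"
      using V \<eta> holomorphic_several_subset by blast+
    show "ball z \<eta> \<subseteq> B" using V \<eta> by blast
  qed (use \<eta> V in blast)+
qed

lemma open_Int_nonzero:
  fixes g :: "complex ^ ('n::finite) \<Rightarrow> complex"
  assumes "holomorphic_several g V" "open V" "open A" "A \<subseteq> V"
  shows "open (A \<inter> {w. g w \<noteq> 0})"
proof -
  have "continuous_on A g"
    using assms holomorphic_several_continuous_on holomorphic_several_subset by blast
  from continuous_open_preimage[OF this \<open>open A\<close>, of "- {0}"]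
  have "open (A \<inter> g -` (- {0}))" by auto
  moreover have "A \<inter> g -` (- {0}) = A \<inter> {w. g w \<noteq> 0}" by auto
  ultimately show ?thesis by simp
qed

text \<open>The relation \<open>Z D = N\<close> is only ever known on open sets that are dense somewhere, because
  the representative of a meromorphic function is arbitrary on a nowhere dense set.\<close>

lemma quotient_representation:
  fixes Z D N f g :: "complex ^ ('n::finite) \<Rightarrow> complex"
  assumes T: "open T" "T \<noteq> {}" "T \<subseteq> C"
    and C: "open C" "convex C" "line_holomorphic D C" "line_holomorphic N C"
    and fg: "holomorphic_several f C" "holomorphic_several g C"
    and nz: "\<And>A. open A \<Longrightarrow> A \<noteq> {} \<Longrightarrow> A \<subseteq> C \<Longrightarrow> \<exists>w\<in>A. g w \<noteq> 0"
    and Z: "\<And>w. w \<in> T \<Longrightarrow> g w \<noteq> 0 \<Longrightarrow> Z w = f w / g w"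
    and eq: "\<And>w. w \<in> T \<Longrightarrow> Z w * D w = N w"
    and x: "x \<in> C"
  shows "f x * D x = g x * N x"
proof -
  have "(\<lambda>x. f x * D x - g x * N x) x = 0"
  proof (rule line_holomorphic_identity[where A = "T \<inter> {w. g w \<noteq> 0}" and U = C])
    show "line_holomorphic (\<lambda>x. f x * D x - g x * N x) C"
      by (intro line_holomorphic_diff line_holomorphic_mult C fg
          holomorphic_several_imp_line_holomorphic)
    show "open (T \<inter> {w. g w \<noteq> 0})"
      by (rule open_Int_nonzero[OF fg(2)]) (use T C in auto)
    show "T \<inter> {w. g w \<noteq> 0} \<noteq> {}" using nz[OF T] by auto
    show "f z * D z - g z * N z = 0" if "z \<in> T \<inter> {w. g w \<noteq> 0}" for z
    proof -
      have *: "Z z = f z / g z" "g z \<noteq> 0" "Z z * D z = N z" using that Z eq by blast+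
      show ?thesis using *(2) unfolding *(3)[symmetric] *(1) by simp
    qed
  qed (use T C x in auto)
  thus ?thesis by simp
qed

text \<open>The property carried along \<open>U\<close> is that every neighbourhood of the point
  inside \<open>U\<close> contains a nonempty open set on which the relation holds. One such set
  yields \<open>f D = g N\<close> on a whole convex piece by the identity theorem, and division by
  \<open>g\<close> returns the relation near every other point of the piece.\<close>

lemma meromorphic_identity_propagation:
  fixes Z D N :: "complex ^ ('n::finite) \<Rightarrow> complex"
  assumes mer: "meromorphic_several Z U0" and U: "open U" "convex U" "U \<subseteq> U0"
    and DN: "line_holomorphic D U" "line_holomorphic N U"
    and A: "open A" "A \<noteq> {}" "A \<subseteq> U" "\<And>w. w \<in> A \<Longrightarrow> Z w * D w = N w"
    and B: "open B" "B \<noteq> {}" "B \<subseteq> U"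
  obtains T where "open T" "T \<noteq> {}" "T \<subseteq> B" "\<And>w. w \<in> T \<Longrightarrow> Z w * D w = N w"
proof -
  define P where "P = (\<lambda>s. \<forall>B. open B \<and> s \<in> B \<and> B \<subseteq> U \<longrightarrow>
    (\<exists>T. open T \<and> T \<noteq> {} \<and> T \<subseteq> B \<and> (\<forall>w\<in>T. Z w * D w = N w)))"
  obtain a where a: "a \<in> A" using A by auto
  obtain b where b: "b \<in> B" using B by auto
  have "P b"
  proof (rule connected_induction_simple[of U])
    show "connected U" using U convex_connected by blast
    show "a \<in> U" "b \<in> U" using a b A B by auto
    show "P a" unfolding P_def
    proof (intro allI impI)
      fix B' assume "open B' \<and> a \<in> B' \<and> B' \<subseteq> U"
      thus "\<exists>T. open T \<and> T \<noteq> {} \<and> T \<subseteq> B' \<and> (\<forall>w\<in>T. Z w * D w = N w)"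
        using A a by (intro exI[of _ "A \<inter> B'"]) auto
    qed
    fix y assume "y \<in> U"
    hence "y \<in> U0" using U by auto
    obtain \<eta>0 f g where e0: "\<eta>0 > 0" "holomorphic_several f (ball y \<eta>0)"
      "holomorphic_several g (ball y \<eta>0)"
      "\<And>A. open A \<Longrightarrow> A \<noteq> {} \<Longrightarrow> A \<subseteq> ball y \<eta>0 \<Longrightarrow> \<exists>w\<in>A. g w \<noteq> 0"
      "\<And>w. w \<in> ball y \<eta>0 \<Longrightarrow> g w \<noteq> 0 \<Longrightarrow> Z w = f w / g w"
      by (rule meromorphic_several_local_quotient[OF mer \<open>y \<in> U0\<close>]) blast
    define C where "C = ball y \<eta>0 \<inter> U"
    have C: "open C" "convex C" "C \<subseteq> U" "C \<subseteq> ball y \<eta>0" "y \<in> C"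
      using U \<open>y \<in> U\<close> e0(1) by (auto simp: C_def intro: convex_Int)
    have "P v" if uv: "u \<in> C" "v \<in> C" "P u" for u v
    proof -
      obtain T where T: "open T" "T \<noteq> {}" "T \<subseteq> C" "\<forall>w\<in>T. Z w * D w = N w"
        using uv(3) uv(1) C(1,3) unfolding P_def by meson
      have eq: "f x * D x = g x * N x" if "x \<in> C" for x
      proof (rule quotient_representation[OF T(1-3) C(1,2)])
        show "line_holomorphic D C" by (rule line_holomorphic_subset[OF DN(1) C(3)])
        show "line_holomorphic N C" by (rule line_holomorphic_subset[OF DN(2) C(3)])
        show "holomorphic_several f C" by (rule holomorphic_several_subset[OF e0(2) C(4)])
        show "holomorphic_several g C" by (rule holomorphic_several_subset[OF e0(3) C(4)])
        show "\<exists>w\<in>A. g w \<noteq> 0" if "open A" "A \<noteq> {}" "A \<subseteq> C" for A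
          by (rule e0(4)[OF that(1,2)]) (use that C(4) in auto)
        show "Z w = f w / g w" if "w \<in> T" "g w \<noteq> 0" for w
          by (rule e0(5)) (use that C(4) T(3) in auto)
        show "Z w * D w = N w" if "w \<in> T" for w using T(4) that by simp
        show "x \<in> C" by fact
      qed
      show ?thesis unfolding P_def
      proof (intro allI impI)
        fix B' assume B': "open B' \<and> v \<in> B' \<and> B' \<subseteq> U"
        define T' where "T' = (B' \<inter> C) \<inter> {w. g w \<noteq> 0}"
        have "open T'" unfolding T'_def
          by (rule open_Int_nonzero[OF e0(3)]) (use B' C in auto)
        moreover have "\<exists>w\<in>B' \<inter> C. g w \<noteq> 0"
          by (rule e0(4)) (use B' C(1,4) uv in auto)
        hence "T' \<noteq> {}" by (auto simp: T'_def)
        moreover have "Z w * D w = N w" if "w \<in> T'" for w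
        proof -
          have "w \<in> C" "g w \<noteq> 0" using that by (auto simp: T'_def)
          hence "w \<in> ball y \<eta>0" using C(4) by auto
          from e0(5)[OF this \<open>g w \<noteq> 0\<close>] eq[OF \<open>w \<in> C\<close>] \<open>g w \<noteq> 0\<close>
          show ?thesis by simp
        qed
        ultimately show "\<exists>T. open T \<and> T \<noteq> {} \<and> T \<subseteq> B' \<and> (\<forall>w\<in>T. Z w * D w = N w)"
          by (intro exI[of _ T']) (auto simp: T'_def)
      qed
    qed
    hence "\<forall>x\<in>C. \<forall>y\<in>C. P x \<longrightarrow> P y" by blast
    moreover have "openin (top_of_set U) C"
      using C(1,3) by (simp add: open_subset)
    ultimately show "\<exists>T. openin (top_of_set U) T \<and> y \<in> T \<and> (\<forall>x\<in>T. \<forall>y\<in>T. P x \<longrightarrow> P y)"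
      using C(5) by (intro exI[of _ C] conjI)
  qed
  hence "\<exists>T. open T \<and> T \<noteq> {} \<and> T \<subseteq> B \<and> (\<forall>w\<in>T. Z w * D w = N w)"
    unfolding P_def using b B by (meson)
  thus ?thesis using that by blast
qed

section \<open>Holomorphy of locally uniformly convergent series and products\<close>

lemma holomorphic_on_suminf:
  fixes f :: "nat \<Rightarrow> complex \<Rightarrow> complex"
  assumes "open S" "\<And>n. f n holomorphic_on S"
    and M: "\<And>x. x \<in> S \<Longrightarrow> \<exists>d>0. \<exists>M. cball x d \<subseteq> S \<and> summable M \<and> (\<forall>n. \<forall>y\<in>cball x d. norm (f n y) \<le> M n)"
  shows "(\<lambda>x. suminf (\<lambda>n. f n x)) holomorphic_on S"
proof (rule holomorphic_uniform_sequence[where f = "\<lambda>n x. \<Sum>i<n. f i x"])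
  show "(\<lambda>x. \<Sum>i<n. f i x) holomorphic_on S" for n
    using assms by (intro holomorphic_intros)
  fix x assume "x \<in> S"
  from M[OF this] obtain d M where d: "d > 0" "cball x d \<subseteq> S" "summable M"
    "\<forall>n. \<forall>y\<in>cball x d. norm (f n y) \<le> M n" by auto
  have "uniform_limit (cball x d) (\<lambda>n x. \<Sum>i<n. f i x) (\<lambda>x. suminf (\<lambda>n. f n x)) sequentially"
    by (rule Weierstrass_m_test) (use d in auto)
  with d show "\<exists>d>0. cball x d \<subseteq> S \<and> uniform_limit (cball x d) (\<lambda>n x. \<Sum>i<n. f i x) (\<lambda>x. suminf (\<lambda>n. f n x)) sequentially"
    by blast
qed (use assms in auto)

lemma holomorphic_on_prodinf:
  fixes f :: "nat \<Rightarrow> complex \<Rightarrow> complex"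
  assumes "open S" "\<And>n. f n holomorphic_on S"
    and M: "\<And>x. x \<in> S \<Longrightarrow> \<exists>d>0. \<exists>M. cball x d \<subseteq> S \<and> summable M \<and> (\<forall>n. \<forall>y\<in>cball x d. norm (f n y - 1) \<le> M n)"
  shows "(\<lambda>x. prodinf (\<lambda>n. f n x)) holomorphic_on S"
proof (rule holomorphic_uniform_sequence[where f = "\<lambda>n x. \<Prod>i<n. f i x"])
  show "(\<lambda>x. \<Prod>i<n. f i x) holomorphic_on S" for n
    using assms by (intro holomorphic_intros)
  fix x assume "x \<in> S"
  from M[OF this] obtain d M where d: "d > 0" "cball x d \<subseteq> S" "summable M"
    "\<forall>n. \<forall>y\<in>cball x d. norm (f n y - 1) \<le> M n" by auto
  have "uniform_limit (cball x d) (\<lambda>n x. \<Prod>i<n. f i x) (\<lambda>x. lim (\<lambda>n. \<Prod>i<n. f i x)) sequentially"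
    unfolding uniformly_convergent_uniform_limit_iff[symmetric]
  proof (rule uniformly_convergent_on_prod')
    show "continuous_on (cball x d) (f n)" for n
      using assms(2) d(2) holomorphic_on_imp_continuous_on holomorphic_on_subset by blast
    show "uniformly_convergent_on (cball x d) (\<lambda>N x. \<Sum>n<N. norm (f n x - 1))"
      by (rule Weierstrass_m_test'[where M = M]) (use d in auto)
  qed auto
  \<comment> \<open>\<open>prodinf\<close> treats vanishing factors separately, so its agreement
    with the plain limit of the partial products is deduced from \<open>convergent_prod\<close>,
    which absolute summability of the deviations from 1 provides.\<close>
  moreover have "lim (\<lambda>n. \<Prod>i<n. f i y) = (prodinf (\<lambda>n. f n y))" if "y \<in> cball x d" for y
  proof -
    have "summable (\<lambda>n. norm (f n y - 1))"
      by (rule summable_comparison_test'[OF d(3)]) (use d(4) that in auto)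
    hence "convergent_prod (\<lambda>n. f n y)"
      by (intro abs_convergent_prod_imp_convergent_prod summable_imp_abs_convergent_prod)
    from convergent_prod_LIMSEQ[OF this]
    have "(\<lambda>n. \<Prod>i<Suc n. f i y) \<longlonglongrightarrow> (prodinf (\<lambda>n. f n y))"
      by (simp only: lessThan_Suc_atMost)
    thus ?thesis by (intro limI) (rule LIMSEQ_imp_Suc)
  qed
  hence "uniform_limit (cball x d) (\<lambda>n x. \<Prod>i<n. f i x) (\<lambda>x. lim (\<lambda>n. \<Prod>i<n. f i x)) sequentially
      \<longleftrightarrow> uniform_limit (cball x d) (\<lambda>n x. \<Prod>i<n. f i x) (\<lambda>x. prodinf (\<lambda>n. f n x)) sequentially"
    by (intro uniform_limit_cong') auto
  ultimately show "\<exists>d>0. cball x d \<subseteq> S \<and> uniform_limit (cball x d) (\<lambda>n x. \<Prod>i<n. f i x) (\<lambda>x. prodinf (\<lambda>n. f n x)) sequentially"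
    using d by blast
qed (use assms in auto)

section \<open>The Riemann zeta function in the right half-plane\<close>

text \<open>\<open>(s - 1) \<zeta>(s)\<close>, continued to \<open>Re s > 0\<close> by subtracting from \<open>\<Sum>n\<^sup>-\<^sup>s\<close> the telescoping series
  with terms \<open>(n\<^sup>1\<^sup>-\<^sup>s - (n + 1)\<^sup>1\<^sup>-\<^sup>s) / (s - 1)\<close>.\<close>

definition zeta_diff :: "nat \<Rightarrow> complex \<Rightarrow> complex" where
  "zeta_diff n s = (s - 1) * of_nat (Suc n) powr (-s) + of_nat (Suc (Suc n)) powr (1 - s) - of_nat (Suc n) powr (1 - s)"

definition zeta_reg :: "complex \<Rightarrow> complex" where
  "zeta_reg s = 1 + (suminf (\<lambda>n. zeta_diff n s))"

text \<open>\<open>zeta_diff n s\<close> is the Taylor remainder of order two of the function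
  x^(1-s) between n+1 and n+2. The second derivative s (s-1) x^(-s-1) gains one power of n over the
  Dirichlet series, whence convergence for Re s > 0.\<close>

lemma norm_zeta_diff_le:
  assumes "Re s \<ge> -1"
  shows "norm (zeta_diff n s) \<le> norm s * norm (s - 1) * of_nat (Suc n) powr (- Re s - 1)"
proof -
  define S where "S = closed_segment (of_nat (Suc n) :: complex) (of_nat (Suc (Suc n)))"
  define f where "f = (\<lambda>(i::nat) x::complex. if i = 0 then x powr (1 - s) else if i = 1 then (1 - s) * x powr (-s)
     else (1 - s) * (-s) * x powr (-s-1))"
  have S: "\<exists>t. x = complex_of_real t \<and> t \<ge> real (Suc n)" if x: "x \<in> S" for x
  proof -
    obtain u where u: "0 \<le> u" "u \<le> 1" "x = (1 - u) *\<^sub>R of_nat (Suc n) + u *\<^sub>R of_nat (Suc (Suc n))"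
      using x unfolding S_def closed_segment_def by blast
    have "(1 - u) *\<^sub>R of_nat (Suc n) + u *\<^sub>R of_nat (Suc (Suc n)) = complex_of_real (real (Suc n) + u)"
      by (simp add: scaleR_conv_of_real algebra_simps)
    with u(3) have "x = of_real (real (Suc n) + u)" by (rule trans)
    moreover have "real (Suc n) + u \<ge> real (Suc n)" using u(1) by simp
    ultimately show ?thesis by blast
  qed
  have "norm (f 0 (of_nat (Suc (Suc n))) - (\<Sum>i\<le>1. f i (of_nat (Suc n)) * (of_nat (Suc (Suc n)) - of_nat (Suc n)) ^ i / (fact i)))
          \<le> (norm s * norm (s - 1) * of_nat (Suc n) powr (- Re s - 1)) * norm (of_nat (Suc (Suc n)) - of_nat (Suc n) :: complex) ^ (Suc 1) / fact 1"
  proof (rule field_Taylor[where S = S and f = f and n = 1 and w = "of_nat (Suc n)" and z = "of_nat (Suc (Suc n))"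
        and B = "norm s * norm (s - 1) * of_nat (Suc n) powr (- Re s - 1)"])
    show "convex S" by (simp add: S_def)
    show "(f i has_field_derivative f (Suc i) x) (at x within S)" if x: "x \<in> S" "i \<le> 1" for i x
    proof -
      obtain t where t: "x = complex_of_real t" "t \<ge> real (Suc n)" using S[OF x(1)] by blast
      hence nz: "x \<notin> \<real>\<^sub>\<le>\<^sub>0" by (auto simp: complex_nonpos_Reals_iff)
      have "(f i has_field_derivative f (Suc i) x) (at x)"
      proof (cases "i = 0")
        case True
        thus ?thesis using has_field_derivative_powr[OF nz, of "1 - s"] by (simp add: f_def)
      next
        case False
        hence i: "i = 1" using x by simp
        show ?thesis using DERIV_cmult[OF has_field_derivative_powr[OF nz, of "- s"], of "1 - s"]
          by (simp add: f_def i mult.assoc)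
      qed
      thus ?thesis by (rule has_field_derivative_at_within)
    qed
    show "norm (f (Suc 1) x) \<le> norm s * norm (s - 1) * of_nat (Suc n) powr (- Re s - 1)" if x: "x \<in> S" for x
    proof -
      obtain t where t: "x = complex_of_real t" "t \<ge> real (Suc n)" using S[OF x] by blast
      have "norm (x powr (-s-1)) = t powr (- Re s - 1)"
        using t by (simp add: norm_powr_real_powr)
      also have "\<dots> \<le> real (Suc n) powr (- Re s - 1)"
        using t assms by (intro powr_mono2') auto
      finally show ?thesis
        by (simp add: f_def norm_mult norm_minus_commute[of 1 s] mult.commute[of "norm (s - 1)"] mult_left_mono)
    qed
  qed (simp_all add: S_def)
  also have "f 0 (of_nat (Suc (Suc n))) - (\<Sum>i\<le>1. f i (of_nat (Suc n)) * (of_nat (Suc (Suc n)) - of_nat (Suc n)) ^ i / (fact i)) = zeta_diff n s"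
  proof -
    have "{..1::nat} = {0, 1}" by auto
    hence "(\<Sum>i\<le>1. f i (of_nat (Suc n)) * (of_nat (Suc (Suc n)) - of_nat (Suc n)) ^ i / (fact i)) =
        of_nat (Suc n) powr (1 - s) + (1 - s) * of_nat (Suc n) powr (- s)"
      by (simp add: f_def)
    thus ?thesis by (simp add: f_def zeta_diff_def left_diff_distrib del: of_nat_Suc)
  qed
  finally show ?thesis by simp
qed

lemma summable_Suc_powr: "c > 0 \<Longrightarrow> summable (\<lambda>n. real (Suc n) powr (- c - 1))"
  by (subst summable_Suc_iff[of "\<lambda>n. real n powr (- c - 1)"]) (simp add: summable_real_powr_iff)

text \<open>Comparison with an integral, whose antiderivative is \<open>g\<close>. The dependence on
  \<open>c\<close> is explicit because the later zero count evaluates the zeta factors at points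
  whose real parts tend to 0.\<close>

lemma suminf_Suc_powr_le:
  assumes "c > 0"
  shows "(suminf (\<lambda>n. real (Suc n) powr (- c - 1))) \<le> 1 + 1 / c"
proof -
  define g where "g = (\<lambda>x::real. - (x powr (-c)) / c)"
  have step: "real (Suc (Suc n)) powr (-c-1) \<le> g (real (Suc (Suc n))) - g (real (Suc n))" for n
  proof -
    have "\<exists>z>real (Suc n). z < real (Suc (Suc n)) \<and> g (real (Suc (Suc n))) - g (real (Suc n)) = (real (Suc (Suc n)) - real (Suc n)) * z powr (-c-1)"
    proof (rule MVT2)
      show "DERIV g x :> x powr (-c-1)" if "real (Suc n) \<le> x" for x
        unfolding g_def using that assms by (auto intro!: derivative_eq_intros)
    qed auto
    then obtain z where z: "z > real (Suc n)" "z < real (Suc (Suc n))"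
      "g (real (Suc (Suc n))) - g (real (Suc n)) = z powr (-c-1)" by auto
    show ?thesis unfolding z(3) using z assms by (intro powr_mono2') auto
  qed
  have partial: "(\<Sum>n<N. real (Suc n) powr (- c - 1)) \<le> 1 + 1 / c" for N
  proof (cases N)
    case (Suc m)
    have "(\<Sum>n<N. real (Suc n) powr (- c - 1)) = 1 + (\<Sum>n<m. real (Suc (Suc n)) powr (-c-1))"
      unfolding Suc by (subst sum.lessThan_Suc_shift) simp
    also have "(\<Sum>n<m. real (Suc (Suc n)) powr (-c-1)) \<le> (\<Sum>n<m. g (real (Suc (Suc n))) - g (real (Suc n)))"
      by (intro sum_mono step)
    also have "\<dots> = g (real (Suc m)) - g 1"
      using sum_lessThan_telescope[of "\<lambda>n. g (real (Suc n))" m] by simp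
    also have "\<dots> \<le> 1 / c" using assms by (simp add: g_def)
    finally show ?thesis by simp
  qed (use assms in auto)
  show ?thesis
    by (rule suminf_le_const) (use assms partial summable_Suc_powr[of c] in auto)
qed

lemma norm_zeta_reg_le:
  assumes "Re s > 0"
  shows "norm (zeta_reg s) \<le> 1 + norm s * norm (s - 1) * (1 + 1 / Re s)"
proof -
  have sm: "summable (\<lambda>n. norm s * norm (s - 1) * (real (Suc n) powr (- Re s - 1)))"
    using summable_Suc_powr[of "Re s"] assms by (intro summable_mult)
  have "norm (suminf (\<lambda>n. zeta_diff n s)) \<le> (suminf (\<lambda>n. norm s * norm (s - 1) * (real (Suc n) powr (- Re s - 1))))"
    using norm_zeta_diff_le[of s] assms sm by (intro norm_suminf_le) auto
  also have "\<dots> = norm s * norm (s - 1) * (suminf (\<lambda>n. real (Suc n) powr (- Re s - 1)))"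
    using summable_Suc_powr[of "Re s"] assms by (intro suminf_mult)
  also have "\<dots> \<le> norm s * norm (s - 1) * (1 + 1 / Re s)"
    by (intro mult_left_mono suminf_Suc_powr_le assms) auto
  finally show ?thesis
    unfolding zeta_reg_def by (intro order.trans[OF norm_triangle_ineq]) simp
qed

lemma holomorphic_zeta_reg: "zeta_reg holomorphic_on {s. Re s > 0}"
proof -
  have "(\<lambda>s. suminf (\<lambda>n. zeta_diff n s)) holomorphic_on {s. Re s > 0}"
  proof (rule holomorphic_on_suminf)
    show "open {s. Re s > 0}" by (rule open_halfspace_Re_gt)
    show "zeta_diff n holomorphic_on {s. Re s > 0}" for n
      unfolding zeta_diff_def by (intro holomorphic_intros)
    fix x :: complex assume "x \<in> {s. Re s > 0}"
    define d where "d = Re x / 2"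
    have d: "d > 0" using \<open>x \<in> _\<close> by (simp add: d_def)
    define M where "M = (\<lambda>n. (norm x + d) * (norm x + d + 1) * real (Suc n) powr (- d - 1))"
    have Re: "Re y \<ge> d" if "y \<in> cball x d" for y
    proof -
      have "\<bar>Re (x - y)\<bar> \<le> d" using that abs_Re_le_cmod[of "x - y"] by (auto simp: dist_norm)
      hence "Re x - Re y \<le> d" by (auto simp del: minus_complex.sel simp: minus_complex.sel(1))
      thus ?thesis by (simp add: d_def)
    qed
    have "norm (zeta_diff n y) \<le> M n" if "y \<in> cball x d" for n y
    proof -
      have "norm y \<le> norm x + d" using that norm_triangle_sub[of y x] by (simp add: dist_norm norm_minus_commute)
      moreover have "norm (y - 1) \<le> norm y + 1" using norm_triangle_ineq4[of y 1] by simp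
      moreover have "real (Suc n) powr (- Re y - 1) \<le> real (Suc n) powr (- d - 1)"
        using Re[OF that] by (intro powr_mono) auto
      moreover have "norm (zeta_diff n y) \<le> norm y * norm (y - 1) * of_nat (Suc n) powr (- Re y - 1)"
        using Re[OF that] d by (intro norm_zeta_diff_le) auto
      ultimately show ?thesis unfolding M_def
        by (intro order.trans[OF \<open>norm (zeta_diff n y) \<le> _\<close>] mult_mono) (use d in auto)
    qed
    moreover have "cball x d \<subseteq> {s. Re s > 0}" using Re d by force
    moreover have "summable M"
      unfolding M_def using summable_Suc_powr[of d] d by (intro summable_mult)
    ultimately show "\<exists>d>0. \<exists>M. cball x d \<subseteq> {s. 0 < Re s} \<and> summable M \<and> (\<forall>n. \<forall>y\<in>cball x d. cmod (zeta_diff n y) \<le> M n)"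
      using d by blast
  qed
  thus ?thesis unfolding zeta_reg_def [abs_def] by (intro holomorphic_intros)
qed

lemma abs_summable_zeta:
  assumes "Re s > 1"
  shows "(\<lambda>n. norm (of_nat n powr (-s) :: complex)) summable_on A"
proof -
  have eq: "norm (of_nat n powr (-s) :: complex) = real n powr (- Re s)" for n
    by (cases "n = 0") (simp_all add: norm_powr_real_powr)
  have "(\<lambda>n. norm (of_nat n powr (-s) :: complex)) summable_on UNIV"
    unfolding eq by (subst summable_on_UNIV_nonneg_real_iff) (use assms in \<open>auto simp: summable_real_powr_iff\<close>)
  thus ?thesis using summable_on_subset_banach by blast
qed

text \<open>For Re s > 1 the correction terms telescope to -1, which cancels the 1 in
  \<open>zeta_reg\<close>.\<close>

lemma zeta_reg_eq:
  assumes "Re s > 1"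
  shows "zeta_reg s = (s - 1) * (\<Sum>\<^sub>\<infinity>n. of_nat n powr (-s))"
proof -
  have "(\<lambda>n. of_nat n powr (-s) :: complex) summable_on UNIV"
    by (rule abs_summable_summable[OF abs_summable_zeta[OF assms]])
  hence "((\<lambda>n. of_nat n powr (-s) :: complex) has_sum (\<Sum>\<^sub>\<infinity>n. of_nat n powr (-s))) UNIV" by simp
  hence "(\<lambda>n. of_nat n powr (-s) :: complex) sums (\<Sum>\<^sub>\<infinity>n. of_nat n powr (-s))" by (rule has_sum_imp_sums)
  \<comment> \<open>The index 0 may be dropped because \<open>0 powr z = 0\<close>.\<close>
  hence 1: "(\<lambda>n. of_nat (Suc n) powr (-s) :: complex) sums (\<Sum>\<^sub>\<infinity>n. of_nat n powr (-s))"
    by (subst sums_Suc_iff) simp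
  have "(\<lambda>n. of_nat (Suc n) powr (1 - s) :: complex) \<longlonglongrightarrow> 0"
  proof (rule Lim_null_comparison)
    show "\<forall>\<^sub>F n in sequentially. norm (of_nat (Suc n) powr (1 - s) :: complex) \<le> real (Suc n) powr (1 - Re s)"
      by (intro always_eventually allI) (simp add: norm_powr_real_powr del: of_nat_Suc)
    have "(\<lambda>n. real n powr (1 - Re s)) \<longlonglongrightarrow> 0"
      using assms by (intro tendsto_neg_powr filterlim_real_sequentially) auto
    thus "(\<lambda>n. real (Suc n) powr (1 - Re s)) \<longlonglongrightarrow> 0" by (rule LIMSEQ_Suc)
  qed
  from telescope_sums[OF this]
  have 2: "(\<lambda>n. of_nat (Suc (Suc n)) powr (1 - s) - of_nat (Suc n) powr (1 - s) :: complex) sums (-1)"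
    by simp
  from sums_add[OF sums_mult[OF 1, of "s - 1"] 2]
  have "(\<lambda>n. zeta_diff n s) sums ((s - 1) * (\<Sum>\<^sub>\<infinity>n. of_nat n powr (-s)) + (-1))"
    by (simp add: zeta_diff_def[abs_def] add_diff_eq)
  thus ?thesis unfolding zeta_reg_def by (simp add: sums_iff)
qed

text \<open>The multiples of p among the numbers free of prime factors from \<open>P\<close> are
  exactly p times such numbers, so multiplication by 1 - p^(-s) removes them.\<close>

lemma zeta_sieve:
  assumes s: "Re s > 1" and "finite P" "\<And>p. p \<in> P \<Longrightarrow> prime p"
  shows "(\<Prod>p\<in>P. 1 - of_nat p powr (-s)) * (\<Sum>\<^sub>\<infinity>n. of_nat n powr (-s)) =
           (\<Sum>\<^sub>\<infinity>n\<in>{n. \<forall>p\<in>P. \<not> p dvd n}. of_nat n powr (-s) :: complex)"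
  using assms(2,3)
proof (induction P rule: finite_induct)
  case (insert p P)
  define f where "f = (\<lambda>n. of_nat n powr (-s) :: complex)"
  define A where "A = {n. \<forall>p\<in>P. \<not> p dvd n}"
  have [simp]: "f summable_on B" for B
    unfolding f_def by (rule abs_summable_summable[OF abs_summable_zeta[OF s]])
  have p: "prime p" and P: "\<And>q. q \<in> P \<Longrightarrow> prime q" using insert by auto
  have "{n\<in>A. p dvd n} = (*) p ` A"
  proof (intro equalityI subsetI)
    fix n assume "n \<in> {n\<in>A. p dvd n}"
    then obtain m where "n = p * m" "n \<in> A" by auto
    moreover have "m \<in> A" using calculation by (auto simp: A_def)
    ultimately show "n \<in> (*) p ` A" by blast
  next
    fix n assume "n \<in> (*) p ` A"
    then obtain m where m: "n = p * m" "m \<in> A" by auto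
    have "\<not> q dvd p * m" if "q \<in> P" for q
    proof
      assume "q dvd p * m"
      hence "q dvd p \<or> q dvd m" using P[OF that] prime_dvd_mult_iff by blast
      hence "q dvd p" using m that by (auto simp: A_def)
      hence "q = p" by (rule primes_dvd_imp_eq[OF P[OF that] p])
      thus False using that insert by auto
    qed
    thus "n \<in> {n\<in>A. p dvd n}" using m by (auto simp: A_def)
  qed
  hence "infsum f {n\<in>A. p dvd n} = infsum f ((*) p ` A)" by simp
  also have "\<dots> = infsum (f \<circ> (*) p) A"
    using p by (intro infsum_reindex) (auto simp: inj_on_def)
  also have "f \<circ> (*) p = (\<lambda>n. of_nat p powr (-s) * f n)"
  proof
    show "(f \<circ> (*) p) n = of_nat p powr (-s) * f n" for n
      unfolding f_def o_def of_nat_mult by (rule powr_times_real) auto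
  qed
  also have "infsum \<dots> A = of_nat p powr (-s) * infsum f A"
    by (rule infsum_cmult_right')
  finally have 1: "infsum f {n\<in>A. p dvd n} = of_nat p powr (-s) * infsum f A" .
  have "infsum f A = infsum f ({n\<in>A. p dvd n} \<union> {n\<in>A. \<not> p dvd n})"
    by (intro arg_cong[where f = "infsum f"]) auto
  also have "\<dots> = infsum f {n\<in>A. p dvd n} + infsum f {n\<in>A. \<not> p dvd n}"
    by (rule infsum_Un_disjoint) auto
  finally have "infsum f {n\<in>A. \<not> p dvd n} = (1 - of_nat p powr (-s)) * infsum f A"
    using 1 by (simp add: algebra_simps)
  moreover have "{n\<in>A. \<not> p dvd n} = {n. \<forall>q\<in>insert p P. \<not> q dvd n}" by (auto simp: A_def)
  ultimately show ?case using insert by (simp add: f_def A_def mult.assoc)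
qed auto

text \<open>After sieving by the primes up to n, the surviving terms other than the term 1 have
  index above n, apart from a possible zero term, and are bounded by the tail of the Dirichlet
  series.\<close>

lemma zeta_euler_product:
  assumes s: "Re s > 1"
  shows "convergent_prod (\<lambda>p. if prime p then 1 - of_nat p powr (-s) else 1 :: complex)" (is "convergent_prod ?f")
    and "(prodinf (\<lambda>p. if prime p then 1 - of_nat p powr (-s) else 1)) * (\<Sum>\<^sub>\<infinity>n. of_nat n powr (-s)) = (1 :: complex)"
proof -
  have eq: "norm (of_nat n powr (-s) :: complex) = real n powr (- Re s)" for n
    by (cases "n = 0") (simp_all add: norm_powr_real_powr)
  have sm: "summable (\<lambda>n. real n powr (- Re s))" using s by (simp add: summable_real_powr_iff)
  have "summable (\<lambda>n. norm (?f n - 1))"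
    by (rule summable_comparison_test'[OF sm]) (auto simp: eq)
  thus cp: "convergent_prod ?f"
    by (intro abs_convergent_prod_imp_convergent_prod summable_imp_abs_convergent_prod)
  let ?z = "\<Sum>\<^sub>\<infinity>n. of_nat n powr (-s) :: complex"
  from convergent_prod_LIMSEQ[OF cp]
  have "(\<lambda>n. (\<Prod>i\<le>n. ?f i) * ?z) \<longlonglongrightarrow> prodinf ?f * ?z" by (intro tendsto_intros)
  moreover have "(\<lambda>n. (\<Prod>i\<le>n. ?f i) * ?z) \<longlonglongrightarrow> 1"
  proof -
    define f where "f = (\<lambda>n. of_nat n powr (-s) :: complex)"
    define T where "T = (suminf (\<lambda>n. real n powr (- Re s)))"
    have [simp]: "f summable_on B" "(\<lambda>n. norm (f n)) summable_on B" for B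
      unfolding f_def using abs_summable_summable[OF abs_summable_zeta[OF s]] abs_summable_zeta[OF s] by auto
    have T: "infsum (\<lambda>n. norm (f n)) UNIV = T"
    proof -
      have "(\<lambda>n. norm (f n)) sums infsum (\<lambda>n. norm (f n)) UNIV"
        by (intro has_sum_imp_sums has_sum_infsum) simp
      thus ?thesis unfolding T_def f_def eq by (simp add: sums_iff)
    qed
    have bound: "norm ((\<Prod>i\<le>n. ?f i) * ?z - 1) \<le> T - (\<Sum>i\<le>n. real i powr (- Re s))" if "n \<ge> 1" for n
    proof -
      define P where "P = {p. prime p \<and> p \<le> n}"
      define A where "A = {n. \<forall>p\<in>P. \<not> p dvd n}"
      have [simp]: "finite P" by (rule finite_subset[of _ "{..n}"]) (auto simp: P_def)
      have "(\<Prod>i\<le>n. ?f i) = (\<Prod>p\<in>P. 1 - of_nat p powr (-s))"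
        by (rule prod.mono_neutral_cong_right) (auto simp: P_def)
      also have "\<dots> * ?z = infsum f A"
        unfolding A_def f_def by (rule zeta_sieve[OF s]) (auto simp: P_def)
      also have "\<dots> = infsum f ({1} \<union> (A - {1}))"
        by (intro arg_cong[where f = "infsum f"]) (auto simp: A_def P_def dest: prime_gt_1_nat)
      also have "\<dots> = f 1 + infsum f (A - {1})"
        by (subst infsum_Un_disjoint) auto
      finally have "(\<Prod>i\<le>n. ?f i) * ?z - 1 = infsum f (A - {1})" by (simp add: f_def)
      hence "norm ((\<Prod>i\<le>n. ?f i) * ?z - 1) = norm (infsum f (A - {1}))" by simp
      also have "\<dots> \<le> infsum (\<lambda>n. norm (f n)) (A - {1})" by (rule norm_infsum_bound) simp
      also have "\<dots> \<le> infsum (\<lambda>n. norm (f n)) (- {..n} \<union> {0})"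
      proof (rule infsum_mono2)
        show "A - {1} \<subseteq> - {..n} \<union> {0}"
        proof
          fix m assume m: "m \<in> A - {1}"
          show "m \<in> - {..n} \<union> {0}"
          proof (rule ccontr)
            assume "m \<notin> - {..n} \<union> {0}"
            hence "m \<le> n" "m \<noteq> 0" "m \<noteq> 1" using m by auto
            then obtain p where "prime p" "p dvd m" using prime_factor_nat by blast
            moreover from this \<open>m \<noteq> 0\<close> have "p \<le> m" by (intro dvd_imp_le) auto
            ultimately show False using m \<open>m \<le> n\<close> by (auto simp: A_def P_def)
          qed
        qed
      qed auto
      also have "\<dots> = infsum (\<lambda>n. norm (f n)) (- {..n})"
        by (intro infsum_cong_neutral) (auto simp: f_def)
      also have "\<dots> = T - (\<Sum>i\<le>n. norm (f i))"
      proof -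
        have "T = infsum (\<lambda>n. norm (f n)) ({..n} \<union> - {..n})" using T by (simp only: Compl_partition)
        also have "\<dots> = (\<Sum>i\<le>n. norm (f i)) + infsum (\<lambda>n. norm (f n)) (- {..n})"
          by (subst infsum_Un_disjoint) auto
        finally show ?thesis by simp
      qed
      finally show ?thesis by (simp add: f_def eq)
    qed
    have lim: "(\<lambda>n. T - (\<Sum>i\<le>n. real i powr (- Re s))) \<longlonglongrightarrow> 0"
      using tendsto_diff[OF tendsto_const[of T] summable_LIMSEQ'[OF sm]] by (simp add: T_def)
    have "(\<lambda>n. (\<Prod>i\<le>n. ?f i) * ?z - 1) \<longlonglongrightarrow> 0"
      by (rule Lim_null_comparison[OF _ lim]) (use bound in \<open>auto intro!: eventually_sequentiallyI[of 1]\<close>)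
    thus ?thesis by (subst LIM_zero_iff[symmetric])
  qed
  ultimately show "prodinf ?f * ?z = 1" using LIMSEQ_unique by blast
qed

lemma zeta_reg_nonzero: "Re s > 1 \<Longrightarrow> zeta_reg s \<noteq> 0"
  using zeta_euler_product(2)[of s] zeta_reg_eq[of s] by auto

lemma zeta_reg_1: "zeta_reg 1 = 1"
  using of_nat_Suc of_nat_neq_0 by (simp add: zeta_reg_def zeta_diff_def del: of_nat_Suc)

text \<open>Both X - 1 and the term of index 1 are at least 1, the other terms being nonnegative.
  This is the lower bound at the centre of the disc in the zero count.\<close>

lemma norm_zeta_reg_ge_1:
  assumes "X \<ge> 2"
  shows "norm (zeta_reg (of_real X)) \<ge> 1"
proof -
  have "((\<lambda>n. of_nat n powr (- of_real X) :: complex) has_sum (\<Sum>\<^sub>\<infinity>n. of_nat n powr (- of_real X))) UNIV"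
    using abs_summable_summable[OF abs_summable_zeta[of "of_real X"]] assms by auto
  from has_sum_Re[OF this]
  have h: "((\<lambda>n. Re (of_nat n powr (- of_real X) :: complex)) has_sum Re (\<Sum>\<^sub>\<infinity>n. of_nat n powr (- of_real X))) UNIV" .
  have eq: "Re (of_nat n powr (- of_real X) :: complex) = real n powr (-X)" for n
    using powr_of_real[of "real n" "-X"] by simp
  have "(\<Sum>n\<in>{1::nat}. real n powr (-X)) \<le> Re (\<Sum>\<^sub>\<infinity>n. of_nat n powr (- of_real X))"
    by (rule has_sum_mono_neutral[OF has_sum_finite h]) (auto simp: eq)
  hence "1 \<le> norm (\<Sum>\<^sub>\<infinity>n. of_nat n powr (- of_real X) :: complex)"
    using complex_Re_le_cmod[of "\<Sum>\<^sub>\<infinity>n. of_nat n powr (- of_real X)"] by (simp add: powr_minus)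
  moreover have "norm (of_real X - 1 :: complex) = X - 1"
    using assms norm_of_real[of "X - 1", where 'a = complex] by simp
  ultimately have "1 * 1 \<le> norm (of_real X - 1 :: complex) * norm (\<Sum>\<^sub>\<infinity>n. of_nat n powr (- of_real X) :: complex)"
    using assms by (intro mult_mono) auto
  thus ?thesis using zeta_reg_eq[of "of_real X"] assms by (simp add: norm_mult)
qed

lemma countable_zeta_reg_zeros: "countable {s. Re s > 0 \<and> zeta_reg s = 0}"
proof -
  have "countable {z\<in>{s. Re s > 0}. zeta_reg z = 0}"
  proof (cases "zeta_reg constant_on {s. Re s > 0}")
    case True
    hence "zeta_reg z = 1" if "Re z > 0" for z
      using that zeta_reg_1 by (fastforce simp: constant_on_def)
    hence "{z\<in>{s. Re s > 0}. zeta_reg z = 0} = {}" by auto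
    thus ?thesis by (simp only: countable_empty)
  next
    case False
    show ?thesis
    proof (rule holomorphic_countable_zeros[OF holomorphic_zeta_reg])
      show "open {s. Re s > 0}" by (rule open_halfspace_Re_gt)
      show "connected {s. Re s > 0}" by (simp add: convex_connected convex_halfspace_Re_gt)
      show "fsigma {s. Re s > 0}"
      proof -
        obtain C :: "nat \<Rightarrow> complex set" where "\<And>n. compact (C n)" "\<Union>(range C) = {s. Re s > 0}"
          using open_Union_compact_subsets[OF open_halfspace_Re_gt[of 0]] by metis
        hence "range C \<subseteq> Collect compact \<and> {s. Re s > 0} = \<Union>(range C)" by auto
        thus ?thesis unfolding fsigma_Union_compact by blast
      qed
    qed (use False in auto)
  qed
  thus ?thesis by simp
qed

section \<open>Factoring the Euler factor into cyclotomic factors\<close>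

definition mono_val :: "complex ^ 'n \<Rightarrow> nat ^ ('n::finite) \<Rightarrow> complex" where
  "mono_val x \<beta> = (\<Prod>i\<in>UNIV. (x $ i) ^ (\<beta> $ i))"

lemma mono_val_0 [simp]: "mono_val x 0 = 1"
  by (simp add: mono_val_def)

lemma mono_val_add: "mono_val x (\<beta> + \<gamma>) = mono_val x \<beta> * mono_val x \<gamma>"
  by (simp add: mono_val_def power_add prod.distrib)

text \<open>The number of summands is recorded separately because one exponent may be a sum of
  elements of \<open>A\<close> in several ways; the order of an error term is this number.\<close>

inductive alpha_sum :: "(nat ^ 'n) set \<Rightarrow> nat \<Rightarrow> nat ^ 'n \<Rightarrow> bool" for A where
  zero: "alpha_sum A 0 0"
| step: "alpha_sum A k \<beta> \<Longrightarrow> \<gamma> \<in> A \<Longrightarrow> alpha_sum A (Suc k) (\<beta> + \<gamma>)"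

lemma alpha_sum_add:
  assumes "alpha_sum A l \<gamma>" "alpha_sum A k \<beta>"
  shows "alpha_sum A (k + l) (\<beta> + \<gamma>)"
  using assms
proof (induction rule: alpha_sum.induct)
  case (step l \<gamma> \<gamma>')
  thus ?case using alpha_sum.step[of A "k + l" "\<beta> + \<gamma>" \<gamma>'] by (simp add: add.assoc)
qed auto

definition alpha_sums :: "(nat ^ 'n) set \<Rightarrow> nat \<Rightarrow> (nat ^ 'n) set" where
  "alpha_sums A N = {\<beta>. \<exists>k\<ge>N. alpha_sum A k \<beta>}"

lemma alpha_sums_add: "\<beta> \<in> alpha_sums A M \<Longrightarrow> \<gamma> \<in> alpha_sums A N \<Longrightarrow> \<beta> + \<gamma> \<in> alpha_sums A (M + N)"
  unfolding alpha_sums_def using alpha_sum_add by (smt (verit) add_mono mem_Collect_eq)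

text \<open>Integer combinations of monomials whose exponents are sums of at least \<open>N\<close> elements of \<open>A\<close>; they
  are of order \<open>N\<close> in the size of the monomials with exponents in \<open>A\<close>.\<close>

inductive_set ordspan :: "(nat ^ ('n::finite)) set \<Rightarrow> nat \<Rightarrow> (complex ^ 'n \<Rightarrow> complex) set" for A N where
  zero: "(\<lambda>_. 0) \<in> ordspan A N"
| base: "\<beta> \<in> alpha_sums A N \<Longrightarrow> (\<lambda>x. mono_val x \<beta>) \<in> ordspan A N"
| add: "f \<in> ordspan A N \<Longrightarrow> g \<in> ordspan A N \<Longrightarrow> (\<lambda>x. f x + g x) \<in> ordspan A N"
| uminus: "f \<in> ordspan A N \<Longrightarrow> (\<lambda>x. - f x) \<in> ordspan A N"

lemma ordspan_diff: "f \<in> ordspan A N \<Longrightarrow> g \<in> ordspan A N \<Longrightarrow> (\<lambda>x. f x - g x) \<in> ordspan A N"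
  using ordspan.add[OF _ ordspan.uminus] by simp

lemma ordspan_mono:
  assumes "f \<in> ordspan A N" "M \<le> N"
  shows "f \<in> ordspan A M"
  using assms
proof (induction rule: ordspan.induct)
  case (base \<beta>)
  hence "\<beta> \<in> alpha_sums A M" using order_trans unfolding alpha_sums_def by blast
  thus ?case by (rule ordspan.base)
qed (auto intro: ordspan.intros)

lemma ordspan_mult:
  assumes "f \<in> ordspan A M" "g \<in> ordspan A N"
  shows "(\<lambda>x. f x * g x) \<in> ordspan A (M + N)"
  using assms(1)
proof (induction rule: ordspan.induct)
  case zero
  thus ?case using ordspan.zero by simp
next
  case (add f1 f2)
  thus ?case using ordspan.add[OF add.IH] by (simp add: distrib_right)
next
  case (uminus f)
  thus ?case using ordspan.uminus[OF uminus.IH] by simp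
next
  case (base \<beta>)
  show ?case using assms(2)
  proof (induction rule: ordspan.induct)
    case zero
    thus ?case using ordspan.zero by simp
  next
    case (add f1 f2)
    thus ?case using ordspan.add[OF add.IH] by (simp add: distrib_left)
  next
    case (uminus f)
    thus ?case using ordspan.uminus[OF uminus.IH] by simp
  next
    case (base \<gamma>)
    have "\<beta> + \<gamma> \<in> alpha_sums A (M + N)" by (rule alpha_sums_add) fact+
    from ordspan.base[OF this] show ?case by (simp add: mono_val_add)
  qed
qed

lemma ordspan_of_int_mult:
  assumes "f \<in> ordspan A N"
  shows "(\<lambda>x. of_int c * f x) \<in> ordspan A N"
proof -
  have nat: "(\<lambda>x. of_nat k * f x) \<in> ordspan A N" for k
  proof (induction k)
    case (Suc k)
    from ordspan.add[OF assms Suc] show ?case by (simp add: algebra_simps)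
  qed (auto intro: ordspan.zero)
  show ?thesis
  proof (cases "c \<ge> 0")
    case True
    thus ?thesis using nat[of "nat c"] by simp
  next
    case False
    thus ?thesis using ordspan.uminus[OF nat[of "nat (-c)"]] by simp
  qed
qed

lemma ordspan_sum:
  assumes "\<And>i. i \<in> I \<Longrightarrow> f i \<in> ordspan A N"
  shows "(\<lambda>x. \<Sum>i\<in>I. f i x) \<in> ordspan A N"
  using assms by (induction I rule: infinite_finite_induct) (auto intro: ordspan.zero ordspan.add)

text \<open>The constant is uniform in the point and in t. With t = p^(-\<delta>) this turns the
  formal order into decay in p that is uniform on \<open>W(\<delta>)\<close>.\<close>

lemma ordspan_bound:
  assumes "f \<in> ordspan A N"
  shows "\<exists>C\<ge>0. \<forall>x t. 0 \<le> t \<and> t \<le> 1 \<and> (\<forall>\<beta>\<in>A. norm (mono_val x \<beta>) \<le> t) \<longrightarrow> norm (f x) \<le> C * t ^ N"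
  using assms
proof (induction rule: ordspan.induct)
  case (base \<beta>)
  then obtain k where k: "k \<ge> N" "alpha_sum A k \<beta>" by (auto simp: alpha_sums_def)
  have "norm (mono_val x \<beta>) \<le> t ^ N" if t: "0 \<le> t" "t \<le> 1" "\<forall>\<beta>\<in>A. norm (mono_val x \<beta>) \<le> t" for x t
  proof -
    have "norm (mono_val x \<beta>) \<le> t ^ k" using k(2)
    proof (induction rule: alpha_sum.induct)
      case (step k \<beta> \<gamma>)
      hence "norm (mono_val x \<beta>) * norm (mono_val x \<gamma>) \<le> t ^ k * t"
        using t by (intro mult_mono) auto
      thus ?case by (simp add: mono_val_add norm_mult mult.commute)
    qed auto
    also have "t ^ k \<le> t ^ N" using k t by (intro power_decreasing)
    finally show ?thesis .
  qed
  thus ?case by (intro exI[of _ 1]) auto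
next
  case (add f g)
  then obtain C D where CD: "C \<ge> 0" "D \<ge> 0"
    "\<And>x t. 0 \<le> t \<and> t \<le> 1 \<and> (\<forall>\<beta>\<in>A. norm (mono_val x \<beta>) \<le> t) \<Longrightarrow> norm (f x) \<le> C * t ^ N"
    "\<And>x t. 0 \<le> t \<and> t \<le> 1 \<and> (\<forall>\<beta>\<in>A. norm (mono_val x \<beta>) \<le> t) \<Longrightarrow> norm (g x) \<le> D * t ^ N"
    by metis
  show ?case
  proof (intro exI[of _ "C + D"] conjI allI impI)
    fix x t assume "0 \<le> t \<and> t \<le> 1 \<and> (\<forall>\<beta>\<in>A. norm (mono_val x \<beta>) \<le> t)"
    from CD(3)[OF this] CD(4)[OF this] show "norm (f x + g x) \<le> (C + D) * t ^ N"
      by (simp add: distrib_right norm_triangle_le)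
  qed (use CD in auto)
qed (auto intro!: exI[of _ 0])

text \<open>A list instead of a set, since repetition of an exponent encodes a power of its
  factor.\<close>

definition cyc_prod :: "complex ^ 'n \<Rightarrow> (nat ^ ('n::finite)) list \<Rightarrow> complex" where
  "cyc_prod x L = (\<Prod>\<beta>\<leftarrow>L. 1 - mono_val x \<beta>)"

lemma cyc_prod_append: "cyc_prod x (P @ Q) = cyc_prod x P * cyc_prod x Q"
  by (simp add: cyc_prod_def)

lemma ordspan_sum_list:
  assumes "set L \<subseteq> alpha_sums A N"
  shows "(\<lambda>x. \<Sum>\<beta>\<leftarrow>L. mono_val x \<beta>) \<in> ordspan A N"
  using assms by (induction L) (auto intro: ordspan.intros)

text \<open>All terms beyond the linear ones are products of at least two monomials of order
  \<open>N\<close>, hence of order at least 2 N, which is at least N + 1.\<close>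

lemma ordspan_cyc_prod_linear:
  assumes "set L \<subseteq> alpha_sums A N" "N \<ge> 1"
  shows "(\<lambda>x. cyc_prod x L - 1 + (\<Sum>\<beta>\<leftarrow>L. mono_val x \<beta>)) \<in> ordspan A (Suc N)"
  using assms(1)
proof (induction L)
  case Nil
  thus ?case using ordspan.zero by (simp add: cyc_prod_def)
next
  case (Cons \<beta> L)
  define f where "f = (\<lambda>x. cyc_prod x L - 1 + (\<Sum>\<beta>\<leftarrow>L. mono_val x \<beta>))"
  define S where "S = (\<lambda>x. \<Sum>\<beta>\<leftarrow>L. mono_val x \<beta>)"
  have f: "f \<in> ordspan A (Suc N)" using Cons by (simp add: f_def)
  have S: "S \<in> ordspan A N" unfolding S_def using Cons by (intro ordspan_sum_list) auto
  have b: "(\<lambda>x. mono_val x \<beta>) \<in> ordspan A N" using Cons by (intro ordspan.base) auto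
  have "(\<lambda>x. mono_val x \<beta> * S x) \<in> ordspan A (N + N)" "(\<lambda>x. mono_val x \<beta> * f x) \<in> ordspan A (N + Suc N)"
    by (intro ordspan_mult b S f)+
  hence "(\<lambda>x. mono_val x \<beta> * S x) \<in> ordspan A (Suc N)" "(\<lambda>x. mono_val x \<beta> * f x) \<in> ordspan A (Suc N)"
    using assms(2) by (auto elim: ordspan_mono)
  hence "(\<lambda>x. (f x + mono_val x \<beta> * S x) - mono_val x \<beta> * f x) \<in> ordspan A (Suc N)"
    by (intro ordspan_diff ordspan.add f)
  moreover have "(\<lambda>x. (f x + mono_val x \<beta> * S x) - mono_val x \<beta> * f x) =
      (\<lambda>x. cyc_prod x (\<beta> # L) - 1 + (\<Sum>\<beta>\<leftarrow>\<beta> # L. mono_val x \<beta>))"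
    by (simp add: f_def S_def cyc_prod_def fun_eq_iff algebra_simps)
  ultimately show ?case by simp
qed

lemma ordspan_cyc_prod_minus_1:
  assumes "set L \<subseteq> alpha_sums A N" "N \<ge> 1"
  shows "(\<lambda>x. cyc_prod x L - 1) \<in> ordspan A N"
  using ordspan_diff[OF ordspan_mono[OF ordspan_cyc_prod_linear[OF assms], of N] ordspan_sum_list[OF assms(1)]]
  by simp

text \<open>An integer coefficient becomes a multiplicity in one of two lists, chosen by its sign.
  The lists then serve as exponents of cyclotomic factors.\<close>

lemma ordspan_as_lists:
  assumes "f \<in> ordspan A N"
  shows "\<exists>P Q. set P \<subseteq> alpha_sums A N \<and> set Q \<subseteq> alpha_sums A N \<and>
           (\<forall>x. f x = (\<Sum>\<beta>\<leftarrow>P. mono_val x \<beta>) - (\<Sum>\<beta>\<leftarrow>Q. mono_val x \<beta>))"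
  using assms
proof (induction rule: ordspan.induct)
  case zero
  show ?case by (intro exI[of _ "[]"]) simp
next
  case (base \<beta>)
  thus ?case by (intro exI[of _ "[\<beta>]"] exI[of _ "[]"]) simp
next
  case (add f g)
  then obtain P Q P' Q' where "set P \<subseteq> alpha_sums A N \<and> set Q \<subseteq> alpha_sums A N \<and>
           (\<forall>x. f x = (\<Sum>\<beta>\<leftarrow>P. mono_val x \<beta>) - (\<Sum>\<beta>\<leftarrow>Q. mono_val x \<beta>))"
    "set P' \<subseteq> alpha_sums A N \<and> set Q' \<subseteq> alpha_sums A N \<and>
           (\<forall>x. g x = (\<Sum>\<beta>\<leftarrow>P'. mono_val x \<beta>) - (\<Sum>\<beta>\<leftarrow>Q'. mono_val x \<beta>))" by metis
  thus ?case by (intro exI[of _ "P @ P'"] exI[of _ "Q @ Q'"]) auto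
next
  case (uminus f)
  then obtain P Q where "set P \<subseteq> alpha_sums A N \<and> set Q \<subseteq> alpha_sums A N \<and>
           (\<forall>x. f x = (\<Sum>\<beta>\<leftarrow>P. mono_val x \<beta>) - (\<Sum>\<beta>\<leftarrow>Q. mono_val x \<beta>))" by metis
  thus ?case by (intro exI[of _ Q] exI[of _ P]) auto
qed

lemma alpha_sums_mono: "M \<le> N \<Longrightarrow> alpha_sums A N \<subseteq> alpha_sums A M"
  using order_trans unfolding alpha_sums_def by blast

text \<open>Multiplying both sides by the factors \<open>1 - X\<^sup>\<beta>\<close> that cancel the linear part of the error
  raises its order; integrality of the coefficients is what makes the exponents integers.\<close>

lemma cyclotomic_approximation:
  assumes h: "(\<lambda>x. h x - 1) \<in> ordspan A 1" and "N \<ge> 1"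
  shows "\<exists>P Q. set P \<subseteq> alpha_sums A 1 \<and> set Q \<subseteq> alpha_sums A 1 \<and>
           (\<lambda>x. h x * cyc_prod x P - cyc_prod x Q) \<in> ordspan A N"
  using assms(2)
proof (induction N rule: dec_induct)
  case base
  show ?case using h by (intro exI[of _ "[]"]) (simp add: cyc_prod_def)
next
  case (step N)
  then obtain P Q where PQ: "set P \<subseteq> alpha_sums A 1" "set Q \<subseteq> alpha_sums A 1"
    "(\<lambda>x. h x * cyc_prod x P - cyc_prod x Q) \<in> ordspan A N" by blast
  define R where "R = (\<lambda>x. h x * cyc_prod x P - cyc_prod x Q)"
  have R: "R \<in> ordspan A N" using PQ by (simp add: R_def)
  obtain P' Q' where PQ': "set P' \<subseteq> alpha_sums A N" "set Q' \<subseteq> alpha_sums A N"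
     "\<And>x. R x = (\<Sum>\<beta>\<leftarrow>P'. mono_val x \<beta>) - (\<Sum>\<beta>\<leftarrow>Q'. mono_val x \<beta>)"
    using ordspan_as_lists[OF R] by blast
  define E where "E = (\<lambda>x. cyc_prod x P' - 1 + (\<Sum>\<beta>\<leftarrow>P'. mono_val x \<beta>))"
  define E' where "E' = (\<lambda>x. cyc_prod x Q' - 1 + (\<Sum>\<beta>\<leftarrow>Q'. mono_val x \<beta>))"
  define B where "B = (\<lambda>x. cyc_prod x Q - 1)"
  define C where "C = (\<lambda>x. cyc_prod x P' - 1)"
  have E: "E \<in> ordspan A (Suc N)" "E' \<in> ordspan A (Suc N)"
    unfolding E_def E'_def using PQ' step.hyps by (auto intro!: ordspan_cyc_prod_linear)
  have B: "B \<in> ordspan A 1"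
    unfolding B_def by (rule ordspan_cyc_prod_minus_1) (use PQ in auto)
  have C: "C \<in> ordspan A 1"
    unfolding C_def using alpha_sums_mono[of 1 N A] step.hyps PQ'
    by (intro ordspan_cyc_prod_minus_1) auto
  have "(\<lambda>x. R x * C x) \<in> ordspan A (N + 1)" "(\<lambda>x. B x * R x) \<in> ordspan A (1 + N)"
    "(\<lambda>x. B x * (E x - E' x)) \<in> ordspan A (1 + Suc N)"
    by (intro ordspan_mult ordspan_diff R C B E)+
  hence "(\<lambda>x. R x * C x) \<in> ordspan A (Suc N)" "(\<lambda>x. B x * R x) \<in> ordspan A (Suc N)"
    "(\<lambda>x. B x * (E x - E' x)) \<in> ordspan A (Suc N)"
    by (auto elim: ordspan_mono)
  \<comment> \<open>With h P = R + Q the new error h P P' - Q Q' is R P' + Q (P' - Q'). Here P' - Q'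
    = E - E' - R, and inserting P' = 1 + C and Q = 1 + B cancels the lone R. The letters P, Q, P',
    Q' stand for the products over these lists.\<close>
  hence "(\<lambda>x. R x * C x - B x * R x + (B x * (E x - E' x) + (E x - E' x))) \<in> ordspan A (Suc N)"
    using E by (intro ordspan.add ordspan_diff)
  moreover have "R x * C x - B x * R x + (B x * (E x - E' x) + (E x - E' x)) =
      h x * cyc_prod x (P @ P') - cyc_prod x (Q @ Q')" for x
  proof -
    have h: "h x * cyc_prod x P = R x + cyc_prod x Q" by (simp add: R_def)
    have EE: "E x - E' x = cyc_prod x P' - cyc_prod x Q' + R x"
      by (simp add: E_def E'_def PQ'(3))
    thus ?thesis
      unfolding cyc_prod_append mult.assoc[symmetric] h B_def C_def EE by (simp add: algebra_simps)
  qed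
  moreover have "set (P @ P') \<subseteq> alpha_sums A 1" "set (Q @ Q') \<subseteq> alpha_sums A 1"
    using PQ PQ' alpha_sums_mono[of 1 N A] step.hyps by auto
  ultimately show ?case by (intro exI[of _ "P @ P'"] exI[of _ "Q @ Q'"]) simp
qed

section \<open>The Euler product\<close>

lemma sdot_add: "sdot s (\<beta> + \<gamma>) = sdot s \<beta> + sdot s \<gamma>"
  by (simp add: sdot_def distrib_left sum.distrib)

lemma sdot_0 [simp]: "sdot s 0 = 0"
  by (simp add: sdot_def)

lemma sdot_line: "sdot (a + t *s d) \<beta> = sdot a \<beta> + t * sdot d \<beta>"
  by (simp add: sdot_def distrib_right sum.distrib sum_distrib_left mult.assoc)

definition prime_point :: "nat \<Rightarrow> complex ^ 'n \<Rightarrow> complex ^ ('n::finite)" where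
  "prime_point p s = (\<chi> l. of_nat p powr (- (s $ l)))"

lemma mono_val_prime_point:
  assumes "p > 0"
  shows "mono_val (prime_point p s) \<beta> = exp (- (of_real (ln (real p)) * sdot s \<beta>))"
proof -
  have "mono_val (prime_point p s) \<beta> = (\<Prod>i\<in>UNIV. exp (- (of_real (ln (real p)) * (s $ i * of_nat (\<beta> $ i)))))"
    unfolding mono_val_def
  proof (rule prod.cong[OF refl])
    fix i
    have "(prime_point p s $ i) = exp (- (of_real (ln (real p)) * s $ i))"
      using assms by (simp add: prime_point_def powr_def Ln_of_nat mult.commute)
    thus "(prime_point p s $ i) ^ (\<beta> $ i) = exp (- (of_real (ln (real p)) * (s $ i * of_nat (\<beta> $ i))))"
      by (simp add: exp_of_nat_mult[symmetric] algebra_simps)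
  qed
  also have "\<dots> = exp (- (of_real (ln (real p)) * sdot s \<beta>))"
    by (simp add: exp_sum[symmetric] sdot_def sum_distrib_left sum_negf)
  finally show ?thesis .
qed

lemma mono_val_prime_point_powr:
  "p > 0 \<Longrightarrow> mono_val (prime_point p s) \<beta> = of_nat p powr (- sdot s \<beta>)"
  by (simp add: mono_val_prime_point powr_def Ln_of_nat mult.commute)

lemma norm_mono_val_prime_point:
  "p > 0 \<Longrightarrow> norm (mono_val (prime_point p s) \<beta>) = real p powr (- Re (sdot s \<beta>))"
  by (simp add: mono_val_prime_point_powr norm_powr_real_powr)

definition euler_factor :: "('n::finite) int_mpoly \<Rightarrow> nat \<Rightarrow> complex ^ 'n \<Rightarrow> complex" where
  "euler_factor h p s = eval_mpoly h (prime_point p s)"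

lemma euler_product_altdef: "euler_product h s = prodinf (\<lambda>p. if prime p then euler_factor h p s else 1)"
  unfolding euler_product_def euler_factor_def prime_point_def ..

lemma eval_h_poly:
  assumes "inj_on \<alpha> {1..r}" "\<And>j. j \<in> {1..r} \<Longrightarrow> \<alpha> j \<noteq> 0"
  shows "eval_mpoly (h_poly r a \<alpha>) x = 1 + (\<Sum>j=1..r. of_int (a j) * mono_val x (\<alpha> j))"
proof -
  have ev: "eval_mpoly Q x = (\<Sum>\<beta>\<in>S. of_int (Poly_Mapping.lookup Q \<beta>) * mono_val x \<beta>)"
    if "finite S" "Poly_Mapping.keys Q \<subseteq> S" for Q S
    unfolding eval_mpoly_def mono_val_def[symmetric]
    by (rule sum.mono_neutral_left) (use that in \<open>auto simp: in_keys_iff\<close>)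
  have lk: "Poly_Mapping.lookup (h_poly r a \<alpha>) \<beta> =
      (if \<beta> = 0 then 1 else 0) + (\<Sum>j=1..r. if \<alpha> j = \<beta> then a j else 0)" for \<beta>
    by (auto simp: h_poly_def lookup_add lookup_sum lookup_single lookup_one when_def intro!: sum.cong)
  have "(\<Sum>j=1..r. if \<alpha> j = 0 then a j else 0) = 0"
    using assms(2) by (intro sum.neutral) auto
  hence lk0: "Poly_Mapping.lookup (h_poly r a \<alpha>) 0 = 1" by (simp add: lk)
  define S where "S = insert 0 (\<alpha> ` {1..r})"
  have "Poly_Mapping.keys (h_poly r a \<alpha>) \<subseteq> S"
  proof
    fix \<beta> assume "\<beta> \<in> Poly_Mapping.keys (h_poly r a \<alpha>)"
    hence "(if \<beta> = 0 then 1 else 0) + (\<Sum>j=1..r. if \<alpha> j = \<beta> then a j else 0) \<noteq> 0"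
      by (simp add: in_keys_iff lk)
    thus "\<beta> \<in> S" by (rule contrapos_np) (auto simp: S_def intro!: sum.neutral)
  qed
  hence "eval_mpoly (h_poly r a \<alpha>) x = (\<Sum>\<beta>\<in>S. of_int (Poly_Mapping.lookup (h_poly r a \<alpha>) \<beta>) * mono_val x \<beta>)"
    by (intro ev) (auto simp: S_def)
  also have "\<dots> = of_int (Poly_Mapping.lookup (h_poly r a \<alpha>) 0) * mono_val x 0 +
      (\<Sum>\<beta>\<in>\<alpha> ` {1..r}. of_int (Poly_Mapping.lookup (h_poly r a \<alpha>) \<beta>) * mono_val x \<beta>)"
    unfolding S_def by (rule sum.insert) (use assms(2) in auto)
  also have "Poly_Mapping.lookup (h_poly r a \<alpha>) 0 = 1" by (rule lk0)
  also have "(\<Sum>\<beta>\<in>\<alpha> ` {1..r}. of_int (Poly_Mapping.lookup (h_poly r a \<alpha>) \<beta>) * mono_val x \<beta>) =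
      (\<Sum>j=1..r. of_int (a j) * mono_val x (\<alpha> j))"
  proof (subst sum.reindex[OF assms(1)], rule sum.cong[OF refl])
    fix j assume j: "j \<in> {1..r}"
    have "(\<Sum>i=1..r. if \<alpha> i = \<alpha> j then a i else 0) = (\<Sum>i=1..r. if i = j then a i else 0)"
    proof (rule sum.cong[OF refl])
      fix i assume "i \<in> {1..r}"
      hence "\<alpha> i = \<alpha> j \<longleftrightarrow> i = j" using assms(1) j by (meson inj_onD)
      thus "(if \<alpha> i = \<alpha> j then a i else 0) = (if i = j then a i else 0)" by simp
    qed
    also have "\<dots> = a j" using j by (subst sum.delta) simp_all
    finally show "((\<lambda>\<beta>. of_int (Poly_Mapping.lookup (h_poly r a \<alpha>) \<beta>) * mono_val x \<beta>) \<circ> \<alpha>) j = of_int (a j) * mono_val x (\<alpha> j)"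
      using assms(2)[OF j] by (simp only: o_def lk if_False add_0_left)
  qed
  finally show ?thesis by simp
qed

lemma h_poly_minus_1_ordspan:
  assumes "inj_on \<alpha> {1..r}" "\<And>j. j \<in> {1..r} \<Longrightarrow> \<alpha> j \<noteq> 0"
  shows "(\<lambda>x. eval_mpoly (h_poly r a \<alpha>) x - 1) \<in> ordspan (\<alpha> ` {1..r}) 1"
proof -
  have "\<alpha> j \<in> alpha_sums (\<alpha> ` {1..r}) 1" if "j \<in> {1..r}" for j
    using alpha_sum.step[OF alpha_sum.zero, of "\<alpha> j" "\<alpha> ` {1..r}"] that
    by (auto simp: alpha_sums_def)
  hence "(\<lambda>x. \<Sum>j=1..r. of_int (a j) * mono_val x (\<alpha> j)) \<in> ordspan (\<alpha> ` {1..r}) 1"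
    by (intro ordspan_sum ordspan_of_int_mult ordspan.base)
  thus ?thesis by (simp only: eval_h_poly[OF assms] add_diff_cancel_left')
qed

lemma alpha_sums_Re_ge:
  assumes "\<beta> \<in> alpha_sums A 1" "\<And>\<gamma>. \<gamma> \<in> A \<Longrightarrow> Re (sdot s \<gamma>) > \<delta>" "\<delta> \<ge> 0"
  shows "Re (sdot s \<beta>) > \<delta>"
proof -
  obtain k where k: "k \<ge> 1" "alpha_sum A k \<beta>" using assms(1) by (auto simp: alpha_sums_def)
  have "Re (sdot s \<beta>) \<ge> 0 \<and> (k \<ge> 1 \<longrightarrow> Re (sdot s \<beta>) > \<delta>)" using k(2)
  proof (induction rule: alpha_sum.induct)
    case (step k \<beta> \<gamma>)
    thus ?case using assms(2)[of \<gamma>] assms(3) by (auto simp: sdot_add)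
  qed auto
  thus ?thesis using k by auto
qed

lemma alpha_sums_nonzero:
  assumes "\<beta> \<in> alpha_sums A 1" "0 \<notin> A"
  shows "\<beta> \<noteq> 0"
proof -
  obtain k where k: "k \<ge> 1" "alpha_sum A k \<beta>" using assms(1) by (auto simp: alpha_sums_def)
  from k(2,1) show ?thesis
  proof (cases rule: alpha_sum.cases)
    case (step k \<beta>' \<gamma>)
    hence "\<gamma> \<noteq> 0" using assms(2) by auto
    thus ?thesis using step by (auto simp: vec_eq_iff)
  qed auto
qed

lemma summable_prime_norm:
  fixes f :: "nat \<Rightarrow> complex"
  assumes "\<And>p. prime p \<Longrightarrow> norm (f p - 1) \<le> C * real p powr (-c)" "c > 1"
  shows "convergent_prod (\<lambda>p. if prime p then f p else 1)"
proof -
  have sm: "summable (\<lambda>p. \<bar>C\<bar> * real p powr (-c))"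
    using assms(2) by (intro summable_mult) (simp add: summable_real_powr_iff)
  have le: "norm ((if prime p then f p else 1) - 1) \<le> \<bar>C\<bar> * real p powr (-c)" for p
  proof (cases "prime p")
    case True
    have "norm (f p - 1) \<le> C * real p powr (-c)" by (rule assms(1)[OF True])
    also have "\<dots> \<le> \<bar>C\<bar> * real p powr (-c)" by (intro mult_right_mono) auto
    finally show ?thesis using True by simp
  qed auto
  have "summable (\<lambda>p. norm ((if prime p then f p else 1) - 1))"
    by (rule summable_comparison_test'[OF sm, of 0]) (use le in auto)
  thus ?thesis
    by (intro abs_convergent_prod_imp_convergent_prod summable_imp_abs_convergent_prod)
qed

lemma W_open: "open (W r \<alpha> \<delta> :: (complex ^ ('n::finite)) set)"
proof -
  have "W r \<alpha> \<delta> = (\<Inter>j\<in>{1..r}. {s. Re (sdot s (\<alpha> j)) > \<delta>})" by (auto simp: W_def)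
  also have "open \<dots>"
    by (intro open_INT ballI open_Collect_less continuous_intros finite_atLeastAtMost) (simp add: sdot_def continuous_intros)
  finally show ?thesis .
qed

lemma sdot_add_left: "sdot (s + t) \<beta> = sdot s \<beta> + sdot t \<beta>"
  by (simp add: sdot_def distrib_right sum.distrib)

lemma sdot_scaleR_left: "sdot (c *\<^sub>R t) \<beta> = c *\<^sub>R sdot t \<beta>"
  by (simp add: sdot_def scaleR_sum_right)

lemma W_convex: "convex (W r \<alpha> \<delta> :: (complex ^ ('n::finite)) set)"
proof (rule convexI)
  fix x y :: "complex ^ 'n" and u v :: real
  assume h: "x \<in> W r \<alpha> \<delta>" "y \<in> W r \<alpha> \<delta>" "0 \<le> u" "0 \<le> v" "u + v = 1"
  show "u *\<^sub>R x + v *\<^sub>R y \<in> W r \<alpha> \<delta>" unfolding W_def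
  proof (intro CollectI ballI)
    fix j assume j: "j \<in> {1..r}"
    have "Re (sdot x (\<alpha> j)) > \<delta>" "Re (sdot y (\<alpha> j)) > \<delta>" using h j by (auto simp: W_def)
    hence "Re (u *\<^sub>R sdot x (\<alpha> j) + v *\<^sub>R sdot y (\<alpha> j)) > \<delta>"
      using convex_bound_lt[of "- Re (sdot x (\<alpha> j))" "-\<delta>" "- Re (sdot y (\<alpha> j))" u v] h by simp
    thus "Re (sdot (u *\<^sub>R x + v *\<^sub>R y) (\<alpha> j)) > \<delta>"
      by (simp add: sdot_add_left sdot_scaleR_left)
  qed
qed

lemma sdot_ones: "Re (sdot (\<chi> l. of_real c) \<beta>) = c * real (\<Sum>l\<in>UNIV. \<beta> $ l)"
  by (simp add: sdot_def sum_distrib_left)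

lemma sdot_ones_ge:
  assumes "\<beta> \<noteq> 0" "c \<ge> 0"
  shows "Re (sdot (\<chi> l. of_real c) \<beta>) \<ge> c"
proof -
  obtain l where "\<beta> $ l \<noteq> 0" using assms(1) by (auto simp: vec_eq_iff)
  hence "1 \<le> \<beta> $ l" by simp
  also have "\<beta> $ l \<le> (\<Sum>l\<in>UNIV. \<beta> $ l)" by (rule member_le_sum) auto
  finally have "real 1 \<le> real (\<Sum>l\<in>UNIV. \<beta> $ l)" by (rule of_nat_mono)
  hence "c * 1 \<le> c * real (\<Sum>l\<in>UNIV. \<beta> $ l)" using assms(2) by (intro mult_left_mono) simp_all
  thus ?thesis by (simp only: sdot_ones mult_1_right)
qed

text \<open>The regularised zeta factors \<open>(z - 1) \<zeta>(z)\<close> are holomorphic, so the factors \<open>z - 1\<close>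
  appear on the opposite side.\<close>

lemma euler_product_factorization:
  fixes \<alpha> :: "nat \<Rightarrow> nat ^ ('n::finite)" and a :: "nat \<Rightarrow> int"
  assumes inj: "inj_on \<alpha> {1..r}" and nz: "\<And>j. j \<in> {1..r} \<Longrightarrow> \<alpha> j \<noteq> 0" and "\<delta> > 0"
  defines "h \<equiv> h_poly r a \<alpha>"
  obtains D N where "line_holomorphic D (W r \<alpha> \<delta>)" "line_holomorphic N (W r \<alpha> \<delta>)"
    "\<And>s. s \<in> W r \<alpha> \<delta> \<Longrightarrow> s \<in> W r \<alpha> 1 \<Longrightarrow> euler_product h s * D s = N s"
    "\<And>s. s \<in> W r \<alpha> 1 \<Longrightarrow> (\<And>p. prime p \<Longrightarrow> euler_factor h p s \<noteq> 0) \<Longrightarrow> euler_product h s \<noteq> 0"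
    "\<And>s. s \<in> W r \<alpha> \<delta> \<Longrightarrow> (\<And>\<beta>. \<beta> \<noteq> 0 \<Longrightarrow> Re (sdot s \<beta>) > 0 \<Longrightarrow> sdot s \<beta> \<noteq> 1 \<and> zeta_reg (sdot s \<beta>) \<noteq> 0) \<Longrightarrow> D s \<noteq> 0"
    "\<And>s p. s \<in> W r \<alpha> \<delta> \<Longrightarrow> prime p \<Longrightarrow> euler_factor h p s = 0 \<Longrightarrow> N s = 0"
proof -
  define A where "A = \<alpha> ` {1..r}"
  have A0: "0 \<notin> A" using nz by (auto simp: A_def)
  define ev where "ev = eval_mpoly h"
  have evh: "ev x = 1 + (\<Sum>j=1..r. of_int (a j) * mono_val x (\<alpha> j))" for x
    unfolding ev_def h_def by (rule eval_h_poly) (use inj nz in auto)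
  have h1: "(\<lambda>x. ev x - 1) \<in> ordspan A 1"
    unfolding A_def ev_def h_def by (rule h_poly_minus_1_ordspan[OF inj nz])
  \<comment> \<open>An error of order \<open>N0\<close> is at most a constant times p^(-2) on
    \<open>W(\<delta>)\<close>, hence summable over the primes.\<close>
  obtain N0 :: nat where N0: "real N0 * \<delta> > 2"
    using ex_less_of_nat_mult[OF \<open>\<delta> > 0\<close>] by blast
  hence "N0 \<ge> 1" by (cases N0) auto
  from cyclotomic_approximation[OF h1 this] obtain P Q where
    PQ: "set P \<subseteq> alpha_sums A 1" "set Q \<subseteq> alpha_sums A 1"
    and E: "(\<lambda>x. ev x * cyc_prod x P - cyc_prod x Q) \<in> ordspan A N0" by blast
  from ordspan_bound[OF E] obtain C where C: "C \<ge> 0"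
    "\<And>x t. 0 \<le> t \<and> t \<le> 1 \<and> (\<forall>\<beta>\<in>A. norm (mono_val x \<beta>) \<le> t) \<Longrightarrow>
       norm (ev x * cyc_prod x P - cyc_prod x Q) \<le> C * t ^ N0" by blast
  from ordspan_bound[OF h1] obtain C1 where C1: "C1 \<ge> 0"
    "\<And>x t. 0 \<le> t \<and> t \<le> 1 \<and> (\<forall>\<beta>\<in>A. norm (mono_val x \<beta>) \<le> t) \<Longrightarrow> norm (ev x - 1) \<le> C1 * t ^ 1"
    by blast
  \<comment> \<open>A lower bound, uniform in the prime, for a cyclotomic factor on
    \<open>W(\<delta>)\<close>; the prime 2 is the worst case.\<close>
  define q0 where "q0 = 1 - 2 powr (-\<delta>)"
  have q0: "0 < q0" using \<open>\<delta> > 0\<close> by (simp add: q0_def powr_less_one)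
  define xx where "xx = (\<lambda>p s. prime_point p s :: complex ^ 'n)"
  have Re_gt: "Re (sdot s \<beta>) > \<delta>" if "s \<in> W r \<alpha> \<delta>" "\<beta> \<in> set P \<union> set Q" for s \<beta>
    by (rule alpha_sums_Re_ge[of \<beta> A]) (use that PQ \<open>\<delta> > 0\<close> in \<open>auto simp: W_def A_def\<close>)
  have small: "norm (mono_val (xx p s) \<beta>) \<le> real p powr (-\<epsilon>)" if "prime p" "Re (sdot s \<beta>) \<ge> \<epsilon>" for p s \<beta> \<epsilon>
    using that prime_ge_1_nat[of p] unfolding xx_def
    by (subst norm_mono_val_prime_point) (auto simp: prime_gt_0_nat intro!: powr_mono)
  have smallA: "\<forall>\<beta>\<in>A. norm (mono_val (xx p s) \<beta>) \<le> real p powr (-\<delta>)" if "s \<in> W r \<alpha> \<delta>" "prime p" for p s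
    using that by (intro ballI small) (auto simp: A_def W_def intro: less_imp_le)
  have t01: "0 \<le> real p powr (-\<delta>) \<and> real p powr (-\<delta>) \<le> 1" if "prime p" for p
    using that prime_ge_1_nat[of p] \<open>\<delta> > 0\<close> by (auto intro!: powr_le_one_le simp: powr_minus_divide ge_one_powr_ge_zero)
  have cycQ: "norm (cyc_prod (xx p s) Q) \<ge> q0 ^ length Q" if "s \<in> W r \<alpha> \<delta>" "prime p" for p s
  proof -
    have "norm (1 - mono_val (xx p s) \<beta>) \<ge> q0" if "\<beta> \<in> set Q" for \<beta>
    proof -
      have "norm (mono_val (xx p s) \<beta>) \<le> real p powr (-\<delta>)"
        using Re_gt[OF \<open>s \<in> _\<close>, of \<beta>] that by (intro small) (use \<open>prime p\<close> in auto)
      also have "\<dots> \<le> 2 powr (-\<delta>)"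
        using prime_ge_2_nat[OF \<open>prime p\<close>] \<open>\<delta> > 0\<close> by (intro powr_mono2') auto
      finally show ?thesis
        using norm_triangle_ineq2[of 1 "mono_val (xx p s) \<beta>"] by (simp add: q0_def)
    qed
    thus ?thesis unfolding cyc_prod_def
    proof (induction Q)
      case (Cons \<beta> Q)
      hence "q0 * q0 ^ length Q \<le> norm (1 - mono_val (xx p s) \<beta>) * norm (\<Prod>\<beta>\<leftarrow>Q. 1 - mono_val (xx p s) \<beta>)"
        using q0 by (intro mult_mono) auto
      thus ?case by (simp add: norm_mult)
    qed auto
  qed
  have cycQ0: "cyc_prod (xx p s) Q \<noteq> 0" if "s \<in> W r \<alpha> \<delta>" "prime p" for p s
  proof -
    have "0 < q0 ^ length Q" using q0 by simp
    also have "\<dots> \<le> norm (cyc_prod (xx p s) Q)" by (rule cycQ[OF that])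
    finally show ?thesis by simp
  qed
  \<comment> \<open>The local factor left after the zeta factors have been split off.\<close>
  define R where "R = (\<lambda>p s. ev (xx p s) * cyc_prod (xx p s) P / cyc_prod (xx p s) Q)"
  define C' where "C' = C / q0 ^ length Q"
  have R: "norm (R p s - 1) \<le> C' * real p powr (-2)" if s: "s \<in> W r \<alpha> \<delta>" and p: "prime p" for p s
  proof -
    have "norm (R p s - 1) = norm (ev (xx p s) * cyc_prod (xx p s) P - cyc_prod (xx p s) Q) / norm (cyc_prod (xx p s) Q)"
      using cycQ0[OF that] by (simp add: R_def norm_divide[symmetric] diff_divide_distrib)
    also have "\<dots> \<le> (C * (real p powr (-\<delta>)) ^ N0) / q0 ^ length Q"
      using C cycQ[OF that] smallA[OF that] t01[OF p] q0 by (intro frac_le C(2)) auto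
    also have "(real p powr (-\<delta>)) ^ N0 = real p powr (- (real N0 * \<delta>))"
      using prime_gt_0_nat[OF p] by (simp add: powr_realpow[symmetric] powr_powr mult.commute)
    also have "C * real p powr (- (real N0 * \<delta>)) / q0 ^ length Q \<le> C * real p powr (-2) / q0 ^ length Q"
      using prime_ge_1_nat[OF p] N0 q0 C by (intro divide_right_mono mult_left_mono powr_mono) auto
    finally show ?thesis by (simp add: C'_def)
  qed
  have conv_ev0: "convergent_prod (\<lambda>p. if prime p then ev (xx p s) else 1)" if s2: "s \<in> W r \<alpha> 1" for s
  proof -
    \<comment> \<open>Finitely many real parts exceed 1, so they exceed 1 uniformly; the extra
      element 2 covers an empty list of exponents.\<close>
    define c where "c = Min (insert 2 ((\<lambda>\<beta>. Re (sdot s \<beta>)) ` A))"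
    have fin: "finite (insert 2 ((\<lambda>\<beta>. Re (sdot s \<beta>)) ` A))" by (simp add: A_def)
    have c: "c > 1" "\<And>\<beta>. \<beta> \<in> A \<Longrightarrow> Re (sdot s \<beta>) \<ge> c"
      unfolding c_def using s2 fin by (auto simp: Min_gr_iff A_def W_def)
    show ?thesis
    proof (rule summable_prime_norm[OF _ c(1)])
      fix p :: nat assume p: "prime p"
      have "norm (ev (xx p s) - 1) \<le> C1 * (real p powr (-c)) ^ 1"
      proof (rule C1(2), intro conjI ballI)
        show "real p powr (-c) \<le> 1"
          using prime_ge_1_nat[OF p] c(1) by (simp add: powr_minus_divide ge_one_powr_ge_zero)
      qed (use small[OF p c(2)] in auto)
      thus "norm (ev (xx p s) - 1) \<le> C1 * real p powr (-c)" by simp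
    qed
  qed
  define G where "G = (\<lambda>s. prodinf (\<lambda>p. if prime p then R p s else 1))"
  have convR: "convergent_prod (\<lambda>p. if prime p then R p s else 1)" if "s \<in> W r \<alpha> \<delta>" for s
    by (rule summable_prime_norm[of _ C' 2]) (use R[OF that] in auto)
  have lineG: "line_holomorphic G (W r \<alpha> \<delta>)"
    unfolding line_holomorphic_def
  proof (intro allI)
    fix b d :: "complex ^ 'n"
    define S where "S = {t. b + t *s d \<in> W r \<alpha> \<delta>}"
    have oS: "open S" unfolding S_def by (intro open_line_preimage W_open)
    have hol_mono: "(\<lambda>t. mono_val (xx p (b + t *s d)) \<beta>) holomorphic_on S" if "prime p" for p \<beta>
      using prime_gt_0_nat[OF that] unfolding xx_def
      by (simp add: mono_val_prime_point sdot_line) (intro holomorphic_intros)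
    have hol_cyc: "(\<lambda>t. cyc_prod (xx p (b + t *s d)) L) holomorphic_on S" if "prime p" for p L
      unfolding cyc_prod_def by (induction L) (auto intro!: holomorphic_intros hol_mono that)
    have hol_ev: "(\<lambda>t. ev (xx p (b + t *s d))) holomorphic_on S" if "prime p" for p
      unfolding evh by (intro holomorphic_intros hol_mono that)
    have "(\<lambda>t. prodinf (\<lambda>p. if prime p then R p (b + t *s d) else 1)) holomorphic_on S"
    proof (rule holomorphic_on_prodinf[OF oS])
      show "(\<lambda>t. if prime p then R p (b + t *s d) else 1) holomorphic_on S" for p
      proof (cases "prime p")
        case True
        have "(\<lambda>t. R p (b + t *s d)) holomorphic_on S"
          unfolding R_def using cycQ0 True
          by (intro holomorphic_intros hol_cyc hol_ev) (auto simp: S_def)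
        thus ?thesis using True by simp
      qed auto
      fix x assume "x \<in> S"
      then obtain e where e: "e > 0" "cball x e \<subseteq> S" using oS open_contains_cball by metis
      have "norm ((if prime p then R p (b + y *s d) else 1) - 1) \<le> C' * real p powr (-2)" if "y \<in> cball x e" for p y
      proof (cases "prime p")
        case True
        have "b + y *s d \<in> W r \<alpha> \<delta>" using e that by (auto simp: S_def)
        from R[OF this True] show ?thesis using True by simp
      next
        case False
        thus ?thesis using C q0 by (simp add: C'_def)
      qed
      moreover have "summable (\<lambda>p. C' * real p powr (-2))"
        by (intro summable_mult) (simp add: summable_real_powr_iff)
      ultimately show "\<exists>d'>0. \<exists>M. cball x d' \<subseteq> S \<and> summable M \<and>
          (\<forall>n. \<forall>y\<in>cball x d'. norm ((if prime n then R n (b + y *s d) else 1) - 1) \<le> M n)"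
        using e by blast
    qed
    thus "(\<lambda>t. G (b + t *s d)) holomorphic_on {t. b + t *s d \<in> W r \<alpha> \<delta>}"
      by (simp add: G_def S_def)
  qed
  define ZP where "ZP = (\<lambda>(L :: (nat ^ 'n) list) s. \<Prod>\<beta>\<leftarrow>L. zeta_reg (sdot s \<beta>))"
  define LP where "LP = (\<lambda>(L :: (nat ^ 'n) list) s. \<Prod>\<beta>\<leftarrow>L. sdot s \<beta> - 1)"
  have lineZP: "line_holomorphic (ZP L) (W r \<alpha> \<delta>)" if "set L \<subseteq> set P \<union> set Q" for L
    unfolding line_holomorphic_def
  proof (intro allI)
    fix b d :: "complex ^ 'n"
    have 1: "(\<lambda>t. zeta_reg (sdot (b + t *s d) \<beta>)) holomorphic_on {t. b + t *s d \<in> W r \<alpha> \<delta>}"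
      if "\<beta> \<in> set P \<union> set Q" for \<beta>
    proof -
      have "(zeta_reg \<circ> (\<lambda>t. sdot (b + t *s d) \<beta>)) holomorphic_on {t. b + t *s d \<in> W r \<alpha> \<delta>}"
      proof (rule holomorphic_on_compose_gen[OF _ holomorphic_zeta_reg])
        show "(\<lambda>t. sdot (b + t *s d) \<beta>) holomorphic_on {t. b + t *s d \<in> W r \<alpha> \<delta>}"
          by (simp add: sdot_line) (intro holomorphic_intros)
        show "(\<lambda>t. sdot (b + t *s d) \<beta>) ` {t. b + t *s d \<in> W r \<alpha> \<delta>} \<subseteq> {s. 0 < Re s}"
          using Re_gt[OF _ that] \<open>\<delta> > 0\<close> by (auto intro: less_trans)
      qed
      thus ?thesis by (simp add: o_def)
    qed
    show "(\<lambda>t. ZP L (b + t *s d)) holomorphic_on {t. b + t *s d \<in> W r \<alpha> \<delta>}"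
      using that unfolding ZP_def by (induction L) (auto intro!: holomorphic_intros 1)
  qed
  have lineLP: "line_holomorphic (LP L) (W r \<alpha> \<delta>)" for L
    unfolding line_holomorphic_def
  proof (intro allI)
    fix b d :: "complex ^ 'n"
    show "(\<lambda>t. LP L (b + t *s d)) holomorphic_on {t. b + t *s d \<in> W r \<alpha> \<delta>}"
      unfolding LP_def by (induction L) (auto intro!: holomorphic_intros simp: sdot_line)
  qed
  \<comment> \<open>The products over p of the factors in \<open>P\<close> and \<open>Q\<close> are
    inverse zeta values, so on \<open>W(1)\<close> the Euler product is \<open>G\<close> times the
    zeta values of \<open>P\<close> divided by those of \<open>Q\<close>. Writing each zeta value as
    \<open>zeta_reg\<close> over z - 1 and clearing denominators gives the two witnesses.\<close>
  show ?thesis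
  proof (rule that[of "\<lambda>s. ZP Q s * LP P s" "\<lambda>s. G s * ZP P s * LP Q s"])
    show "line_holomorphic (\<lambda>s. ZP Q s * LP P s) (W r \<alpha> \<delta>)"
      by (intro line_holomorphic_mult lineZP lineLP) auto
    show "line_holomorphic (\<lambda>s. G s * ZP P s * LP Q s) (W r \<alpha> \<delta>)"
      by (intro line_holomorphic_mult lineZP lineLP lineG) auto
    show "euler_product h s \<noteq> 0" if s: "s \<in> W r \<alpha> 1" and hyp: "\<And>p. prime p \<Longrightarrow> euler_factor h p s \<noteq> 0" for s
    proof -
      have "(\<lambda>p. if prime p then ev (xx p s) else 1) has_prod euler_product h s"
        using convergent_prod_has_prod[OF conv_ev0[OF s]]
        unfolding euler_product_altdef euler_factor_def ev_def xx_def .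
      moreover have "0 \<notin> range (\<lambda>p. if prime p then ev (xx p s) else 1)"
        using hyp by (auto simp: euler_factor_def ev_def xx_def)
      ultimately show ?thesis using has_prod_eq_0_iff by blast
    qed
    show "ZP Q s * LP P s \<noteq> 0" if s: "s \<in> W r \<alpha> \<delta>" and hyp:
      "\<And>\<beta>. \<beta> \<noteq> 0 \<Longrightarrow> Re (sdot s \<beta>) > 0 \<Longrightarrow> sdot s \<beta> \<noteq> 1 \<and> zeta_reg (sdot s \<beta>) \<noteq> 0" for s
    proof -
      have "sdot s \<beta> \<noteq> 1 \<and> zeta_reg (sdot s \<beta>) \<noteq> 0" if b: "\<beta> \<in> set P \<union> set Q" for \<beta>
      proof (rule hyp)
        show "\<beta> \<noteq> 0" by (rule alpha_sums_nonzero[OF _ A0]) (use b PQ in auto)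
        show "Re (sdot s \<beta>) > 0" using Re_gt[OF s b] \<open>\<delta> > 0\<close> by simp
      qed
      thus ?thesis by (auto simp: ZP_def LP_def prod_list_zero_iff)
    qed
    show "G s * ZP P s * LP Q s = 0" if "s \<in> W r \<alpha> \<delta>" "prime p" "euler_factor h p s = 0" for s p
    proof -
      have "R p s = 0" using that(3) by (simp add: R_def ev_def euler_factor_def xx_def)
      hence "(if prime p then R p s else 1) = 0" using that(2) by simp
      hence "0 \<in> range (\<lambda>p. if prime p then R p s else 1)" by (intro range_eqI[of _ _ p]) simp
      moreover have "(\<lambda>p. if prime p then R p s else 1) has_prod G s"
        unfolding G_def by (rule convergent_prod_has_prod[OF convR[OF that(1)]])
      ultimately have "G s = 0" using has_prod_eq_0_iff by blast
      thus ?thesis by simp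
    qed
    show "euler_product h s * (ZP Q s * LP P s) = G s * ZP P s * LP Q s"
      if s: "s \<in> W r \<alpha> \<delta>" "s \<in> W r \<alpha> 1" for s
    proof -
      have Re1: "Re (sdot s \<beta>) > 1" if "\<beta> \<in> set P \<union> set Q" for \<beta>
        by (rule alpha_sums_Re_ge[of \<beta> A]) (use that s PQ in \<open>auto simp: W_def A_def\<close>)
      have conv_ev: "convergent_prod (\<lambda>p. if prime p then ev (xx p s) else 1)"
        by (rule conv_ev0[OF s(2)])
      define zp where "zp = (\<lambda>\<beta> (p::nat). if prime p then 1 - of_nat p powr (- sdot s \<beta>) else 1 :: complex)"
      define zv where "zv = (\<lambda>\<beta>. \<Sum>\<^sub>\<infinity>n. of_nat n powr (- sdot s \<beta>) :: complex)"
      have cyc: "convergent_prod (\<lambda>p. if prime p then cyc_prod (xx p s) L else 1) \<and>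
          prodinf (\<lambda>p. if prime p then cyc_prod (xx p s) L else 1) * (\<Prod>\<beta>\<leftarrow>L. zv \<beta>) = 1"
        if "set L \<subseteq> set P \<union> set Q" for L using that
      proof (induction L)
        case Nil
        have eq: "(\<lambda>p. if prime p then cyc_prod (xx p s) [] else 1) = (\<lambda>_. 1)"
          by (auto simp: cyc_prod_def fun_eq_iff)
        show ?case by (simp only: eq) simp
      next
        case (Cons \<beta> L)
        have zp: "convergent_prod (zp \<beta>)" "prodinf (zp \<beta>) * zv \<beta> = 1"
          using zeta_euler_product[OF Re1[of \<beta>]] Cons by (auto simp: zp_def zv_def)
        have eq: "(if prime p then cyc_prod (xx p s) (\<beta> # L) else 1) = zp \<beta> p * (if prime p then cyc_prod (xx p s) L else 1)" for p
          by (auto simp: cyc_prod_def zp_def xx_def mono_val_prime_point_powr prime_gt_0_nat)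
        have IH: "convergent_prod (\<lambda>p. if prime p then cyc_prod (xx p s) L else 1)"
          "prodinf (\<lambda>p. if prime p then cyc_prod (xx p s) L else 1) * (\<Prod>\<beta>\<leftarrow>L. zv \<beta>) = 1"
          using Cons by auto
        have "prodinf (\<lambda>p. if prime p then cyc_prod (xx p s) (\<beta> # L) else 1) =
           prodinf (zp \<beta>) * prodinf (\<lambda>p. if prime p then cyc_prod (xx p s) L else 1)"
          unfolding eq by (rule prodinf_mult[symmetric, OF zp(1) IH(1)])
        moreover have "prodinf (zp \<beta>) * prodinf (\<lambda>p. if prime p then cyc_prod (xx p s) L else 1) * (zv \<beta> * (\<Prod>\<beta>\<leftarrow>L. zv \<beta>)) =
           (prodinf (zp \<beta>) * zv \<beta>) * (prodinf (\<lambda>p. if prime p then cyc_prod (xx p s) L else 1) * (\<Prod>\<beta>\<leftarrow>L. zv \<beta>))"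
          by (simp only: mult_ac)
        ultimately show ?case
          using convergent_prod_mult[OF zp(1) IH(1)] unfolding eq zp(2) IH(2) by simp
      qed
      define cP where "cP = prodinf (\<lambda>p. if prime p then cyc_prod (xx p s) P else 1)"
      define cQ where "cQ = prodinf (\<lambda>p. if prime p then cyc_prod (xx p s) Q else 1)"
      define vP where "vP = (\<Prod>\<beta>\<leftarrow>P. zv \<beta>)"
      define vQ where "vQ = (\<Prod>\<beta>\<leftarrow>Q. zv \<beta>)"
      have c1: "cP * vP = 1" "cQ * vQ = 1" unfolding cP_def vP_def cQ_def vQ_def using cyc by auto
      have "G s * cQ = prodinf (\<lambda>p. (if prime p then R p s else 1) * (if prime p then cyc_prod (xx p s) Q else 1))"
        unfolding G_def cQ_def using convR[OF s(1)] cyc[of Q] by (intro prodinf_mult) auto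
      also have "\<dots> = prodinf (\<lambda>p. (if prime p then ev (xx p s) else 1) * (if prime p then cyc_prod (xx p s) P else 1))"
        by (intro prodinf_cong) (use cycQ0[OF s(1)] in \<open>auto simp: R_def\<close>)
      also have "\<dots> = prodinf (\<lambda>p. if prime p then ev (xx p s) else 1) * cP"
        unfolding cP_def using conv_ev cyc[of P] by (intro prodinf_mult[symmetric]) auto
      also have "prodinf (\<lambda>p. if prime p then ev (xx p s) else 1) = euler_product h s"
        unfolding euler_product_altdef euler_factor_def ev_def xx_def ..
      finally have GE: "G s * cQ = euler_product h s * cP" .
      have "G s * vP = G s * cQ * vQ * vP" using c1(2) by (simp add: mult.assoc)
      also have "\<dots> = euler_product h s * (cP * vP) * vQ" unfolding GE by (simp only: mult_ac)
      finally have GE2: "G s * vP = euler_product h s * vQ" using c1(1) by simp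
      have ZP: "ZP L s = LP L s * (\<Prod>\<beta>\<leftarrow>L. zv \<beta>)" if "set L \<subseteq> set P \<union> set Q" for L
        using that unfolding ZP_def LP_def
      proof (induction L)
        case (Cons \<beta> L)
        have "zeta_reg (sdot s \<beta>) = (sdot s \<beta> - 1) * zv \<beta>"
          unfolding zv_def by (rule zeta_reg_eq[OF Re1]) (use Cons in auto)
        thus ?case using Cons by simp
      qed auto
      have "ZP P s = LP P s * vP" "ZP Q s = LP Q s * vQ" unfolding vP_def vQ_def by (rule ZP; simp)+
      thus ?thesis using GE2 by (simp add: algebra_simps)
    qed
  qed
qed

text \<open>Far inside the cone every Euler factor is close to 1. Such a point witnesses that
  \<open>N\<close> and \<open>D\<close> are not identically zero, and hence that the numerator of
  the extension is not.\<close>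

lemma deep_point:
  fixes \<alpha> :: "nat \<Rightarrow> nat ^ ('n::finite)" and a :: "nat \<Rightarrow> int"
  assumes inj: "inj_on \<alpha> {1..r}" and nz: "\<And>j. j \<in> {1..r} \<Longrightarrow> \<alpha> j \<noteq> 0"
  obtains s :: "complex ^ 'n" where "s \<in> W r \<alpha> \<delta>" "s \<in> W r \<alpha> 1" "\<And>\<beta>. \<beta> \<noteq> 0 \<Longrightarrow> Re (sdot s \<beta>) > 1"
    "\<And>p. prime p \<Longrightarrow> euler_factor (h_poly r a \<alpha>) p s \<noteq> 0"
proof -
  define S where "S = (\<Sum>j=1..r. \<bar>real_of_int (a j)\<bar>)"
  obtain k :: nat where k: "real k > max (max 2 \<delta>) S" using reals_Archimedean2 by blast
  define s :: "complex ^ 'n" where "s = (\<chi> l. complex_of_real (real k))"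
  have ge: "Re (sdot s \<beta>) \<ge> real k" if "\<beta> \<noteq> 0" for \<beta>
    unfolding s_def using that by (intro sdot_ones_ge) auto
  show ?thesis
  proof (rule that[of s])
    have "Re (sdot s (\<alpha> j)) > max 2 \<delta>" if "j \<in> {1..r}" for j
      using ge[OF nz[OF that]] k by linarith
    thus "s \<in> W r \<alpha> \<delta>" "s \<in> W r \<alpha> 1" by (force simp: W_def)+
    show "Re (sdot s \<beta>) > 1" if "\<beta> \<noteq> 0" for \<beta> using ge[OF that] k by linarith
    fix p :: nat assume p: "prime p"
    have le: "norm (mono_val (prime_point p s) (\<alpha> j)) \<le> 2 powr (- real k)" if "j \<in> {1..r}" for j
    proof -
      have "norm (mono_val (prime_point p s) (\<alpha> j)) = real p powr (- Re (sdot s (\<alpha> j)))"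
        using prime_gt_0_nat[OF p] by (rule norm_mono_val_prime_point)
      also have "\<dots> \<le> real p powr (- real k)"
        using ge[OF nz[OF that]] prime_ge_1_nat[OF p] by (intro powr_mono) auto
      also have "\<dots> \<le> 2 powr (- real k)"
        using prime_ge_2_nat[OF p] by (intro powr_mono2') auto
      finally show ?thesis .
    qed
    have "norm (\<Sum>j=1..r. of_int (a j) * mono_val (prime_point p s) (\<alpha> j)) \<le>
        (\<Sum>j=1..r. \<bar>real_of_int (a j)\<bar> * 2 powr (- real k))"
      by (rule sum_norm_le) (auto simp: norm_mult intro!: mult_left_mono le)
    also have "\<dots> = S * 2 powr (- real k)" by (simp add: S_def sum_distrib_right)
    also have "\<dots> < 1"
    \<comment> \<open>Since S < k < 2^k, the sum of the nonconstant terms stays below 1 in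
      modulus.\<close>
    proof -
      have "S < real k" using k by simp
      also have "\<dots> < 2 ^ k" by (rule of_nat_less_two_power)
      finally show ?thesis by (simp add: powr_minus powr_realpow field_simps)
    qed
    finally have "norm (\<Sum>j=1..r. of_int (a j) * mono_val (prime_point p s) (\<alpha> j)) < 1" .
    moreover have "eval_mpoly (h_poly r a \<alpha>) (prime_point p s) =
        1 + (\<Sum>j=1..r. of_int (a j) * mono_val (prime_point p s) (\<alpha> j))"
      by (rule eval_h_poly) (use inj nz in auto)
    ultimately show "euler_factor (h_poly r a \<alpha>) p s \<noteq> 0"
      unfolding euler_factor_def by (metis add_eq_0_iff less_irrefl norm_minus_cancel norm_one)
  qed
qed

section \<open>Zeros forced on the numerator of a meromorphic extension\<close>

lemma W_Int: "\<delta> \<le> \<delta>' \<Longrightarrow> W r \<alpha> \<delta>' \<subseteq> W r \<alpha> \<delta>"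
  by (force simp: W_def)

lemma W_0_imp_W_pos:
  assumes "s \<in> W r \<alpha> 0"
  shows "\<exists>\<delta>>0. s \<in> W r \<alpha> \<delta>"
proof -
  define m where "m = Min (insert 1 ((\<lambda>j. Re (sdot s (\<alpha> j))) ` {1..r}))"
  have "m > 0" unfolding m_def using assms by (subst Min_gr_iff) (auto simp: W_def)
  moreover have "Re (sdot s (\<alpha> j)) \<ge> m" if "j \<in> {1..r}" for j
    unfolding m_def using that by (intro Min_le) auto
  ultimately show ?thesis by (intro exI[of _ "m / 2"]) (force simp: W_def)
qed

text \<open>If f/g represents the extension near \<open>s1\<close>, then f D = g N holds wherever
  the ball meets \<open>W(\<delta>)\<close>. At a zero of an Euler factor N vanishes, and D does not
  if all relevant zeta values are finite and nonzero, so f vanishes. The value of \<delta> may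
  depend on the zero, while f does not. If f were identically zero, so would N be, contrary to
  \<open>deep_point\<close>.\<close>

lemma meromorphic_extension_zeros:
  fixes \<alpha> :: "nat \<Rightarrow> nat ^ ('n::finite)" and a :: "nat \<Rightarrow> int"
  assumes inj: "inj_on \<alpha> {1..r}" and nz: "\<And>j. j \<in> {1..r} \<Longrightarrow> \<alpha> j \<noteq> 0"
    and Z: "euler_extension r a \<alpha> Z"
    and F: "meromorphic_several F B" "open B" "coincide_on (B \<inter> W r \<alpha> 0) F Z"
    and s1: "s1 \<in> B" "s1 \<in> closure (W r \<alpha> 0)"
  obtains \<eta> f where "\<eta> > 0" "ball s1 \<eta> \<subseteq> B" "holomorphic_several f (ball s1 \<eta>)" "\<exists>w\<in>ball s1 \<eta>. f w \<noteq> 0"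
    "\<And>s p. s \<in> ball s1 \<eta> \<Longrightarrow> s \<in> W r \<alpha> 0 \<Longrightarrow> prime p \<Longrightarrow> euler_factor (h_poly r a \<alpha>) p s = 0 \<Longrightarrow>
       \<forall>\<beta>. \<beta> \<noteq> 0 \<longrightarrow> Re (sdot s \<beta>) > 0 \<longrightarrow> sdot s \<beta> \<noteq> 1 \<and> zeta_reg (sdot s \<beta>) \<noteq> 0 \<Longrightarrow> f s = 0"
proof -
  obtain \<eta> f g where V: "\<eta> > 0" "ball s1 \<eta> \<subseteq> B" "holomorphic_several f (ball s1 \<eta>)"
    "holomorphic_several g (ball s1 \<eta>)"
    "\<And>A. open A \<Longrightarrow> A \<noteq> {} \<Longrightarrow> A \<subseteq> ball s1 \<eta> \<Longrightarrow> \<exists>w\<in>A. g w \<noteq> 0"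
    "\<And>w. w \<in> ball s1 \<eta> \<Longrightarrow> g w \<noteq> 0 \<Longrightarrow> F w = f w / g w"
    by (rule meromorphic_several_local_quotient[OF F(1) s1(1)]) blast
  have Zm: "meromorphic_several Z (W r \<alpha> 0)"
    and Zc: "coincide_on (W r \<alpha> 1) Z (euler_product (h_poly r a \<alpha>))"
    using Z by (auto simp: euler_extension_def)
  from Zc obtain D1 where D1: "open D1" "D1 \<subseteq> W r \<alpha> 1" "W r \<alpha> 1 \<subseteq> closure D1"
    "\<And>w. w \<in> D1 \<Longrightarrow> Z w = euler_product (h_poly r a \<alpha>) w" by (auto simp: coincide_on_def)
  from F(3) obtain D2 where D2: "open D2" "D2 \<subseteq> B \<inter> W r \<alpha> 0" "B \<inter> W r \<alpha> 0 \<subseteq> closure D2"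
    "\<And>w. w \<in> D2 \<Longrightarrow> F w = Z w" by (auto simp: coincide_on_def)
  have key: "f x * D x = g x * N x"
    if DN: "\<delta> > 0" "line_holomorphic D (W r \<alpha> \<delta>)" "line_holomorphic N (W r \<alpha> \<delta>)"
    "\<And>s. s \<in> W r \<alpha> \<delta> \<Longrightarrow> s \<in> W r \<alpha> 1 \<Longrightarrow> euler_product (h_poly r a \<alpha>) s * D s = N s"
    and x: "x \<in> ball s1 \<eta> \<inter> W r \<alpha> \<delta>" for \<delta> D N x
  proof -
    obtain s3 where s3: "s3 \<in> W r \<alpha> \<delta>" "s3 \<in> W r \<alpha> 1"
      by (rule deep_point[of \<alpha> r \<delta>]) (use inj nz in auto)
    define A where "A = D1 \<inter> W r \<alpha> \<delta>"
    have A: "open A" "A \<subseteq> W r \<alpha> \<delta>" unfolding A_def using D1 W_open by blast+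
    have "A \<noteq> {}"
      using s3 D1(3) W_open[of r \<alpha> \<delta>] unfolding A_def by (metis Int_commute disjoint_iff open_Int_closure_eq_empty subset_iff)
    have AZ: "Z w * D w = N w" if "w \<in> A" for w
      using that D1 DN(4) by (auto simp: A_def)
    define C where "C = ball s1 \<eta> \<inter> W r \<alpha> \<delta>"
    have C: "open C" "convex C" "C \<subseteq> W r \<alpha> \<delta>" "C \<subseteq> ball s1 \<eta>" "C \<noteq> {}"
      unfolding C_def using W_open x convex_Int[OF convex_ball W_convex] by auto
    have sub0: "W r \<alpha> \<delta> \<subseteq> W r \<alpha> 0" using DN(1) by (intro W_Int) auto
    obtain T where T: "open T" "T \<noteq> {}" "T \<subseteq> C" "\<And>w. w \<in> T \<Longrightarrow> Z w * D w = N w"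
      by (rule meromorphic_identity_propagation[OF Zm W_open W_convex sub0 DN(2,3) A(1) \<open>A \<noteq> {}\<close> A(2) AZ C(1,5,3)]; blast)
    \<comment> \<open>\<open>F\<close> agrees with \<open>Z\<close> only on a dense open set, so the
      open set carrying the identity has to be cut down once more.\<close>
    define T' where "T' = T \<inter> D2"
    have T': "open T'" "T' \<subseteq> C" unfolding T'_def using T D2 by auto
    have TC: "T \<subseteq> closure D2" using T(3) C(3,4) V(2) sub0 D2(3) by blast
    have "T' \<noteq> {}"
      unfolding T'_def using T(1,2) TC by (metis Int_absorb2 open_Int_closure_eq_empty)
    show ?thesis
    proof (rule quotient_representation[OF T'(1) \<open>T' \<noteq> {}\<close> T'(2) C(1,2)])
      show "line_holomorphic D C" by (rule line_holomorphic_subset[OF DN(2) C(3)])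
      show "line_holomorphic N C" by (rule line_holomorphic_subset[OF DN(3) C(3)])
      show "holomorphic_several f C" by (rule holomorphic_several_subset[OF V(3) C(4)])
      show "holomorphic_several g C" by (rule holomorphic_several_subset[OF V(4) C(4)])
      show "\<exists>w\<in>A. g w \<noteq> 0" if "open A" "A \<noteq> {}" "A \<subseteq> C" for A
        by (rule V(5)[OF that(1,2)]) (use that C(4) in auto)
      show "Z w = f w / g w" if "w \<in> T'" "g w \<noteq> 0" for w
        using V(6)[of w] D2(4)[of w] that T'(2) C(4) by (auto simp: T'_def)
      show "Z w * D w = N w" if "w \<in> T'" for w using T(4) that by (simp add: T'_def)
      show "x \<in> C" using x by (simp add: C_def)
    qed
  qed
  show ?thesis
  proof (rule that[OF V(1,2,3)])
    fix s p assume s: "s \<in> ball s1 \<eta>" "s \<in> W r \<alpha> 0" "prime p" "euler_factor (h_poly r a \<alpha>) p s = 0"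
      and hyp: "\<forall>\<beta>. \<beta> \<noteq> 0 \<longrightarrow> Re (sdot s \<beta>) > 0 \<longrightarrow> sdot s \<beta> \<noteq> 1 \<and> zeta_reg (sdot s \<beta>) \<noteq> 0"
    from W_0_imp_W_pos[OF s(2)] obtain \<delta> where \<delta>: "\<delta> > 0" "s \<in> W r \<alpha> \<delta>" by blast
    obtain D N where DN: "line_holomorphic D (W r \<alpha> \<delta>)" "line_holomorphic N (W r \<alpha> \<delta>)"
      "\<And>s. s \<in> W r \<alpha> \<delta> \<Longrightarrow> s \<in> W r \<alpha> 1 \<Longrightarrow> euler_product (h_poly r a \<alpha>) s * D s = N s"
      "\<And>s. s \<in> W r \<alpha> \<delta> \<Longrightarrow> (\<And>\<beta>. \<beta> \<noteq> 0 \<Longrightarrow> Re (sdot s \<beta>) > 0 \<Longrightarrow> sdot s \<beta> \<noteq> 1 \<and> zeta_reg (sdot s \<beta>) \<noteq> 0) \<Longrightarrow> D s \<noteq> 0"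
      "\<And>s p. s \<in> W r \<alpha> \<delta> \<Longrightarrow> prime p \<Longrightarrow> euler_factor (h_poly r a \<alpha>) p s = 0 \<Longrightarrow> N s = 0"
      by (rule euler_product_factorization[OF inj _ \<delta>(1), of a]) (use nz in auto)
    have "f s * D s = g s * N s" by (rule key[OF \<delta>(1) DN(1,2,3)]) (use s \<delta> in auto)
    moreover have "N s = 0" by (rule DN(5)[OF \<delta>(2) s(3,4)])
    moreover have "D s \<noteq> 0" by (rule DN(4)[OF \<delta>(2)]) (use hyp in blast)
    ultimately show "f s = 0" by simp
  next
    show "\<exists>w\<in>ball s1 \<eta>. f w \<noteq> 0"
    proof (rule ccontr)
      assume "\<not> (\<exists>w\<in>ball s1 \<eta>. f w \<noteq> 0)"
      hence f0: "f w = 0" if "w \<in> ball s1 \<eta>" for w using that by blast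
      obtain s2 where s2: "s2 \<in> W r \<alpha> 0" "s2 \<in> ball s1 \<eta>"
        using s1(2) V(1) by (metis closure_approachable dist_commute mem_ball)
      from W_0_imp_W_pos[OF s2(1)] obtain \<delta> where \<delta>: "\<delta> > 0" "s2 \<in> W r \<alpha> \<delta>" by blast
      obtain D N where DN: "line_holomorphic D (W r \<alpha> \<delta>)" "line_holomorphic N (W r \<alpha> \<delta>)"
        "\<And>s. s \<in> W r \<alpha> \<delta> \<Longrightarrow> s \<in> W r \<alpha> 1 \<Longrightarrow> euler_product (h_poly r a \<alpha>) s * D s = N s"
        "\<And>s. s \<in> W r \<alpha> 1 \<Longrightarrow> (\<And>p. prime p \<Longrightarrow> euler_factor (h_poly r a \<alpha>) p s \<noteq> 0) \<Longrightarrow> euler_product (h_poly r a \<alpha>) s \<noteq> 0"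
        "\<And>s. s \<in> W r \<alpha> \<delta> \<Longrightarrow> (\<And>\<beta>. \<beta> \<noteq> 0 \<Longrightarrow> Re (sdot s \<beta>) > 0 \<Longrightarrow> sdot s \<beta> \<noteq> 1 \<and> zeta_reg (sdot s \<beta>) \<noteq> 0) \<Longrightarrow> D s \<noteq> 0"
        by (rule euler_product_factorization[OF inj _ \<delta>(1), of a]) (use nz in auto)
      define C where "C = ball s1 \<eta> \<inter> W r \<alpha> \<delta>"
      have C: "open C" "C \<noteq> {}" "C \<subseteq> ball s1 \<eta>" "C \<subseteq> W r \<alpha> \<delta>"
        unfolding C_def using W_open s2 \<delta> by auto
      define T where "T = C \<inter> {w. g w \<noteq> 0}"
      have T: "open T" unfolding T_def by (rule open_Int_nonzero[OF V(4)]) (use C in auto)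
      have T': "T \<noteq> {}" "T \<subseteq> W r \<alpha> \<delta>" using V(5)[OF C(1-3)] C(4) by (auto simp: T_def)
      have N0: "N w = 0" if "w \<in> T" for w
      proof -
        have w: "w \<in> ball s1 \<eta> \<inter> W r \<alpha> \<delta>" "g w \<noteq> 0" using that by (auto simp: T_def C_def)
        have "f w * D w = g w * N w" by (rule key[OF \<delta>(1) DN(1,2,3) w(1)])
        thus ?thesis using w f0 by auto
      qed
      obtain s3 where s3: "s3 \<in> W r \<alpha> \<delta>" "s3 \<in> W r \<alpha> 1" "\<And>\<beta>. \<beta> \<noteq> 0 \<Longrightarrow> Re (sdot s3 \<beta>) > 1"
        "\<And>p. prime p \<Longrightarrow> euler_factor (h_poly r a \<alpha>) p s3 \<noteq> 0"
        by (rule deep_point[OF inj, of \<delta> a]) (use nz in auto)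
      have "N s3 = 0"
        by (rule line_holomorphic_identity[OF DN(2) W_open W_convex T T' N0 s3(1)])
      moreover have "D s3 \<noteq> 0"
      proof (rule DN(5)[OF s3(1)])
        fix \<beta> :: "nat ^ 'n" assume "\<beta> \<noteq> 0"
        from s3(3)[OF this] show "sdot s3 \<beta> \<noteq> 1 \<and> zeta_reg (sdot s3 \<beta>) \<noteq> 0"
          using zeta_reg_nonzero by auto
      qed
      moreover have "euler_product (h_poly r a \<alpha>) s3 \<noteq> 0" by (rule DN(4)[OF s3(2,4)])
      ultimately show False using DN(3)[OF s3(1,2)] by simp
    qed
  qed
qed

section \<open>Polynomials all of whose roots have modulus one\<close>

definition wprod :: "(nat \<Rightarrow> nat) \<Rightarrow> nat \<Rightarrow> int poly" where
  "wprod e N = (\<Prod>k\<in>{1..<N}. (1 - monom 1 k) ^ e k)"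

lemma wprod_Suc: "N \<ge> 1 \<Longrightarrow> wprod e (Suc N) = wprod e N * (1 - monom 1 N) ^ e N"
  by (simp add: wprod_def atLeastLessThanSuc mult.commute)

lemma wprod_cong: "(\<And>k. 1 \<le> k \<Longrightarrow> k < N \<Longrightarrow> e k = e' k) \<Longrightarrow> wprod e N = wprod e' N"
  unfolding wprod_def by (rule prod.cong) auto

section \<open>Factoring integral power series into factors 1 - T^k\<close>

lemma one_minus_monom_power:
  assumes "N \<ge> 1"
  shows "\<exists>q. (1 - monom 1 N :: int poly) ^ m = 1 - of_nat m * monom 1 N + monom 1 (Suc N) * q"
proof (induction m)
  case 0
  show ?case by (intro exI[of _ 0]) simp
next
  case (Suc m)
  then obtain q where q: "(1 - monom 1 N :: int poly) ^ m = 1 - of_nat m * monom 1 N + monom 1 (Suc N) * q" by blast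
  have sq: "monom 1 N * monom 1 N = (monom 1 (Suc N) * monom 1 (N - 1) :: int poly)"
    using assms by (simp add: mult_monom)
  have "(1 - monom 1 N :: int poly) ^ Suc m = (1 - monom 1 N) * (1 - of_nat m * monom 1 N + monom 1 (Suc N) * q)"
    using q by simp
  also have "\<dots> = 1 - of_nat (Suc m) * monom 1 N + (of_nat m * (monom 1 N * monom 1 N) + monom 1 (Suc N) * (q - monom 1 N * q))"
    by (simp add: algebra_simps)
  also have "\<dots> = 1 - of_nat (Suc m) * monom 1 N + monom 1 (Suc N) * (of_nat m * monom 1 (N - 1) + (q - monom 1 N * q))"
    unfolding sq by (simp add: algebra_simps)
  finally show ?case by blast
qed

lemma coeff_0_wprod: "coeff (wprod e N) 0 = 1"
proof -
  have "poly (wprod e N) 0 = 1"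
    unfolding wprod_def poly_prod by (rule prod.neutral) (auto simp: poly_monom zero_power)
  thus ?thesis by (simp add: poly_0_coeff_0)
qed

text \<open>Over the integers a series with constant term 1 is an infinite product of powers of 1 -
  T^k; the k-th exponent is read off from the first coefficient not yet matched. Negative exponents
  are moved to the side of \<open>H\<close>.\<close>

lemma witt_exponents:
  fixes H :: "int poly"
  assumes H0: "coeff H 0 = 1"
  shows "\<exists>\<gamma>::nat \<Rightarrow> int. \<forall>N\<ge>1. monom 1 N dvd H * wprod (\<lambda>k. nat (- \<gamma> k)) N - wprod (\<lambda>k. nat (\<gamma> k)) N"
proof -
  define P where "P = (\<lambda>n (g :: nat \<Rightarrow> int). monom 1 (Suc n) dvd H * wprod (\<lambda>k. nat (- g k)) (Suc n) - wprod (\<lambda>k. nat (g k)) (Suc n))"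
  have "\<exists>f. \<forall>n. P n (f n) \<and> (\<forall>k\<le>n. f (Suc n) k = f n k)"
  proof (rule dependent_nat_choice)
    show "\<exists>g. P 0 g"
      unfolding P_def monom_1_dvd_iff' by (intro exI[of _ "\<lambda>_. 0"]) (simp add: wprod_def H0)
    fix g n assume g: "P n g"
    define N where "N = Suc n"
    define A where "A = wprod (\<lambda>k. nat (- g k)) N"
    define B where "B = wprod (\<lambda>k. nat (g k)) N"
    from g obtain q where q: "H * A - B = monom 1 N * q" by (auto simp: P_def A_def B_def N_def elim: dvdE)
    define c where "c = coeff q 0"
    \<comment> \<open>The error has leading term c T^N. A power \<open>nat c\<close> of 1 - T^N on
      the side of \<open>H\<close> and a power \<open>nat (- c)\<close> on the other side change
      this coefficient by - c.\<close>
    define g' where "g' = g(N := - c)"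
    have gA: "wprod (\<lambda>k. nat (- g' k)) N = A" "wprod (\<lambda>k. nat (g' k)) N = B"
      unfolding A_def B_def by (auto simp: g'_def intro!: wprod_cong)
    have N1: "N \<ge> 1" by (simp add: N_def)
    obtain qA where qA: "(1 - monom 1 N :: int poly) ^ nat c = 1 - of_nat (nat c) * monom 1 N + monom 1 (Suc N) * qA"
      using one_minus_monom_power[OF N1] by blast
    obtain qB where qB: "(1 - monom 1 N :: int poly) ^ nat (- c) = 1 - of_nat (nat (- c)) * monom 1 N + monom 1 (Suc N) * qB"
      using one_minus_monom_power[OF N1] by blast
    have c: "int (nat c) - int (nat (- c)) = c" by simp
    define E where "E = H * A * (1 - monom 1 N) ^ nat c - B * (1 - monom 1 N) ^ nat (- c)"
    have E: "E = monom 1 N * (q - of_nat (nat c) * (H * A) + of_nat (nat (- c)) * B) + monom 1 (Suc N) * (H * A * qA - B * qB)"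
    proof -
      have "E = (H * A - B) - of_nat (nat c) * (monom 1 N * (H * A)) + of_nat (nat (- c)) * (monom 1 N * B) + monom 1 (Suc N) * (H * A * qA - B * qB)"
        unfolding E_def qA qB by (simp add: algebra_simps)
      thus ?thesis unfolding q by (simp add: algebra_simps)
    qed
    have A0: "coeff (H * A) 0 = 1" "coeff B 0 = 1" using H0 coeff_0_wprod by (auto simp: A_def B_def coeff_mult_0)
    have "coeff (q - of_nat (nat c) * (H * A) + of_nat (nat (- c)) * B) 0 = 0"
      using A0 c by (simp add: c_def coeff_mult_0 of_nat_poly)
    hence "monom 1 1 dvd q - of_nat (nat c) * (H * A) + of_nat (nat (- c)) * B"
      unfolding monom_1_dvd_iff' by simp
    hence "monom 1 N * monom 1 1 dvd monom 1 N * (q - of_nat (nat c) * (H * A) + of_nat (nat (- c)) * B)"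
      by (intro mult_dvd_mono dvd_refl)
    hence "monom 1 (Suc N) dvd E" unfolding E by (intro dvd_add) (simp_all add: mult_monom)
    moreover have "H * wprod (\<lambda>k. nat (- g' k)) (Suc N) - wprod (\<lambda>k. nat (g' k)) (Suc N) = E"
      unfolding wprod_Suc[OF N1] gA E_def by (simp add: g'_def mult.assoc)
    ultimately have "P (Suc n) g'" by (simp add: P_def N_def)
    moreover have "\<forall>k\<le>n. g' k = g k" by (simp add: g'_def N_def)
    ultimately show "\<exists>y. P (Suc n) y \<and> (\<forall>k\<le>n. y k = g k)" by blast
  qed
  then obtain f where f: "\<And>n. P n (f n)" "\<And>n k. k \<le> n \<Longrightarrow> f (Suc n) k = f n k" by blast
  have stab: "f n k = f k k" if "k \<le> n" for n k
    using that by (induction n rule: dec_induct) (auto simp: f(2))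
  show ?thesis
  proof (intro exI[of _ "\<lambda>k. f k k"] allI impI)
    fix N :: nat assume "N \<ge> 1"
    then obtain n where n: "N = Suc n" by (cases N) auto
    have st: "f n k = f k k" if "k < N" for k using stab[of k n] that n by (simp only: less_Suc_eq_le)
    have "wprod (\<lambda>k. nat (- f n k)) N = wprod (\<lambda>k. nat (- f k k)) N"
      "wprod (\<lambda>k. nat (f n k)) N = wprod (\<lambda>k. nat (f k k)) N"
      by (rule wprod_cong; simp only: st)+
    thus "monom 1 N dvd H * wprod (\<lambda>k. nat (- f k k)) N - wprod (\<lambda>k. nat (f k k)) N"
      using f(1)[of n] n by (simp add: P_def)
  qed
qed

text \<open>The operator T f'/f turns products into sums and sends 1 - b T to the series with
  coefficients - b^n. Applied to \<open>H\<close> it yields the negative power sums of the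
  reciprocal roots.\<close>

definition fps_X_log_deriv :: "complex fps \<Rightarrow> complex fps" where
  "fps_X_log_deriv f = fps_X * fps_deriv f * inverse f"

lemma fps_X_log_deriv_mult:
  assumes "fps_nth f 0 \<noteq> 0" "fps_nth g 0 \<noteq> 0"
  shows "fps_X_log_deriv (f * g) = fps_X_log_deriv f + fps_X_log_deriv g"
proof -
  have 1: "f * inverse f = 1" "g * inverse g = 1" using assms by (simp_all add: inverse_mult_eq_1')
  have "fps_X_log_deriv (f * g) = fps_X * (f * fps_deriv g + fps_deriv f * g) * (inverse f * inverse g)"
    unfolding fps_X_log_deriv_def fps_deriv_mult fps_inverse_mult ..
  also have "\<dots> = (fps_X * fps_deriv f * inverse f) * (g * inverse g) + (fps_X * fps_deriv g * inverse g) * (f * inverse f)"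
    by (simp only: algebra_simps)
  finally show ?thesis unfolding 1 by (simp add: fps_X_log_deriv_def)
qed

lemma fps_X_log_deriv_1 [simp]: "fps_X_log_deriv 1 = 0" by (simp add: fps_X_log_deriv_def)

lemma fps_X_log_deriv_power: "fps_nth f 0 \<noteq> 0 \<Longrightarrow> fps_X_log_deriv (f ^ n) = of_nat n * fps_X_log_deriv f"
  by (induction n) (auto simp: fps_X_log_deriv_mult algebra_simps fps_power_zeroth)

lemma fps_nth_prod_0: "fps_nth (\<Prod>i\<in>I. f i) 0 = (\<Prod>i\<in>I. fps_nth (f i) 0 :: complex)"
  by (induction I rule: infinite_finite_induct) auto

lemma fps_X_log_deriv_prod:
  assumes "\<And>i. i \<in> I \<Longrightarrow> fps_nth (f i) 0 \<noteq> 0"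
  shows "fps_X_log_deriv (\<Prod>i\<in>I. f i) = (\<Sum>i\<in>I. fps_X_log_deriv (f i))"
  using assms
proof (induction I rule: infinite_finite_induct)
  case (insert i I)
  have "fps_nth (\<Prod>i\<in>I. f i) 0 \<noteq> 0" using insert by (simp add: fps_nth_prod_0)
  thus ?case using insert by (simp add: fps_X_log_deriv_mult)
qed auto

text \<open>Newton's recursion: for constant term 1 the n-th coefficient of T f'/f depends only on
  the coefficients of f up to n.\<close>

lemma fps_X_log_deriv_nth_cong:
  assumes "fps_nth f 0 = 1" "fps_nth g 0 = 1" and eq: "\<And>n. n < N \<Longrightarrow> fps_nth f n = fps_nth g n"
  shows "n < N \<Longrightarrow> fps_nth (fps_X_log_deriv f) n = fps_nth (fps_X_log_deriv g) n"
proof (induction n rule: less_induct)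
  case (less n)
  have rec: "fps_nth (fps_X_log_deriv h) n = of_nat n * fps_nth h n - (\<Sum>i<n. fps_nth (fps_X_log_deriv h) i * fps_nth h (n - i))"
    if h: "fps_nth h 0 = 1" for h
  proof -
    have "fps_X_log_deriv h * h = fps_X * fps_deriv h * (inverse h * h)" by (simp add: fps_X_log_deriv_def mult.assoc)
    also have "inverse h * h = 1" by (rule inverse_mult_eq_1) (use h in auto)
    finally have "fps_nth (fps_X_log_deriv h * h) n = fps_nth (fps_X * fps_deriv h) n" by simp
    also have "\<dots> = of_nat n * fps_nth h n" by (cases n) auto
    also have "fps_nth (fps_X_log_deriv h * h) n = (\<Sum>i=0..n. fps_nth (fps_X_log_deriv h) i * fps_nth h (n - i))" by (rule fps_mult_nth)
    also have "{0..n} = insert n {..<n}" by auto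
    also have "(\<Sum>i\<in>insert n {..<n}. fps_nth (fps_X_log_deriv h) i * fps_nth h (n - i)) =
        fps_nth (fps_X_log_deriv h) n + (\<Sum>i<n. fps_nth (fps_X_log_deriv h) i * fps_nth h (n - i))" using h by (subst sum.insert) auto
    finally show ?thesis by (simp add: algebra_simps)
  qed
  show ?case unfolding rec[OF assms(1)] rec[OF assms(2)] using less eq by simp
qed

lemma fps_X_log_deriv_nth_linear: "fps_nth (fps_X_log_deriv (1 - fps_const b * fps_X)) n = (if n = 0 then 0 else - (b ^ n))"
proof -
  define f where "f = (1 - fps_const b * fps_X :: complex fps)"
  define g where "g = Abs_fps (\<lambda>n. if n = 0 then 0 else - (b ^ n))"
  have f0: "fps_nth f 0 \<noteq> 0" by (simp add: f_def)
  have "g * f = fps_X * fps_deriv f"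
  proof (rule fps_ext)
    fix n show "fps_nth (g * f) n = fps_nth (fps_X * fps_deriv f) n"
    proof (cases n)
      case (Suc m)
      have "fps_nth (g * f) n = fps_nth g n - b * fps_nth g m"
        unfolding f_def Suc by (simp add: algebra_simps)
      also have "\<dots> = (if m = 0 then - b else 0)" by (simp add: g_def Suc)
      also have "\<dots> = fps_nth (fps_X * fps_deriv f) n" by (auto simp: f_def Suc)
      finally show ?thesis .
    qed (simp add: f_def g_def)
  qed
  hence "fps_X_log_deriv f = g * (f * inverse f)" unfolding fps_X_log_deriv_def by (simp add: mult.assoc)
  also have "f * inverse f = 1" using f0 by (rule inverse_mult_eq_1')
  finally show ?thesis by (simp add: f_def g_def)
qed

lemma fps_X_log_deriv_nth_X_power:
  assumes "k \<ge> 1"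
  shows "fps_nth (fps_X_log_deriv (1 - fps_X ^ k)) n = (if n > 0 \<and> k dvd n then - of_nat k else 0)"
proof -
  define f where "f = (1 - fps_X ^ k :: complex fps)"
  define g where "g = Abs_fps (\<lambda>n. if n > 0 \<and> k dvd n then - of_nat k else 0 :: complex)"
  have f0: "fps_nth f 0 \<noteq> 0" using assms by (simp add: f_def)
  have "g * f = fps_X * fps_deriv f"
  proof (rule fps_ext)
    fix n
    have "fps_nth (g * f) n = fps_nth g n - fps_nth (g * fps_X ^ k) n"
      by (simp add: f_def right_diff_distrib)
    also have "fps_nth (g * fps_X ^ k) n = (if n < k then 0 else fps_nth g (n - k))"
      by (rule fps_X_power_mult_right_nth)
    also have "fps_nth g n - (if n < k then 0 else fps_nth g (n - k)) = (if n = k then - of_nat k else 0)"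
      using assms by (auto simp: g_def dvd_imp_le nat_dvd_not_less dvd_minus_self)
    also have "\<dots> = fps_nth (fps_X * fps_deriv f) n"
    proof -
      have "fps_nth (fps_X * fps_deriv f) n = of_nat n * fps_nth f n" by (cases n) auto
      also have "fps_nth f n = (if n = 0 then 1 else 0) - (if n = k then 1 else 0)" by (simp add: f_def)
      finally have "fps_nth (fps_X * fps_deriv f) n = of_nat n * ((if n = 0 then 1 else 0) - (if n = k then 1 else 0))" .
      thus ?thesis by auto
    qed
    finally show "fps_nth (g * f) n = fps_nth (fps_X * fps_deriv f) n" .
  qed
  hence "fps_X_log_deriv f = g * (f * inverse f)" unfolding fps_X_log_deriv_def by (simp add: mult.assoc)
  also have "f * inverse f = 1" using f0 by (rule inverse_mult_eq_1')
  finally show ?thesis by (simp add: f_def g_def)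
qed

text \<open>Inclusion-exclusion over the prime divisors of \<open>n\<close>, i.e. Moebius inversion with the bound
  \<open>2\<^sup>\<omega>\<^sup>(\<^sup>n\<^sup>)\<close>.\<close>

lemma divisor_sum_bound:
  fixes g :: "nat \<Rightarrow> real"
  assumes bd: "\<And>n. n \<ge> 1 \<Longrightarrow> \<bar>\<Sum>k | k dvd n. g k\<bar> \<le> D"
  shows "finite S \<Longrightarrow> n \<ge> 1 \<Longrightarrow> (\<forall>q\<in>S. prime q \<and> q dvd n) \<Longrightarrow>
     \<bar>\<Sum>k | k dvd n \<and> (\<forall>q\<in>S. \<not> k dvd n div q). g k\<bar> \<le> 2 ^ card S * D"
proof (induction S arbitrary: n rule: finite_induct)
  case empty
  thus ?case using bd by simp
next
  case (insert q S)
  define m where "m = n div q"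
  have q: "prime q" "n = q * m" using insert by (auto simp: m_def)
  have m1: "m \<ge> 1" using q insert by (cases m) auto
  have qS: "q \<noteq> s" if "s \<in> S" for s using that insert by auto
  have S: "prime s" "s dvd n" if "s \<in> S" for s using insert that by auto
  have Sm: "s dvd m" if s: "s \<in> S" for s
  proof -
    have "\<not> s dvd q" using S[OF s] q qS[OF s] primes_dvd_imp_eq by metis
    thus ?thesis using S[OF s] unfolding q(2) by (simp add: prime_dvd_mult_iff)
  qed
  define f where "f = (\<lambda>n S. \<Sum>k | k dvd n \<and> (\<forall>q\<in>S. \<not> k dvd n div q). g k)"
  have n0: "n > 0" using insert by simp
  have fin: "finite {k. k dvd n \<and> Q k}" for Q using n0 by (rule_tac finite_subset[of _ "{k. k dvd n}"]) auto
  \<comment> \<open>Passing from n to m = n/q leaves the remaining exclusions unchanged. If k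
    divides both q l and s l with distinct primes q and s, then it divides l.\<close>
  have eqv: "k dvd n div s \<longleftrightarrow> k dvd m div s" if k: "k dvd m" and s: "s \<in> S" for k s
  proof -
    obtain l where l: "m = s * l" using Sm[OF s] by (elim dvdE)
    have s0: "s > 0" using S[OF s] prime_gt_0_nat by blast
    have "n div s = q * l" unfolding q(2) l using s0 by (simp add: mult.left_commute)
    moreover have "m div s = l" unfolding l using s0 by simp
    moreover have "k dvd l" if "k dvd q * l"
    proof -
      have "k dvd gcd (q * l) (s * l)" using that k l by simp
      also have "gcd (q * l) (s * l) = gcd q s * l" by (simp add: gcd_mult_distrib_nat[symmetric] mult.commute)
      also have "gcd q s = 1" using primes_coprime[OF q(1) S(1)[OF s] qS[OF s]] by simp
      finally show ?thesis by simp
    qed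
    ultimately show ?thesis by auto
  qed
  have "f n S = (\<Sum>k\<in>{k. k dvd n \<and> (\<forall>s\<in>insert q S. \<not> k dvd n div s)} \<union> {k. k dvd n \<and> k dvd m \<and> (\<forall>s\<in>S. \<not> k dvd n div s)}. g k)"
    unfolding f_def by (rule sum.cong) (auto simp: m_def)
  also have "\<dots> = f n (insert q S) + (\<Sum>k\<in>{k. k dvd n \<and> k dvd m \<and> (\<forall>s\<in>S. \<not> k dvd n div s)}. g k)"
    unfolding f_def by (rule sum.union_disjoint) (auto simp: m_def intro: fin)
  also have "{k. k dvd n \<and> k dvd m \<and> (\<forall>s\<in>S. \<not> k dvd n div s)} = {k. k dvd m \<and> (\<forall>s\<in>S. \<not> k dvd m div s)}"
    using eqv unfolding q(2) by auto
  finally have "f n (insert q S) = f n S - f m S" by (simp add: f_def)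
  moreover have "\<bar>f n S\<bar> \<le> 2 ^ card S * D" unfolding f_def by (rule insert.IH) (use insert in auto)
  moreover have "\<bar>f m S\<bar> \<le> 2 ^ card S * D" unfolding f_def by (rule insert.IH) (use m1 Sm S in auto)
  ultimately have "\<bar>f n (insert q S)\<bar> \<le> 2 ^ card (insert q S) * D" using insert by simp
  thus ?case by (simp add: f_def)
qed

text \<open>Every prime factor other than 2 and 3 is at least 4, so 4 to the number of prime factors
  is at most 16 n; the bound is its square root. What matters below is growth slower than n.\<close>

lemma two_power_prime_factors:
  assumes "n \<ge> (1::nat)"
  shows "(2::real) ^ card (prime_factors n) \<le> 4 * sqrt (real n)"
proof -
  define S where "S = prime_factors n"
  define S1 where "S1 = S \<inter> {2, 3}"
  define S2 where "S2 = S - {2, 3}"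
  have fin: "finite S" "finite S1" "finite S2" by (auto simp: S_def S1_def S2_def)
  have pr: "prime p" if "p \<in> S" for p using that by (auto simp: S_def)
  have "card S1 \<le> card {2, 3::nat}" unfolding S1_def by (rule card_mono) auto
  hence c1: "card S1 \<le> 2" by simp
  have "(\<Prod>p\<in>S2. 4) \<le> (\<Prod>p\<in>S2. p)"
  proof (rule prod_mono)
    fix p assume p: "p \<in> S2"
    hence "p \<ge> 2" "p \<noteq> 2" "p \<noteq> 3" using pr prime_ge_2_nat by (auto simp: S2_def)
    thus "0 \<le> (4::nat) \<and> 4 \<le> p" by simp
  qed
  also have "\<dots> dvd n"
  proof -
    have "(\<Prod>p\<in>S2. p) dvd (\<Prod>p\<in>S. p ^ multiplicity p n)"
    proof (rule dvd_trans)
      show "(\<Prod>p\<in>S2. p) dvd (\<Prod>p\<in>S2. p ^ multiplicity p n)"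
        by (rule prod_dvd_prod) (auto simp: S2_def S_def prime_factors_multiplicity)
      show "(\<Prod>p\<in>S2. p ^ multiplicity p n) dvd (\<Prod>p\<in>S. p ^ multiplicity p n)"
        by (rule prod_dvd_prod_subset) (auto simp: fin S2_def)
    qed
    also have "\<dots> = n" unfolding S_def by (rule prime_factorization_nat[symmetric]) (use assms in simp)
    finally show ?thesis .
  qed
  hence "(\<Prod>p\<in>S2. p) \<le> n" using assms by (intro dvd_imp_le) auto
  finally have c2: "4 ^ card S2 \<le> n" by simp
  have "card S = card S1 + card S2"
    using fin by (subst card_Un_disjoint[symmetric]) (auto simp: S1_def S2_def intro!: arg_cong[where f = card])
  hence "(4::nat) ^ card S = 4 ^ card S1 * 4 ^ card S2" by (simp add: power_add)
  also have "\<dots> \<le> 4 ^ 2 * n" using c1 c2 by (intro mult_mono power_increasing) auto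
  finally have "(4::nat) ^ card S \<le> 16 * n" by simp
  hence "real (4 ^ card S) \<le> real (16 * n)" by (rule of_nat_mono)
  hence "(4::real) ^ card S \<le> 16 * real n" by simp
  moreover have "((2::real) ^ card S)\<^sup>2 = 4 ^ card S" by (simp add: power2_eq_square flip: power_mult_distrib)
  ultimately have "((2::real) ^ card S)\<^sup>2 \<le> 16 * real n" by simp
  hence "(2::real) ^ card S \<le> sqrt (16 * real n)" by (rule real_le_rsqrt)
  also have "\<dots> = 4 * sqrt (real n)" by (simp add: real_sqrt_mult)
  finally show ?thesis by (simp add: S_def)
qed

text \<open>The only divisor of n that divides none of the n/q, with q a prime factor of n, is n
  itself, so the filtered sum reduces to the single value \<open>g n\<close>.\<close>

lemma divisor_sum_inverse_bound:
  fixes g :: "nat \<Rightarrow> real"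
  assumes bd: "\<And>n. n \<ge> 1 \<Longrightarrow> \<bar>\<Sum>k | k dvd n. g k\<bar> \<le> D" and "n \<ge> 1"
  shows "\<bar>g n\<bar> \<le> 4 * sqrt (real n) * D"
proof -
  have "\<bar>\<Sum>k | k dvd n \<and> (\<forall>q\<in>prime_factors n. \<not> k dvd n div q). g k\<bar> \<le> 2 ^ card (prime_factors n) * D"
    using assms by (intro divisor_sum_bound) auto
  also have "{k. k dvd n \<and> (\<forall>q\<in>prime_factors n. \<not> k dvd n div q)} = {n}"
  proof (intro equalityI subsetI)
    fix k assume k: "k \<in> {k. k dvd n \<and> (\<forall>q\<in>prime_factors n. \<not> k dvd n div q)}"
    then obtain l where l: "n = k * l" by (auto elim: dvdE)
    have "l = 1"
    proof (rule ccontr)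
      assume "l \<noteq> 1"
      then obtain q where q: "prime q" "q dvd l" using prime_factor_nat by blast
      then obtain l' where l': "l = q * l'" by (elim dvdE)
      have "q > 0" using q(1) prime_gt_0_nat by blast
      hence "n div q = k * l'" unfolding l l' by (simp add: mult.left_commute)
      moreover have "q \<in> prime_factors n" using q assms l by (auto simp: prime_factors_dvd)
      ultimately show False using k by auto
    qed
    thus "k \<in> {n}" using l by simp
  next
    fix k assume "k \<in> {n}"
    moreover have "\<not> n dvd n div q" if "q \<in> prime_factors n" for q
    proof
      assume "n dvd n div q"
      have q: "prime q" "q dvd n" using that by (auto simp: prime_factors_dvd)
      have "n div q < n" using prime_gt_1_nat[OF q(1)] assms by simp
      moreover have "n div q > 0" using q assms by (simp add: div_greater_zero_iff dvd_imp_le prime_gt_0_nat)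
      ultimately show False using \<open>n dvd n div q\<close> dvd_imp_le by fastforce
    qed
    ultimately show "k \<in> {k. k dvd n \<and> (\<forall>q\<in>prime_factors n. \<not> k dvd n div q)}" by auto
  qed
  finally have "\<bar>g n\<bar> \<le> 2 ^ card (prime_factors n) * D" by simp
  moreover have "D \<ge> 0" using bd[of 1] by (meson abs_ge_zero order_trans le_refl)
  ultimately show ?thesis using two_power_prime_factors[OF assms(2)] mult_right_mono by fastforce
qed

section \<open>Integer polynomials as complex power series\<close>

definition int_fps :: "int poly \<Rightarrow> complex fps" where
  "int_fps p = Abs_fps (\<lambda>n. of_int (coeff p n))"

lemma int_fps_nth [simp]: "fps_nth (int_fps p) n = of_int (coeff p n)"
  by (simp add: int_fps_def)

lemma int_fps_mult: "int_fps (p * q) = int_fps p * int_fps q"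
  by (rule fps_ext) (simp add: fps_mult_nth coeff_mult atLeast0AtMost)

lemma int_fps_1: "int_fps 1 = 1"
  by (rule fps_ext) (simp add: coeff_1)

lemma int_fps_power: "int_fps (p ^ n) = int_fps p ^ n"
  by (induction n) (simp_all add: int_fps_mult int_fps_1)

lemma int_fps_prod: "int_fps (\<Prod>i\<in>I. f i) = (\<Prod>i\<in>I. int_fps (f i))"
  by (induction I rule: infinite_finite_induct) (simp_all add: int_fps_mult int_fps_1)

lemma int_fps_one_minus_monom: "int_fps (1 - monom 1 k) = 1 - fps_X ^ k"
  by (rule fps_ext) (auto simp: )

lemma int_fps_wprod: "int_fps (wprod e N) = (\<Prod>k\<in>{1..<N}. (1 - fps_X ^ k) ^ e k)"
  by (simp add: wprod_def int_fps_prod int_fps_power int_fps_one_minus_monom)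

lemma fps_X_log_deriv_int_fps_wprod:
  assumes "n \<ge> 1"
  shows "fps_nth (fps_X_log_deriv (int_fps (wprod e N))) n = - (\<Sum>k\<in>{k\<in>{1..<N}. k dvd n}. of_nat (e k * k))"
proof -
  have "fps_X_log_deriv (int_fps (wprod e N)) = (\<Sum>k\<in>{1..<N}. fps_X_log_deriv ((1 - fps_X ^ k) ^ e k))"
    unfolding int_fps_wprod by (rule fps_X_log_deriv_prod) (auto simp: fps_power_zeroth power_0_left)
  also have "\<dots> = (\<Sum>k\<in>{1..<N}. of_nat (e k) * fps_X_log_deriv (1 - fps_X ^ k))"
    by (rule sum.cong[OF refl]) (auto intro!: fps_X_log_deriv_power simp: power_0_left)
  also have "fps_nth \<dots> n = (\<Sum>k\<in>{1..<N}. of_nat (e k) * fps_nth (fps_X_log_deriv (1 - fps_X ^ k)) n)"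
    by (simp add: fps_sum_nth flip: fps_of_nat)
  also have "\<dots> = (\<Sum>k\<in>{1..<N}. if k dvd n then - of_nat (e k * k) else 0)"
    by (rule sum.cong[OF refl]) (use assms in \<open>auto simp: fps_X_log_deriv_nth_X_power\<close>)
  also have "\<dots> = (\<Sum>k\<in>{k\<in>{1..<N}. k dvd n}. - of_nat (e k * k))"
    by (rule sum.inter_filter[symmetric]) simp
  finally show ?thesis by (simp add: sum_negf)
qed

text \<open>For the exponents \<gamma> of the product expansion, the sum of k \<gamma>(k) over the
  divisors k of n is the n-th power sum of the reciprocal roots. It is bounded because the roots are
  unimodular. Divisor inversion gives n |\<gamma>(n)| = O(sqrt n), so these integers vanish from
  some point on and the infinite product is finite.\<close>

lemma unit_roots_cyclotomic:
  fixes H :: "int poly"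
  assumes H0: "coeff H 0 = 1"
    and roots: "\<And>z::complex. poly (map_poly of_int H) z = 0 \<Longrightarrow> norm z = 1"
  shows "\<exists>K (\<gamma>::nat \<Rightarrow> int). H * wprod (\<lambda>k. nat (- \<gamma> k)) K = wprod (\<lambda>k. nat (\<gamma> k)) K"
proof -
  define Hc where "Hc = (map_poly of_int H :: complex poly)"
  have Hc0: "coeff Hc 0 = 1" using H0 by (simp add: Hc_def coeff_map_poly)
  hence Hcn: "Hc \<noteq> 0" by auto
  define R where "R = {z. poly Hc z = 0}"
  define o' where "o' = (\<lambda>z. order z Hc)"
  have finR: "finite R" unfolding R_def using Hcn by (rule poly_roots_finite)
  have nR: "norm z = 1" if "z \<in> R" for z using roots that by (simp add: R_def Hc_def)
  have dec: "smult (lead_coeff Hc) (\<Prod>z\<in>R. [:-z, 1:] ^ o' z) = Hc"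
    unfolding R_def o'_def by (rule complex_poly_decompose)
  have fac: "fps_of_poly [:-z, 1:] = fps_const (-z) * (1 - fps_const (1 / z) * fps_X)" if "z \<in> R" for z
  proof -
    have z: "z \<noteq> 0" using nR[OF that] by auto
    have "fps_const z * (fps_const (1 / z) * fps_X) = fps_X"
      using z by (simp add: mult.assoc[symmetric])
    thus ?thesis by (simp add: fps_of_poly_pCons algebra_simps flip: fps_const_neg)
  qed
  define P where "P = (\<Prod>z\<in>R. (1 - fps_const (1 / z) * fps_X) ^ o' z)"
  \<comment> \<open>Collects the leading coefficient and the factors - z taken out of the linear
    factors; constant coefficient 1 forces it to be 1.\<close>
  define l where "l = lead_coeff Hc * (\<Prod>z\<in>R. (-z) ^ o' z)"
  have "fps_of_poly Hc = fps_const (lead_coeff Hc) * (\<Prod>z\<in>R. fps_of_poly [:-z, 1:] ^ o' z)"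
    by (subst dec[symmetric]) (simp add: fps_of_poly_smult fps_of_poly_prod fps_of_poly_power)
  also have "(\<Prod>z\<in>R. fps_of_poly [:-z, 1:] ^ o' z) = (\<Prod>z\<in>R. fps_const ((-z) ^ o' z) * (1 - fps_const (1 / z) * fps_X) ^ o' z)"
    by (rule prod.cong[OF refl]) (simp only: fac power_mult_distrib fps_const_power)
  also have "\<dots> = fps_const (\<Prod>z\<in>R. (-z) ^ o' z) * P"
  proof -
    have "(\<Prod>z\<in>I. fps_const ((-z) ^ o' z)) = fps_const (\<Prod>z\<in>I. (-z) ^ o' z)" for I :: "complex set"
      by (induction I rule: infinite_finite_induct) simp_all
    thus ?thesis by (simp add: prod.distrib P_def)
  qed
  finally have HP: "fps_of_poly Hc = fps_const l * P" by (simp add: l_def mult.assoc[symmetric])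
  have "fps_nth P 0 = 1" by (simp add: P_def fps_nth_prod_0 fps_power_zeroth)
  moreover have "fps_nth (fps_of_poly Hc) 0 = 1" using Hc0 by simp
  ultimately have "l = 1" unfolding HP by simp
  hence HP: "int_fps H = P" using HP by (intro fps_ext) (metis Hc_def coeff_map_poly fps_const_1_eq_1 fps_of_poly_nth int_fps_nth mult.left_neutral of_int_0)
  define D where "D = real (\<Sum>z\<in>R. o' z)"
  have bd: "norm (fps_nth (fps_X_log_deriv (int_fps H)) n) \<le> D" if "n \<ge> 1" for n
  proof -
    have "fps_X_log_deriv (int_fps H) = (\<Sum>z\<in>R. fps_X_log_deriv ((1 - fps_const (1 / z) * fps_X) ^ o' z))"
      unfolding HP P_def by (rule fps_X_log_deriv_prod) (auto simp: fps_power_zeroth)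
    also have "\<dots> = (\<Sum>z\<in>R. of_nat (o' z) * fps_X_log_deriv (1 - fps_const (1 / z) * fps_X))"
      by (rule sum.cong[OF refl]) (auto intro!: fps_X_log_deriv_power)
    also have "fps_nth \<dots> n = (\<Sum>z\<in>R. of_nat (o' z) * fps_nth (fps_X_log_deriv (1 - fps_const (1 / z) * fps_X)) n)"
      by (simp add: fps_sum_nth flip: fps_of_nat)
    also have "norm \<dots> \<le> (\<Sum>z\<in>R. real (o' z))"
      by (rule sum_norm_le) (use that in \<open>simp add: fps_X_log_deriv_nth_linear norm_mult norm_power norm_divide nR\<close>)
    finally show ?thesis by (simp add: D_def)
  qed
  obtain \<gamma> :: "nat \<Rightarrow> int" where \<gamma>: "\<And>N. N \<ge> 1 \<Longrightarrow> monom 1 N dvd H * wprod (\<lambda>k. nat (- \<gamma> k)) N - wprod (\<lambda>k. nat (\<gamma> k)) N"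
    using witt_exponents[OF H0] by blast
  define g where "g = (\<lambda>k. real_of_int (\<gamma> k) * real k)"
  have sum: "\<bar>\<Sum>k | k dvd n. g k\<bar> \<le> D" if n: "n \<ge> 1" for n
  proof -
    define N where "N = Suc n"
    define A where "A = wprod (\<lambda>k. nat (- \<gamma> k)) N"
    define B where "B = wprod (\<lambda>k. nat (\<gamma> k)) N"
    have eq: "coeff (H * A) i = coeff B i" if "i < N" for i
      using \<gamma>[of N] that by (simp add: monom_1_dvd_iff' N_def A_def B_def)
    have A0: "coeff A 0 = 1" "coeff B 0 = 1" by (auto simp: A_def B_def coeff_0_wprod)
    have "fps_nth (fps_X_log_deriv (int_fps (H * A))) n = fps_nth (fps_X_log_deriv (int_fps B)) n"
      by (rule fps_X_log_deriv_nth_cong[of _ _ N]) (use eq A0 H0 in \<open>auto simp: N_def coeff_mult_0\<close>)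
    also have "fps_X_log_deriv (int_fps (H * A)) = fps_X_log_deriv (int_fps H) + fps_X_log_deriv (int_fps A)"
      unfolding int_fps_mult by (rule fps_X_log_deriv_mult) (use H0 A0 in auto)
    finally have "fps_nth (fps_X_log_deriv (int_fps H)) n = fps_nth (fps_X_log_deriv (int_fps B)) n - fps_nth (fps_X_log_deriv (int_fps A)) n"
      by (simp add: algebra_simps)
    also have "\<dots> = - (\<Sum>k\<in>{k\<in>{1..<N}. k dvd n}. of_nat (nat (\<gamma> k) * k)) + (\<Sum>k\<in>{k\<in>{1..<N}. k dvd n}. of_nat (nat (- \<gamma> k) * k))"
      unfolding A_def B_def fps_X_log_deriv_int_fps_wprod[OF n] by simp
    also have "\<dots> = - (\<Sum>k\<in>{k\<in>{1..<N}. k dvd n}. of_nat (nat (\<gamma> k) * k) - of_nat (nat (- \<gamma> k) * k))"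
      by (simp add: sum_subtractf)
    also have "(\<Sum>k\<in>{k\<in>{1..<N}. k dvd n}. of_nat (nat (\<gamma> k) * k) - of_nat (nat (- \<gamma> k) * k)) =
        (\<Sum>k\<in>{k\<in>{1..<N}. k dvd n}. complex_of_real (g k))"
    proof (rule sum.cong[OF refl])
      fix k
      have "of_nat (nat (\<gamma> k)) - of_nat (nat (- \<gamma> k)) = (of_int (\<gamma> k) :: complex)"
        by (cases "\<gamma> k \<ge> 0") auto
      thus "of_nat (nat (\<gamma> k) * k) - of_nat (nat (- \<gamma> k) * k) = complex_of_real (g k)"
        by (simp add: g_def flip: left_diff_distrib)
    qed
    also have "{k\<in>{1..<N}. k dvd n} = {k. k dvd n}" using n by (auto simp: N_def less_Suc_eq_le dvd_imp_le intro: Suc_leI dvd_pos_nat)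
    finally have "fps_nth (fps_X_log_deriv (int_fps H)) n = - complex_of_real (\<Sum>k | k dvd n. g k)" by simp
    thus ?thesis using bd[OF n] by (metis norm_minus_cancel norm_of_real)
  qed
  \<comment> \<open>A nonzero \<gamma>(n) gives n \<le> 4 sqrt n D, that is n \<le> 16 D^2.\<close>
  define K where "K = nat \<lceil>16 * D\<^sup>2\<rceil> + 2"
  have \<gamma>0: "\<gamma> n = 0" if n: "n \<ge> K" for n
  proof (rule ccontr)
    assume "\<gamma> n \<noteq> 0"
    hence "1 \<le> \<bar>real_of_int (\<gamma> n)\<bar>" by linarith
    hence "real n \<le> \<bar>g n\<bar>" by (simp add: g_def abs_mult mult_le_cancel_right1)
    also have "\<dots> \<le> 4 * sqrt (real n) * D"
      by (rule divisor_sum_inverse_bound[OF sum]) (use n in \<open>auto simp: K_def\<close>)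
    finally have "(real n)\<^sup>2 \<le> (4 * sqrt (real n) * D)\<^sup>2" by (intro power_mono) auto
    hence "real n * real n \<le> real n * (16 * D\<^sup>2)" by (simp add: power_mult_distrib power2_eq_square[of "real n"] mult_ac)
    moreover have "real n > 0" using n by (simp add: K_def)
    ultimately have "real n \<le> 16 * D\<^sup>2" by simp
    moreover have "real n > 16 * D\<^sup>2" using n unfolding K_def by linarith
    ultimately show False by simp
  qed
  define E where "E = H * wprod (\<lambda>k. nat (- \<gamma> k)) K - wprod (\<lambda>k. nat (\<gamma> k)) K"
  have stab: "wprod e N = wprod e K" if "N \<ge> K" "\<And>k. k \<ge> K \<Longrightarrow> e k = 0" for e :: "nat \<Rightarrow> nat" and N
    unfolding wprod_def by (rule prod.mono_neutral_right) (use that in auto)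
  have "monom 1 N dvd E" if "N \<ge> K" for N
    using \<gamma>[of N] that \<gamma>0 stab[OF that, of "\<lambda>k. nat (- \<gamma> k)"] stab[OF that, of "\<lambda>k. nat (\<gamma> k)"]
    by (simp add: E_def K_def)
  hence "coeff E i = 0" for i unfolding monom_1_dvd_iff' by (metis max.cobounded1 max.cobounded2 Suc_le_lessD)
  hence "E = 0" by (intro poly_eqI) simp
  thus ?thesis unfolding E_def by (intro exI[of _ K] exI[of _ \<gamma>]) simp
qed

text \<open>The target is any commutative ring, so that a polynomial identity can be read both at
  complex numbers and at the monomial X^w in \<open>int_mpoly\<close>.\<close>

definition int_eval :: "int poly \<Rightarrow> 'a::comm_ring_1 \<Rightarrow> 'a" where
  "int_eval p x = poly (map_poly of_int p) x"

lemma int_eval_0 [simp]: "int_eval 0 x = 0" by (simp add: int_eval_def)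

lemma int_eval_pCons [simp]: "int_eval (pCons c p) x = of_int c + x * int_eval p x"
  by (simp add: int_eval_def map_poly_pCons)

lemma int_eval_1 [simp]: "int_eval 1 x = 1"
  by (simp add: one_pCons)

lemma int_eval_add: "int_eval (p + q) x = int_eval p x + int_eval q x"
  by (induction p q rule: poly_induct2) (simp_all add: algebra_simps)

lemma int_eval_smult: "int_eval (smult c p) x = of_int c * int_eval p x"
  by (induction p) (simp_all add: algebra_simps)

lemma int_eval_diff: "int_eval (p - q) x = int_eval p x - int_eval q x"
  using int_eval_add[of "p - q" q x] by simp

lemma int_eval_mult: "int_eval (p * q) x = int_eval p x * int_eval q x"
  by (induction p) (simp_all add: int_eval_add int_eval_smult algebra_simps)

lemma int_eval_power: "int_eval (p ^ n) x = int_eval p x ^ n"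
  by (induction n) (simp_all add: int_eval_mult)

lemma int_eval_prod: "int_eval (\<Prod>i\<in>I. f i) x = (\<Prod>i\<in>I. int_eval (f i) x)"
  by (induction I rule: infinite_finite_induct) (simp_all add: int_eval_mult)

lemma int_eval_sum: "int_eval (\<Sum>i\<in>I. f i) x = (\<Sum>i\<in>I. int_eval (f i) x)"
  by (induction I rule: infinite_finite_induct) (simp_all add: int_eval_add)

lemma int_eval_monom: "int_eval (monom c n) x = of_int c * x ^ n"
  by (induction n) (simp_all add: monom_0 monom_Suc algebra_simps)

text \<open>The leading coefficient is a unit, so division with remainder works over the integers.\<close>

lemma unit_roots_dvd:
  fixes H P :: "int poly"
  assumes H0: "coeff H 0 = 1"
    and roots: "\<And>z::complex. poly (map_poly of_int H) z = 0 \<Longrightarrow> norm z = 1"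
    and simple: "\<And>z::complex. order z (map_poly of_int H) \<le> 1"
    and P: "\<And>z::complex. poly (map_poly of_int H) z = 0 \<Longrightarrow> poly (map_poly of_int P) z = 0"
  shows "H dvd P"
proof -
  define Hc where "Hc = (map_poly of_int H :: complex poly)"
  have Hc0: "coeff Hc 0 = 1" using H0 by (simp add: Hc_def coeff_map_poly)
  hence Hcn: "Hc \<noteq> 0" by auto
  have Hn: "H \<noteq> 0" using H0 by auto
  define R where "R = {z. poly Hc z = 0}"
  have finR: "finite R" unfolding R_def using Hcn by (rule poly_roots_finite)
  have nR: "norm z = 1" if "z \<in> R" for z using roots that by (simp add: R_def Hc_def)
  have ord: "order z Hc = 1" if "z \<in> R" for z
    using simple[of z] that Hcn order_root[of Hc z] by (simp add: R_def Hc_def)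
  have dec: "smult (lead_coeff Hc) (\<Prod>z\<in>R. [:-z, 1:] ^ order z Hc) = Hc"
    unfolding R_def by (rule complex_poly_decompose)
  also have "(\<Prod>z\<in>R. [:-z, 1:] ^ order z Hc) = (\<Prod>z\<in>R. [:-z, 1:])"
    by (rule prod.cong[OF refl]) (simp add: ord)
  finally have dec: "smult (lead_coeff Hc) (\<Prod>z\<in>R. [:-z, 1:]) = Hc" .
  have deg: "degree Hc = degree H" by (simp add: Hc_def degree_map_poly)
  have "degree (\<Prod>z\<in>R. [:-z, 1:]) = card R" by (simp add: degree_prod_sum_eq)
  hence cR: "card R = degree H" using dec deg Hcn by (metis degree_smult_eq leading_coeff_0_iff)
  \<comment> \<open>The leading coefficient times the product of the negated roots is the constant
    coefficient 1. Unimodular roots therefore make the leading coefficient a unit.\<close>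
  have "poly Hc 0 = 1" using Hc0 by (simp add: poly_0_coeff_0)
  hence "lead_coeff Hc * (\<Prod>z\<in>R. - z) = 1" using dec by (metis (no_types, lifting) add_0 mult_zero_left add.right_neutral poly_pCons poly_prod poly_smult prod.cong mult_zero_right poly_0)
  hence "norm (lead_coeff Hc) * (\<Prod>z\<in>R. norm z) = 1"
    by (metis (no_types, lifting) norm_minus_cancel norm_mult norm_one prod.cong prod_norm)
  hence "norm (lead_coeff Hc) = 1" using nR by simp
  moreover have "lead_coeff Hc = of_int (lead_coeff H)" unfolding deg by (simp add: Hc_def coeff_map_poly)
  ultimately have "real_of_int \<bar>lead_coeff H\<bar> = 1" by simp
  hence lc: "\<bar>lead_coeff H\<bar> = 1" by linarith
  obtain q r where qr: "pseudo_divmod P H = (q, r)" by fastforce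
  define k where "k = Suc (degree P) - degree H"
  have eq: "smult (lead_coeff H ^ k) P = H * q + r" and r: "r = 0 \<or> degree r < degree H"
    using pseudo_divmod[OF Hn qr] by (auto simp: k_def)
  \<comment> \<open>The remainder vanishes at all roots of \<open>H\<close>; as they are simple,
    their number is the degree of \<open>H\<close>.\<close>
  have r0: "r = 0"
  proof (rule ccontr)
    assume "r \<noteq> 0"
    define rc where "rc = (map_poly of_int r :: complex poly)"
    have "rc \<noteq> 0" using \<open>r \<noteq> 0\<close> by (simp add: rc_def map_poly_eq_0_iff)
    have "R \<subseteq> {z. poly rc z = 0}"
    proof
      fix z assume "z \<in> R"
      hence z: "int_eval H z = 0" "int_eval P z = 0" using P by (auto simp: R_def Hc_def int_eval_def)
      have "int_eval (smult (lead_coeff H ^ k) P) z = int_eval (H * q + r) z" by (simp only: eq)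
      hence "int_eval r z = 0" using z by (simp add: int_eval_smult int_eval_add int_eval_mult)
      thus "z \<in> {z. poly rc z = 0}" by (simp add: rc_def int_eval_def)
    qed
    hence "card R \<le> degree rc"
      using card_mono[OF poly_roots_finite[OF \<open>rc \<noteq> 0\<close>]] card_poly_roots_bound[OF \<open>rc \<noteq> 0\<close>] by (meson order_trans)
    also have "\<dots> = degree r" by (simp add: rc_def degree_map_poly)
    finally show False using r \<open>r \<noteq> 0\<close> cR by simp
  qed
  have "lead_coeff H ^ k * lead_coeff H ^ k = 1"
    using lc by (metis abs_mult_self_eq mult.left_neutral power_mult_distrib power_one)
  hence "P = smult (lead_coeff H ^ k) (smult (lead_coeff H ^ k) P)" by simp
  also have "\<dots> = H * smult (lead_coeff H ^ k) q" unfolding eq r0 by simp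
  finally show ?thesis by (rule dvdI)
qed

section \<open>Counting zeros of the zeta factors\<close>

lemma holomorphic_factor_zeros:
  fixes f :: "complex \<Rightarrow> complex"
  assumes "finite A" "open S" "f holomorphic_on S" "A \<subseteq> S" "\<And>a. a \<in> A \<Longrightarrow> f a = 0"
  shows "\<exists>g. g holomorphic_on S \<and> (\<forall>z\<in>S. f z = g z * (\<Prod>a\<in>A. z - a))"
  using assms(1,4,5)
proof (induction A rule: finite_induct)
  case empty
  thus ?case using assms by auto
next
  case (insert b A)
  then obtain g where g: "g holomorphic_on S" "\<And>z. z \<in> S \<Longrightarrow> f z = g z * (\<Prod>a\<in>A. z - a)" by auto
  have bS: "b \<in> S" using insert by auto
  have "(\<Prod>a\<in>A. b - a) \<noteq> 0" using insert by auto
  hence gb: "g b = 0" using g(2)[OF bS] insert by auto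
  define g2 where "g2 = (\<lambda>z. if z = b then deriv g b else (g z - g b) / (z - b))"
  have "g2 holomorphic_on S"
    unfolding g2_def by (rule pole_theorem_open_0[OF g(1) assms(2)]) (use gb in auto)
  moreover have "f z = g2 z * (\<Prod>a\<in>insert b A. z - a)" if "z \<in> S" for z
  proof -
    have "g z = g2 z * (z - b)" using gb by (auto simp: g2_def)
    thus ?thesis using g(2)[OF that] insert by (simp add: mult.assoc)
  qed
  ultimately show ?case by blast
qed

text \<open>Jensen's inequality. Each zero factor z - a is replaced by (R^2 - cnj (a - c) (z - c)) /
  R, which has the same modulus on the circle of radius R and modulus R at the centre. The maximum
  principle then gives |g(c)| R^n \<le> M, while the lower bound at the centre gives 1 \<le> |g(c)|
  r^n.\<close>

lemma card_zeros_le: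
  fixes f :: "complex \<Rightarrow> complex"
  assumes A: "finite A" "A \<subseteq> cball c r" "\<And>a. a \<in> A \<Longrightarrow> f a = 0"
    and S: "open S" "f holomorphic_on S" "cball c R \<subseteq> S" and r: "0 < r" "r < R"
    and M: "\<And>z. norm (z - c) = R \<Longrightarrow> norm (f z) \<le> M" and fc: "norm (f c) \<ge> 1"
  shows "(R / r) ^ card A \<le> M"
proof -
  have "A \<subseteq> S" using A(2) S(3) subset_cball[of r R c] r by auto
  from holomorphic_factor_zeros[OF A(1) S(1,2) this A(3)] obtain g where
    g: "g holomorphic_on S" "\<And>z. z \<in> S \<Longrightarrow> f z = g z * (\<Prod>a\<in>A. z - a)" by blast
  define k where "k = (\<lambda>z. g z * (\<Prod>a\<in>A. (of_real (R\<^sup>2) - cnj (a - c) * (z - c)) / of_real R))"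
  have holk: "k holomorphic_on S" unfolding k_def using r by (intro holomorphic_intros g) auto
  have bd: "norm (k z) \<le> M" if z: "norm (z - c) = R" for z
  proof -
    have zS: "z \<in> S" using S(3) z by (auto simp: dist_norm norm_minus_commute)
    have "norm ((of_real (R\<^sup>2) - cnj (a - c) * (z - c)) / of_real R) = norm (z - a)" for a
    proof -
      have "of_real (R\<^sup>2) = (z - c) * cnj (z - c)" using z complex_norm_square[of "z - c"] by simp
      hence "of_real (R\<^sup>2) - cnj (a - c) * (z - c) = (z - c) * cnj (z - a)" by (simp add: algebra_simps)
      hence "norm (of_real (R\<^sup>2) - cnj (a - c) * (z - c)) = R * norm (z - a)"
        using z by (simp only: norm_mult complex_mod_cnj)
      thus ?thesis using r by (simp add: norm_divide)
    qed
    hence "norm (k z) = norm (f z)" unfolding g(2)[OF zS] k_def by (simp add: norm_mult prod_norm[symmetric])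
    thus ?thesis using M[OF z] by simp
  qed
  have kc: "norm (k c) \<le> M"
  proof (rule maximum_modulus_frontier[of k "cball c R"])
    show "k holomorphic_on interior (cball c R)"
      by (rule holomorphic_on_subset[OF holk]) (use S(3) interior_subset in blast)
    show "continuous_on (closure (cball c R)) k"
      using holomorphic_on_imp_continuous_on[OF holomorphic_on_subset[OF holk S(3)]] by simp
    show "norm (k z) \<le> M" if "z \<in> frontier (cball c R)" for z
      using that r by (intro bd) (auto simp: dist_norm norm_minus_commute)
  qed (use r in auto)
  have "norm (k c) = norm (g c) * R ^ card A"
    using r by (simp add: k_def norm_mult prod_norm[symmetric] power2_eq_square norm_divide norm_power)
  hence 1: "norm (g c) * R ^ card A \<le> M" using kc by simp
  have "c \<in> S" using S(3) r by auto
  have "1 \<le> norm (g c) * (\<Prod>a\<in>A. norm (c - a))"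
    using fc unfolding g(2)[OF \<open>c \<in> S\<close>] by (simp add: norm_mult prod_norm)
  also have "(\<Prod>a\<in>A. norm (c - a)) \<le> (\<Prod>a\<in>A. r)"
    by (rule prod_mono) (use A(2) in \<open>auto simp: dist_norm\<close>)
  hence "norm (g c) * (\<Prod>a\<in>A. norm (c - a)) \<le> norm (g c) * r ^ card A" by (intro mult_left_mono) auto
  finally have 2: "1 \<le> norm (g c) * r ^ card A" .
  have "(R / r) ^ card A \<le> (R / r) ^ card A * (norm (g c) * r ^ card A)"
    using mult_left_mono[OF 2, of "(R / r) ^ card A"] r by simp
  also have "\<dots> = norm (g c) * R ^ card A" using r by (simp add: power_divide)
  finally show ?thesis using 1 by simp
qed

text \<open>Too few primes would make the Euler product bounded near its pole at \<open>1\<close>.\<close>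

lemma primes_not_polylog:
  shows "\<exists>N\<ge>N0. real (card {p. prime p \<and> p \<le> N}) > C * (ln (real N)) ^ 10"
proof (rule ccontr)
  assume "\<not> ?thesis"
  hence few: "real (card {p. prime p \<and> p \<le> N}) \<le> C * (ln (real N)) ^ 10" if "N \<ge> N0" for N
    using that by (auto simp: not_less)
  define P where "P = {p::nat. prime p}"
  have infP: "infinite P" unfolding P_def by (rule primes_infinite)
  define q where "q = enumerate P"
  have qP: "prime (q n)" for n using enumerate_in_set[OF infP] by (auto simp: q_def P_def)
  have qge: "q n \<ge> n" for n unfolding q_def using infP by (rule le_enumerate)
  have "eventually (\<lambda>x::real. C * (ln x) ^ 10 < sqrt x) at_top"
  proof -
    have "((\<lambda>x::real. (ln x) ^ 10 / x powr (1/2)) \<longlongrightarrow> 0) at_top"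
      by real_asymp
    hence "((\<lambda>x::real. C * ((ln x) ^ 10 / x powr (1/2))) \<longlongrightarrow> C * 0) at_top" by (intro tendsto_intros)
    hence "eventually (\<lambda>x::real. C * ((ln x) ^ 10 / x powr (1/2)) < 1) at_top"
      by (intro order_tendstoD(2)) auto
    thus ?thesis using eventually_gt_at_top[of "0::real"]
      by eventually_elim (simp add: powr_half_sqrt field_simps)
  qed
  then obtain X where X: "\<And>x. x \<ge> X \<Longrightarrow> C * (ln x) ^ 10 < sqrt x" unfolding eventually_at_top_linorder by blast
  define n0 where "n0 = max N0 (nat \<lceil>X\<rceil>)"
  \<comment> \<open>There are n + 1 primes up to \<open>q n\<close>, and the assumed bound makes
    this number at most the square root of \<open>q n\<close>. Hence the reciprocals of the primes
    are summable.\<close>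
  have big: "real (Suc n) ^ 2 \<le> real (q n)" if "n \<ge> n0" for n
  proof -
    have "real (q n) \<ge> X" "q n \<ge> N0" using that qge[of n] unfolding n0_def by linarith+
    have "Suc n = card (q ` {..n})"
      using strict_mono_enumerate[OF infP] by (subst card_image) (auto simp: q_def strict_mono_on_imp_inj_on strict_mono_imp_inj_on inj_on_subset)
    also have "\<dots> \<le> card {p. prime p \<and> p \<le> q n}"
    proof (rule card_mono)
      show "finite {p. prime p \<and> p \<le> q n}" by (rule finite_subset[of _ "{..q n}"]) auto
      show "q ` {..n} \<subseteq> {p. prime p \<and> p \<le> q n}"
        using qP strict_mono_enumerate[OF infP] by (auto simp: q_def strict_mono_less_eq)
    qed
    finally have "real (Suc n) \<le> real (card {p. prime p \<and> p \<le> q n})" by simp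
    also have "\<dots> \<le> C * (ln (real (q n))) ^ 10" by (rule few) fact
    also have "\<dots> \<le> sqrt (real (q n))" using X[OF \<open>real (q n) \<ge> X\<close>] by simp
    finally have "real (Suc n) ^ 2 \<le> sqrt (real (q n)) ^ 2" by (intro power_mono) auto
    thus ?thesis by simp
  qed
  have sm: "summable (\<lambda>n. 1 / real (q n))"
  proof (rule summable_comparison_test'[of "\<lambda>n. 1 / real (Suc n) ^ 2" n0])
    show "summable (\<lambda>n. 1 / real (Suc n) ^ 2)"
      using inverse_squares_sums by (simp add: sums_iff add.commute)
    show "norm (1 / real (q n)) \<le> 1 / real (Suc n) ^ 2" if "n \<ge> n0" for n
      using big[OF that] by (simp add: frac_le)
  qed
  define T where "T = suminf (\<lambda>n. 1 / real (q n))"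
  have T: "(\<Sum>p\<in>B. 1 / real p) \<le> T" if "finite B" "B \<subseteq> P" for B
  proof -
    have "P = range q" unfolding q_def using infP by (simp add: range_enumerate)
    hence "\<exists>I. finite I \<and> B = q ` I" using that finite_subset_image by (metis subset_UNIV)
    then obtain I where I: "finite I" "B = q ` I" by blast
    have "inj q" unfolding q_def using strict_mono_enumerate[OF infP] strict_mono_imp_inj_on by blast
    hence "(\<Sum>p\<in>B. 1 / real p) = (\<Sum>i\<in>I. 1 / real (q i))"
      unfolding I by (subst sum.reindex) (auto intro: inj_on_subset)
    also have "\<dots> \<le> T" unfolding T_def by (rule sum_le_suminf[OF sm I(1)]) auto
    finally show ?thesis .
  qed
  \<comment> \<open>Each factor 1 - p^(-\<sigma>) is at least exp (-2/p), so the Dirichlet series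
    stays below exp (2 T). The factor \<sigma> - 1 then sends \<open>zeta_reg\<close> to 0 at 1,
    where its value is 1.\<close>
  have bound: "norm (zeta_reg (of_real \<sigma>)) \<le> (\<sigma> - 1) * exp (2 * T)" if "\<sigma> > 1" for \<sigma>
  proof -
    let ?f = "\<lambda>p. if prime p then 1 - of_nat p powr (- of_real \<sigma>) else 1 :: complex"
    have cp: "convergent_prod ?f" and eq: "prodinf ?f * (\<Sum>\<^sub>\<infinity>n. of_nat n powr (- of_real \<sigma>)) = 1"
      using zeta_euler_product[of "of_real \<sigma>"] that by auto
    have "(\<lambda>n. norm (\<Prod>i\<le>n. ?f i)) \<longlonglongrightarrow> norm (prodinf ?f)"
      by (intro tendsto_norm convergent_prod_LIMSEQ cp)
    moreover have "norm (\<Prod>i\<le>n. ?f i) \<ge> exp (- 2 * T)" for n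
    proof -
      define B where "B = {p\<in>{..n}. prime p}"
      have "(\<Prod>i\<le>n. ?f i) = (\<Prod>p\<in>B. 1 - of_nat p powr (- of_real \<sigma>))"
        unfolding B_def by (subst prod.inter_filter) auto
      hence "norm (\<Prod>i\<le>n. ?f i) = (\<Prod>p\<in>B. norm (1 - of_nat p powr (- of_real \<sigma>) :: complex))"
        by (simp add: prod_norm)
      also have "\<dots> \<ge> (\<Prod>p\<in>B. exp (- 2 * (1 / real p)))"
      proof (rule prod_mono, intro conjI)
        fix p assume "p \<in> B"
        hence p: "prime p" by (simp add: B_def)
        have p2: "real p \<ge> 2" using prime_ge_2_nat[OF p] by simp
        have "norm (of_nat p powr (- of_real \<sigma>) :: complex) = real p powr (- \<sigma>)"
          using p2 by (simp add: norm_powr_real_powr)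
        also have "\<dots> \<le> real p powr (- 1)" using that p2 by (intro powr_mono) auto
        finally have "norm (of_nat p powr (- of_real \<sigma>) :: complex) \<le> 1 / real p"
          using p2 by (simp add: powr_minus_divide)
        hence "norm (1 - of_nat p powr (- of_real \<sigma>) :: complex) \<ge> 1 - 1 / real p"
          using norm_triangle_ineq2[of 1 "of_nat p powr (- of_real \<sigma>) :: complex"] by simp
        moreover have "exp (- 2 * (1 / real p)) \<le> 1 - 1 / real p"
        proof -
          define y where "y = 1 / real p"
          have y: "0 \<le> y" "y \<le> 1/2" using p2 by (auto simp: y_def field_simps)
          have "1 \<le> (1 - y) * (1 + 2 * y)" using y mult_right_mono[of y "1/2" "y"] by (simp add: algebra_simps)
          also have "\<dots> \<le> (1 - y) * exp (2 * y)" using y exp_ge_add_one_self[of "2 * y"] by (intro mult_left_mono) auto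
          finally have "exp (- 2 * y) \<le> 1 - y" by (simp add: exp_minus field_simps)
          thus ?thesis by (simp add: y_def)
        qed
        ultimately show "exp (- 2 * (1 / real p)) \<le> norm (1 - of_nat p powr (- of_real \<sigma>) :: complex)" by simp
      qed auto
      finally have "norm (\<Prod>i\<le>n. ?f i) \<ge> (\<Prod>p\<in>B. exp (- 2 * (1 / real p)))" .
      moreover have "(\<Prod>p\<in>B. exp (- 2 * (1 / real p))) = exp (- 2 * (\<Sum>p\<in>B. 1 / real p))"
        by (simp add: B_def exp_sum[symmetric] sum_distrib_left)
      moreover have "exp (- 2 * T) \<le> exp (- 2 * (\<Sum>p\<in>B. 1 / real p))"
        using T[of B] by (auto simp: B_def P_def)
      ultimately show ?thesis by linarith
    qed
    ultimately have ge: "norm (prodinf ?f) \<ge> exp (- 2 * T)"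
      by (intro LIMSEQ_le_const[of _ _ "exp (- 2 * T)"]) auto
    have "norm (prodinf ?f) * norm (\<Sum>\<^sub>\<infinity>n. of_nat n powr (- of_real \<sigma>) :: complex) = 1"
      using eq by (metis norm_mult norm_one)
    moreover have "exp (- 2 * T) * norm (\<Sum>\<^sub>\<infinity>n. of_nat n powr (- of_real \<sigma>) :: complex) \<le>
        norm (prodinf ?f) * norm (\<Sum>\<^sub>\<infinity>n. of_nat n powr (- of_real \<sigma>) :: complex)"
      by (intro mult_right_mono ge) auto
    ultimately have "norm (\<Sum>\<^sub>\<infinity>n. of_nat n powr (- of_real \<sigma>) :: complex) \<le> exp (2 * T)"
      by (simp add: exp_minus field_simps)
    hence "(\<sigma> - 1) * norm (\<Sum>\<^sub>\<infinity>n. of_nat n powr (- of_real \<sigma>) :: complex) \<le> (\<sigma> - 1) * exp (2 * T)"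
      using that by (intro mult_left_mono) auto
    moreover have "norm (zeta_reg (of_real \<sigma>)) = (\<sigma> - 1) * norm (\<Sum>\<^sub>\<infinity>n. of_nat n powr (- of_real \<sigma>) :: complex)"
    proof -
      have "norm (of_real \<sigma> - 1 :: complex) = \<sigma> - 1" using that norm_of_real[of "\<sigma> - 1", where 'a = complex] by simp
      thus ?thesis using zeta_reg_eq[of "of_real \<sigma>"] that by (simp add: norm_mult)
    qed
    ultimately show ?thesis by simp
  qed
  have "isCont zeta_reg 1"
    using holomorphic_on_imp_continuous_on[OF holomorphic_zeta_reg] open_halfspace_Re_gt[of 0]
    by (simp add: continuous_on_eq_continuous_at)
  hence "isCont (\<lambda>\<sigma>. norm (zeta_reg (of_real \<sigma>))) 1"
    by (intro isCont_norm isCont_o2[of 1 of_real zeta_reg]) auto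
  hence "((\<lambda>\<sigma>. norm (zeta_reg (of_real \<sigma>))) \<longlongrightarrow> norm (zeta_reg 1)) (at_right 1)"
    by (simp add: isCont_def filterlim_at_split)
  moreover have "((\<lambda>\<sigma>. (\<sigma> - 1) * exp (2 * T)) \<longlongrightarrow> (1 - 1) * exp (2 * T)) (at_right 1)"
    by (intro tendsto_intros)
  moreover have "eventually (\<lambda>\<sigma>. norm (zeta_reg (of_real \<sigma>)) \<le> (\<sigma> - 1) * exp (2 * T)) (at_right 1)"
    using eventually_at_right_less[of 1] by eventually_elim (rule bound)
  ultimately have "norm (zeta_reg 1) \<le> (1 - 1) * exp (2 * T)"
    by (intro tendsto_le[of "at_right (1::real)"]) auto
  thus False by (simp add: zeta_reg_1)
qed

text \<open>The points \<open>w\<^sub>p = (u\<^sub>0 + 2\<pi>i m\<^sub>p) / log p\<close> with \<open>p \<le> N\<close> are distinct and lie in a disc on which the product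
  of the first \<open>O(log N)\<close> zeta factors has only polynomially many zeros in \<open>log N\<close>.\<close>

lemma zeta_factors_miss_zeros:
  fixes m :: "nat \<Rightarrow> int" and u0 :: complex
  defines "w \<equiv> (\<lambda>p::nat. (u0 + 2 * pi * \<i> * of_int (m p)) / of_real (ln (real p)))"
  assumes c: "Re u0 > 0"
    and Im: "\<And>p. prime p \<Longrightarrow> p \<ge> P0 \<Longrightarrow> \<bar>Im (w p)\<bar> \<le> Y"
  shows "\<exists>p\<ge>P0. prime p \<and> (\<forall>k::nat. k \<ge> 1 \<longrightarrow> of_nat k * w p \<noteq> 1 \<and> zeta_reg (of_nat k * w p) \<noteq> 0)"
proof (rule ccontr)
  assume "\<not> ?thesis"
  hence zero: "\<exists>k::nat\<ge>1. of_nat k * w p = 1 \<or> zeta_reg (of_nat k * w p) = 0" if "prime p" "p \<ge> P0" for p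
    using that by blast
  define c where "c = Re u0"
  have c: "c > 0" using c by (simp add: c_def)
  define Y' where "Y' = max Y 0"
  have Y': "Y' \<ge> 0" "\<And>p. prime p \<Longrightarrow> p \<ge> P0 \<Longrightarrow> \<bar>Im (w p)\<bar> \<le> Y'"
    using order.trans[OF Im max.cobounded1] by (auto simp: Y'_def)
  have Rew: "Re (w p) = c / ln (real p)" if "prime p" for p
    by (simp add: w_def c_def Re_divide_of_real)
  define c2 where "c2 = c / ln 2"
  have c2: "c2 > 0" using c by (simp add: c2_def)
  \<comment> \<open>\<open>A\<close> and \<open>B\<close> are the constants in X \<le> A L and K
    \<le> B L for L = ln N. \<open>c2\<close> is the real part at p = 2, the largest one that
    occurs.\<close>
  define A where "A = 4 * Y'\<^sup>2 / c + 2 + c2"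
  define B where "B = 1 / c + 1"
  have A: "A \<ge> 2" using c c2 Y' by (simp add: A_def)
  have B: "B \<ge> 1" using c by (simp add: B_def)
  define N1 where "N1 = max P0 (nat \<lceil>exp (max 1 c)\<rceil>)"
  \<comment> \<open>The power 10 of the logarithm consists of X^4, K^4 and 1/e^2.\<close>
  have main: "real (card {p. prime p \<and> P0 \<le> p \<and> p \<le> N}) \<le> 228 * A ^ 4 * B ^ 4 / c\<^sup>2 * ln (real N) ^ 10"
    if N: "N \<ge> N1" for N
  proof -
    define L where "L = ln (real N)"
    have "real N \<ge> exp (max 1 c)" using N unfolding N1_def by linarith
    moreover from this have "real N > 0" by (rule less_le_trans[OF exp_gt_zero])
    ultimately have L: "L \<ge> max 1 c" unfolding L_def by (simp only: ln_ge_iff)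
    hence L1: "L \<ge> 1" "L \<ge> c" "L > 0" by auto
    \<comment> \<open>A lower bound for the real parts of the points \<open>w p\<close> with p \<le>
      N.\<close>
    define e where "e = c / L"
    have e: "e > 0" "e \<le> 1" using c L1 by (auto simp: e_def)
    \<comment> \<open>For k > 1/e the point k \<open>w p\<close> has real part above 1, where it is
      neither 1 nor a zero of the zeta factor. So only the first \<open>K\<close> factors
      matter.\<close>
    define K where "K = nat \<lceil>L / c\<rceil>"
    have "L / c > 0" using L1 c by simp
    hence K1: "K \<ge> 1" unfolding K_def by linarith
    have "real K \<le> L / c + 1" unfolding K_def using \<open>L / c > 0\<close> by linarith
    also have "\<dots> \<le> B * L" using L1 by (simp add: B_def algebra_simps)
    finally have KB: "real K \<le> B * L" .
    \<comment> \<open>A far centre makes the disc flat near the imaginary axis: by the term 4 Y'^2 /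
      e, a disc of radius X - 3 e / 4 still contains every point of real part between e and
      \<open>c2\<close> at height up to Y'. The radius X - e / 2 keeps the larger disc in Re z \<ge>
      e / 2, and X \<ge> 2 serves the lower bound at the centre.\<close>
    define X where "X = 4 * Y'\<^sup>2 / e + 2 + c2"
    have X: "X \<ge> 2" "X \<ge> c2" using e Y' c2 by (auto simp: X_def)
    have "X = (4 * Y'\<^sup>2 / c) * L + 2 + c2" by (simp add: X_def e_def)
    also have "\<dots> \<le> A * L" using mult_left_mono[OF L1(1), of "2 + c2"] c2 by (simp add: A_def algebra_simps)
    finally have XA: "X \<le> A * L" .
    define R where "R = X - e / 2"
    define r where "r = X - 3 * e / 4"
    have rR: "0 < r" "r < R" "R \<le> X" using X e by (auto simp: r_def R_def)
    define f where "f = (\<lambda>z. \<Prod>k=1..K. (of_nat k * z - 1) * zeta_reg (of_nat k * z))"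
    define Pr where "Pr = {p. prime p \<and> P0 \<le> p \<and> p \<le> N}"
    have finPr: "finite Pr" by (rule finite_subset[of _ "{..N}"]) (auto simp: Pr_def)
    have Reb: "e \<le> Re (w p)" "Re (w p) \<le> c2" if "p \<in> Pr" for p
    proof -
      have p: "real p \<ge> 2" "p \<le> N" "prime p" using that prime_ge_2_nat by (auto simp: Pr_def)
      have "ln 2 \<le> ln (real p)" "ln (real p) \<le> L" using p by (auto simp: L_def)
      moreover from this have "0 < ln (real p)" "0 < L" using ln_gt_zero[of "2::real"] by linarith+
      ultimately show "e \<le> Re (w p)" "Re (w p) \<le> c2" unfolding Rew[OF p(3)] e_def c2_def
        using c by (auto intro!: divide_left_mono mult_pos_pos dest: less_le_trans)
    qed
    have inj: "inj_on w Pr"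
    proof (rule inj_onI)
      fix p q assume pq: "p \<in> Pr" "q \<in> Pr" "w p = w q"
      hence "prime p" "prime q" by (auto simp: Pr_def)
      hence g: "real p \<ge> 2" "real q \<ge> 2" using prime_ge_2_nat by auto
      have "c / ln (real p) = c / ln (real q)" using pq Rew \<open>prime p\<close> \<open>prime q\<close> by metis
      hence "ln (real p) = ln (real q)" using c g by (simp add: field_simps)
      thus "p = q" using g by simp
    qed
    \<comment> \<open>57 = 3 * 19: for k \<le> K one has |k z - 1| \<le> 3 K X, and the zeta factor
      is at most 19 (K X)^2 / e.\<close>
    have "(R / r) ^ card (w ` Pr) \<le> (57 * real K ^ 3 * X ^ 3 / e) ^ K"
    proof (rule card_zeros_le[where S = "{s. Re s > 0}" and c = "of_real X" and f = f])
      show "finite (w ` Pr)" using finPr by simp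
      show "w ` Pr \<subseteq> cball (of_real X) r"
      proof
        fix z assume "z \<in> w ` Pr"
        then obtain p where p: "p \<in> Pr" "z = w p" by auto
        have "\<bar>Im z\<bar> \<le> Y'" using Y'(2)[of p] p by (auto simp: Pr_def)
        hence I: "(Im z)\<^sup>2 \<le> Y'\<^sup>2" using abs_le_square_iff[of "Im z" Y'] Y' by simp
        have "(X - Re z)\<^sup>2 \<le> (X - e)\<^sup>2" using Reb[OF p(1)] p(2) X e by (intro power_mono) auto
        moreover have "Y'\<^sup>2 \<le> e / 4 * (2 * X - 7 / 4 * e)"
        proof -
          have "X \<le> 2 * X - 7 / 4 * e" using X e by simp
          hence "e / 4 * X \<le> e / 4 * (2 * X - 7 / 4 * e)" using e by (intro mult_left_mono) auto
          moreover have "e / 4 * X = Y'\<^sup>2 + e / 4 * (2 + c2)" using e by (simp add: X_def field_simps)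
          moreover have "e / 4 * (2 + c2) \<ge> 0" using e c2 by simp
          ultimately show ?thesis by linarith
        qed
        moreover have "(X - e)\<^sup>2 + e / 4 * (2 * X - 7 / 4 * e) = r\<^sup>2"
          by (simp add: r_def power2_eq_square algebra_simps)
        ultimately have "(X - Re z)\<^sup>2 + (Im z)\<^sup>2 \<le> r\<^sup>2" using I by linarith
        moreover have "norm (of_real X - z) = sqrt ((X - Re z)\<^sup>2 + (Im z)\<^sup>2)" by (simp add: cmod_def)
        ultimately have "norm (of_real X - z) \<le> r" using rR real_le_lsqrt by fastforce
        thus "z \<in> cball (of_real X) r" by (simp add: dist_norm)
      qed
      show "f z = 0" if z: "z \<in> w ` Pr" for z
      proof -
        obtain p where p: "p \<in> Pr" "z = w p" using z by auto
        obtain k :: nat where k: "k \<ge> 1" "of_nat k * z = 1 \<or> zeta_reg (of_nat k * z) = 0"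
          using zero[of p] p by (auto simp: Pr_def)
        have "Re (of_nat k * z) \<le> 1"
        proof (rule ccontr)
          assume gt: "\<not> Re (of_nat k * z) \<le> 1"
          hence "of_nat k * z = 1" using k(2) zeta_reg_nonzero[of "of_nat k * z"] by auto
          thus False using gt by (metis one_complex.sel(1) order_refl)
        qed
        hence "real k * Re z \<le> 1" by simp
        moreover have "real k * e \<le> real k * Re z" using Reb[OF p(1)] p(2) by (intro mult_left_mono) auto
        ultimately have "real k * e \<le> 1" by linarith
        hence "real k \<le> L / c" using c L1 by (simp add: e_def field_simps)
        hence "k \<le> K" unfolding K_def by linarith
        thus ?thesis using k unfolding f_def by (auto intro!: bexI[of _ k])
      qed
      show "open {s. Re s > 0}" by (rule open_halfspace_Re_gt)
      show "f holomorphic_on {s. Re s > 0}"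
        unfolding f_def
      proof (intro holomorphic_intros)
        fix k :: nat assume k: "k \<in> {1..K}"
        have "(zeta_reg \<circ> (\<lambda>z. of_nat k * z)) holomorphic_on {s. Re s > 0}"
          by (rule holomorphic_on_compose_gen[OF _ holomorphic_zeta_reg]) (use k in \<open>auto intro!: holomorphic_intros\<close>)
        thus "(\<lambda>z. zeta_reg (of_nat k * z)) holomorphic_on {s. Re s > 0}" by (simp add: o_def)
      qed
      have ReR: "Re z \<ge> e / 2" if "norm (z - of_real X) \<le> R" for z
        using that abs_Re_le_cmod[of "z - of_real X"] by (auto simp: R_def)
      show "cball (of_real X) R \<subseteq> {s. Re s > 0}"
        using ReR e by (force simp: dist_norm norm_minus_commute)
      show "0 < r" "r < R" by (rule rR)+
      show "norm (f z) \<le> (57 * real K ^ 3 * X ^ 3 / e) ^ K" if z: "norm (z - of_real X) = R" for z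
      proof -
        have Rz: "Re z \<ge> e / 2" using ReR z by simp
        have nz: "norm z \<le> 2 * X" using norm_triangle_sub[of z "of_real X"] z rR X by simp
        have "norm ((of_nat k * z - 1) * zeta_reg (of_nat k * z)) \<le> 57 * real K ^ 3 * X ^ 3 / e" if k: "k \<in> {1..K}" for k
        proof -
          have kz: "norm (of_nat k * z) \<le> 2 * real K * X"
            using k nz by (simp add: norm_mult) (metis mult.assoc mult.commute mult_mono norm_ge_zero of_nat_0_le_iff of_nat_le_iff)
          have KX: "real K * X \<ge> 1" using K1 X mult_mono[of 1 "real K" 1 X] by simp
          have kz1: "norm (of_nat k * z - 1) \<le> 3 * real K * X"
            using norm_triangle_ineq4[of "of_nat k * z" 1] kz KX by simp
          have Rk: "Re (of_nat k * z) \<ge> e / 2"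
            using k Rz mult_mono[of 1 "real k" "e / 2" "Re z"] e by simp
          have "norm (zeta_reg (of_nat k * z)) \<le> 1 + norm (of_nat k * z) * norm (of_nat k * z - 1) * (1 + 1 / Re (of_nat k * z))"
            using Rk e by (intro norm_zeta_reg_le) simp
          also have "\<dots> \<le> 1 + (2 * real K * X) * (3 * real K * X) * (3 / e)"
          proof -
            have "1 / Re (of_nat k * z) \<le> 1 / (e / 2)" using Rk e by (intro divide_left_mono) auto
            also have "1 / (e / 2) = 2 / e" by simp
            finally have "1 + 1 / Re (of_nat k * z) \<le> 1 / e + 2 / e" using e by (simp add: field_simps)
            hence "1 + 1 / Re (of_nat k * z) \<le> 3 / e" by simp
            moreover have "0 \<le> 1 + 1 / Re (of_nat k * z)" using Rk e by simp
            moreover have "0 \<le> X" using X by simp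
            ultimately show ?thesis
              using kz kz1 by (intro add_left_mono mult_mono) auto
          qed
          also have "\<dots> = 1 + 18 * (real K * X)\<^sup>2 / e" by (simp add: power2_eq_square)
          also have "1 \<le> (real K * X)\<^sup>2 / e"
          proof -
            have "e \<le> (real K * X)\<^sup>2" using e(2) one_le_power[OF KX, of 2] by linarith
            thus ?thesis using e by (simp add: le_divide_eq)
          qed
          finally have "norm (zeta_reg (of_nat k * z)) \<le> 19 * (real K * X)\<^sup>2 / e" by simp
          hence "norm ((of_nat k * z - 1) * zeta_reg (of_nat k * z)) \<le> (3 * real K * X) * (19 * (real K * X)\<^sup>2 / e)"
            using kz1 X unfolding norm_mult by (intro mult_mono) auto
          also have "\<dots> = 57 * real K ^ 3 * X ^ 3 / e" by (simp add: power2_eq_square power3_eq_cube)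
          finally show ?thesis .
        qed
        hence "norm (f z) \<le> (\<Prod>k=1..K. 57 * real K ^ 3 * X ^ 3 / e)"
          unfolding f_def prod_norm[symmetric] by (intro prod_mono) auto
        thus ?thesis by simp
      qed
      have "(\<Prod>k=1..K. 1::real) \<le> (\<Prod>k=1..K. norm ((of_nat k * of_real X - 1) * zeta_reg (of_nat k * of_real X)))"
      proof (rule prod_mono, intro conjI)
        fix k assume k: "k \<in> {1..K}"
        have kX: "real k * X \<ge> 2" using k X mult_mono[of 1 "real k" 2 X] by simp
        have "norm (zeta_reg (of_real (real k * X))) \<ge> 1" by (rule norm_zeta_reg_ge_1[OF kX])
        moreover have "norm (of_real (real k * X - 1) :: complex) \<ge> 1" using kX by (simp only: norm_of_real)
        ultimately have "1 * 1 \<le> norm (of_real (real k * X - 1) :: complex) * norm (zeta_reg (of_real (real k * X)))"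
          by (intro mult_mono) auto
        thus "1 \<le> norm ((of_nat k * of_real X - 1) * zeta_reg (of_nat k * of_real X))"
          by (simp add: norm_mult)
      qed auto
      thus "1 \<le> norm (f (of_real X))" by (simp add: f_def prod_norm)
    qed
    also have "card (w ` Pr) = card Pr" by (rule card_image[OF inj])
    finally have le: "(R / r) ^ card Pr \<le> (57 * real K ^ 3 * X ^ 3 / e) ^ K" .
    define M1 where "M1 = 57 * real K ^ 3 * X ^ 3 / e"
    have M1: "M1 > 0" using K1 X e by (simp add: M1_def)
    have Rr1: "R / r > 0" using rR by simp
    have "real (card Pr) * ln (R / r) \<le> real K * ln M1"
    proof -
      have "ln ((R / r) ^ card Pr) \<le> ln (M1 ^ K)"
        using le Rr1 M1 by (simp add: M1_def[symmetric])
      thus ?thesis using Rr1 M1 by (simp add: ln_realpow)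
    qed
    \<comment> \<open>Bounding ln M1 by M1 is wasteful, but any power of ln N will do.\<close>
    also have "\<dots> \<le> real K * M1" using ln_bound[OF M1] by (intro mult_left_mono) auto
    finally have 1: "real (card Pr) * ln (R / r) \<le> real K * M1" .
    have "e / (4 * X) \<le> ln (R / r)"
    proof -
      have "r / R > 0" "r / R \<le> 1" using rR by auto
      hence "ln (r / R) \<le> r / R - 1" by (intro ln_le_minus_one)
      hence "1 - r / R \<le> ln (R / r)" using rR by (simp add: ln_div)
      moreover have "1 - r / R = (e / 4) / R" using rR by (simp add: r_def R_def field_simps)
      moreover have "(e / 4) / X \<le> (e / 4) / R" using rR e by (intro divide_left_mono) auto
      ultimately show ?thesis by simp
    qed
    hence "real (card Pr) * (e / (4 * X)) \<le> real K * M1" using 1 by (meson mult_left_mono of_nat_0_le_iff order_trans)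
    hence "real (card Pr) \<le> real K * M1 * (4 * X / e)" using e X by (simp add: field_simps)
    also have "\<dots> = 228 * X ^ 4 * real K ^ 4 / e\<^sup>2"
      by (simp add: M1_def power2_eq_square power3_eq_cube power4_eq_xxxx)
    also have "\<dots> \<le> 228 * (A * L) ^ 4 * (B * L) ^ 4 / e\<^sup>2"
      using XA KB X A B L1 by (intro divide_right_mono mult_mono power_mono) auto
    also have "\<dots> = 228 * A ^ 4 * B ^ 4 / c\<^sup>2 * L ^ 10"
      using c L1 by (simp add: e_def power_mult_distrib power_divide field_simps flip: power_add)
    finally show ?thesis by (simp add: Pr_def L_def)
  qed
  define C where "C = 228 * A ^ 4 * B ^ 4 / c\<^sup>2"
  have C: "C \<ge> 0" using A B by (simp add: C_def)
  \<comment> \<open>At most \<open>P0\<close> primes lie below \<open>P0\<close>; since N \<ge> 3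
    gives ln N \<ge> 1, adding \<open>P0\<close> to the constant accounts for them.\<close>
  obtain N where N: "N \<ge> max N1 3" "real (card {p. prime p \<and> p \<le> N}) > (real P0 + C) * ln (real N) ^ 10"
    using primes_not_polylog[of "max N1 3" "real P0 + C"] by blast
  have "{p. prime p \<and> p \<le> N} \<subseteq> {..<P0} \<union> {p. prime p \<and> P0 \<le> p \<and> p \<le> N}" by auto
  hence "card {p. prime p \<and> p \<le> N} \<le> card ({..<P0} \<union> {p. prime p \<and> P0 \<le> p \<and> p \<le> N})"
    by (intro card_mono) (auto intro: finite_subset[of _ "{..N}"])
  also have "\<dots> \<le> P0 + card {p. prime p \<and> P0 \<le> p \<and> p \<le> N}"
    by (rule order.trans[OF card_Un_le]) simp
  finally have "real (card {p. prime p \<and> p \<le> N}) \<le> real P0 + C * ln (real N) ^ 10"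
    using main[of N] N(1) unfolding C_def by linarith
  also have "\<dots> \<le> real P0 * ln (real N) ^ 10 + C * ln (real N) ^ 10"
  proof -
    have "ln (real N) \<ge> 1" using N(1) ln_ge_iff[of "real N" 1] exp_le by simp
    hence "ln (real N) ^ 10 \<ge> 1" by (rule one_le_power)
    thus ?thesis using mult_left_mono[of 1 "ln (real N) ^ 10" "real P0"] by simp
  qed
  finally show False using N(2) by (simp add: distrib_right)
qed

section \<open>Zeros of perturbed exponential sums\<close>

lemma holomorphic_linear_factor:
  fixes f :: "complex \<Rightarrow> complex"
  assumes "f holomorphic_on UNIV"
  obtains q where "q holomorphic_on UNIV" "\<And>u. f u = f u0 + (u - u0) * q u" "q u0 = deriv f u0"
proof -
  define q where "q = (\<lambda>u. if u = u0 then deriv f u0 else (f u - f u0) / (u - u0))"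
  have "f field_differentiable at u0"
    using assms holomorphic_on_imp_differentiable_at[OF assms open_UNIV] by blast
  hence dq: "deriv (\<lambda>u. f u - f u0) u0 = deriv f u0" by simp
  have "(\<lambda>z. if z = u0 then deriv (\<lambda>u. f u - f u0) u0 else (f z - f u0) / (z - u0)) holomorphic_on UNIV"
    by (rule pole_theorem_open_0[OF _ open_UNIV, of "\<lambda>u. f u - f u0"])
       (use assms in \<open>auto intro!: holomorphic_intros\<close>)
  hence "q holomorphic_on UNIV" unfolding q_def dq .
  show ?thesis
  proof (rule that)
    show "q holomorphic_on UNIV" by fact
  qed (auto simp: q_def)
qed

text \<open>Rouche's theorem yields for large \<open>L\<close> a zero \<open>u\<close> of \<open>Phi L \<mu>\<close> with
  \<open>u - u0 \<approx> - E c1 u0 / deriv E0 u0 * exp (- L (x c1 + \<mu> d c1))\<close>. This is not affine in \<open>\<mu>\<close>, as comparing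
  three values shows; therefore each relation in \<open>bad L\<close> holds for countably many \<open>\<mu>\<close> only.
  The values of \<open>\<mu>\<close> for which the phase of the exponential gives \<open>Re u > Re u0\<close> for arbitrarily large
  \<open>L\<close> form a dense \<open>G\<^sub>\<delta>\<close> set, so by Baire some \<open>\<mu>\<close> satisfies both requirements.\<close>

lemma perturbed_zero_aux:
  fixes E0 :: "complex \<Rightarrow> complex" and E :: "'k \<Rightarrow> complex \<Rightarrow> complex" and x :: "'k \<Rightarrow> complex"
    and d :: "'k \<Rightarrow> real" and bad :: "real \<Rightarrow> (complex \<times> complex \<times> complex) set"
  assumes K: "finite K" and hol: "E0 holomorphic_on UNIV" "\<And>c. c \<in> K \<Longrightarrow> E c holomorphic_on UNIV"
    and E0: "E0 u0 = 0" "deriv E0 u0 \<noteq> 0" and u0: "Re u0 \<ge> 0"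
    and x: "\<And>c. c \<in> K \<Longrightarrow> Re (x c) > 0"
    and c1: "c1 \<in> K" "E c1 u0 \<noteq> 0" "d c1 \<noteq> 0"
      "\<And>c. c \<in> K \<Longrightarrow> c \<noteq> c1 \<Longrightarrow> E c u0 \<noteq> 0 \<Longrightarrow> Re (x c) > Re (x c1)"
    and LL: "\<And>B. \<exists>L\<in>LL. L > B" "countable LL"
    and bad: "\<And>L. L \<in> LL \<Longrightarrow> countable (bad L)"
      "\<And>L y y' y''. L \<in> LL \<Longrightarrow> (y, y', y'') \<in> bad L \<Longrightarrow> y' \<noteq> 0 \<or> y'' \<noteq> 0"
    and pos: "\<epsilon> > 0" "\<rho>0 > 0"
  defines "Phi \<equiv> (\<lambda>L \<mu> u. E0 u + (\<Sum>c\<in>K. exp (- (of_real L * (x c + \<mu> * of_real (d c)))) * E c u))"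
  shows "\<exists>\<mu>. norm \<mu> < \<epsilon> \<and> (\<forall>B. \<exists>L\<in>LL. L > B \<and> (\<exists>u. norm (u - u0) < \<rho>0 \<and> Re u > 0 \<and> Phi L \<mu> u = 0 \<and>
           (\<forall>(y, y', y'')\<in>bad L. y + \<mu> * y' + u * y'' \<noteq> 0)))"
proof -
  obtain Q0 where Q0: "Q0 holomorphic_on UNIV" "\<And>u. E0 u = (u - u0) * Q0 u" "Q0 u0 = deriv E0 u0"
    using holomorphic_linear_factor[OF hol(1), of u0] E0(1) by auto
  have "\<exists>Q. \<forall>c\<in>K. Q c holomorphic_on UNIV \<and> (\<forall>u. E c u = E c u0 + (u - u0) * Q c u)"
    using holomorphic_linear_factor[OF hol(2), of _ u0] by (intro bchoice) metis
  then obtain Q where Q: "\<And>c. c \<in> K \<Longrightarrow> Q c holomorphic_on UNIV"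
    "\<And>c u. c \<in> K \<Longrightarrow> E c u = E c u0 + (u - u0) * Q c u" by blast
  define m where "m = norm (Q0 u0)"
  have m: "m > 0" using E0 Q0 by (simp add: m_def)
  have "isCont Q0 u0" using Q0(1) holomorphic_on_imp_continuous_on continuous_on_eq_continuous_at by blast
  then obtain \<rho>1 where \<rho>1: "\<rho>1 > 0" "\<And>u. norm (u - u0) < \<rho>1 \<Longrightarrow> norm (Q0 u - Q0 u0) < m / 16"
    using m unfolding isCont_def LIM_def dist_norm by (metis divide_pos_pos zero_less_numeral cancel_comm_monoid_add_class.diff_cancel norm_zero)
  define \<rho> where "\<rho> = min (\<rho>0 / 2) (\<rho>1 / 2)"
  have \<rho>: "\<rho> > 0" "\<rho> < \<rho>0" "\<And>u. norm (u - u0) \<le> \<rho> \<Longrightarrow> norm (Q0 u - Q0 u0) < m / 16"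
    using \<rho>1 pos by (auto simp: \<rho>_def)
  have "\<forall>c\<in>K. \<exists>C. \<forall>u\<in>cball u0 \<rho>. norm (E c u) \<le> C \<and> norm (Q c u) \<le> C"
  proof
    fix c assume c: "c \<in> K"
    have "compact (E c ` cball u0 \<rho>)" "compact (Q c ` cball u0 \<rho>)"
      using hol(2)[OF c] Q(1)[OF c]
      by (auto intro!: compact_continuous_image holomorphic_on_imp_continuous_on elim: holomorphic_on_subset)
    hence "bounded (E c ` cball u0 \<rho>)" "bounded (Q c ` cball u0 \<rho>)" by (auto intro: compact_imp_bounded)
    then obtain C1 C2 where "\<forall>u\<in>cball u0 \<rho>. norm (E c u) \<le> C1" "\<forall>u\<in>cball u0 \<rho>. norm (Q c u) \<le> C2"
      unfolding bounded_iff by blast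
    thus "\<exists>C. \<forall>u\<in>cball u0 \<rho>. norm (E c u) \<le> C \<and> norm (Q c u) \<le> C"
      by (intro exI[of _ "max C1 C2"]) fastforce
  qed
  then obtain C0 where C0: "\<And>c u. c \<in> K \<Longrightarrow> u \<in> cball u0 \<rho> \<Longrightarrow> norm (E c u) \<le> C0 c \<and> norm (Q c u) \<le> C0 c"
    by metis
  define C where "C = 1 + (\<Sum>c\<in>K. \<bar>C0 c\<bar>)"
  have C: "C \<ge> 1" "\<And>c u. c \<in> K \<Longrightarrow> u \<in> cball u0 \<rho> \<Longrightarrow> norm (E c u) \<le> C \<and> norm (Q c u) \<le> C"
  proof -
    show "C \<ge> 1" by (simp add: C_def sum_nonneg)
    fix c u assume c: "c \<in> K" "u \<in> cball u0 \<rho>"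
    have "\<bar>C0 c\<bar> \<le> (\<Sum>c\<in>K. \<bar>C0 c\<bar>)" using K c by (intro member_le_sum) auto
    thus "norm (E c u) \<le> C \<and> norm (Q c u) \<le> C" using C0[OF c] by (auto simp: C_def)
  qed
  define e1 where "e1 = norm (E c1 u0)"
  have e1: "e1 > 0" using c1 by (simp add: e1_def)
  \<comment> \<open>The positive quantities to be preserved: the real parts of the exponents and
    their gaps to the dominant one. Each is at least 2 g, and a shift \<mu> of norm at most
    \<open>r\<close> changes each real part by at most g / 2, so that g remains.\<close>
  define V where "V = (\<lambda>c. Re (x c)) ` K \<union> (\<lambda>c. Re (x c) - Re (x c1)) ` {c\<in>K. c \<noteq> c1 \<and> E c u0 \<noteq> 0}"
  define g where "g = Min V / 2"
  have V: "finite V" "V \<noteq> {}" using K c1 by (auto simp: V_def)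
  have "Min V > 0" using V x c1(4) by (auto simp: V_def)
  hence g: "g > 0" by (simp add: g_def)
  have gV: "2 * g \<le> v" if "v \<in> V" for v using that V by (simp add: g_def)
  define D where "D = 1 + (\<Sum>c\<in>K. \<bar>d c\<bar>)"
  have D: "D \<ge> 1" "\<And>c. c \<in> K \<Longrightarrow> \<bar>d c\<bar> \<le> D"
  proof -
    show "D \<ge> 1" by (simp add: D_def sum_nonneg)
    fix c assume "c \<in> K"
    hence "\<bar>d c\<bar> \<le> (\<Sum>c\<in>K. \<bar>d c\<bar>)" using K by (intro member_le_sum) auto
    thus "\<bar>d c\<bar> \<le> D" by (simp add: D_def)
  qed
  define r where "r = min (\<epsilon> / 2) (g / (2 * D))"
  have r: "r > 0" "r < \<epsilon>" "r * D * 2 \<le> g" using pos g D by (auto simp: r_def min_def field_simps)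
  define X where "X = (\<lambda>c \<mu>. Re (x c) + Re \<mu> * d c)"
  have Rd: "\<bar>Re \<mu> * d c\<bar> \<le> g / 2" if "c \<in> K" "norm \<mu> \<le> r" for c \<mu>
  proof -
    have "\<bar>Re \<mu> * d c\<bar> \<le> r * D"
      using that D(2)[OF that(1)] abs_Re_le_cmod[of \<mu>] r by (subst abs_mult) (intro mult_mono; auto)
    thus ?thesis using r by simp
  qed
  have X1: "X c \<mu> \<ge> g" if "c \<in> K" "norm \<mu> \<le> r" for c \<mu>
    using Rd[OF that] gV[of "Re (x c)"] that by (auto simp: X_def V_def)
  have X2: "X c \<mu> \<ge> X c1 \<mu> + g" if "c \<in> K" "c \<noteq> c1" "E c u0 \<noteq> 0" "norm \<mu> \<le> r" for c \<mu>
    using Rd[OF that(1,4)] Rd[OF c1(1) that(4)] gV[of "Re (x c) - Re (x c1)"] that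
    by (auto simp: X_def V_def)
  define ee where "ee = (\<lambda>L c \<mu>. exp (- (of_real L * (x c + \<mu> * of_real (d c)))) :: complex)"
  have nee: "norm (ee L c \<mu>) = exp (- L * X c \<mu>)" for L c \<mu>
    by (simp add: ee_def X_def)
  define n where "n = real (card K)"
  have n: "n \<ge> 0" by (simp add: n_def)
  \<comment> \<open>The three bounds serve three estimates: m / 16 for the perturbed derivative
    quotient, \<rho> m / 4 for Rouche's theorem on the circle of radius \<rho>, and e1 / 8 for the
    non-dominant terms relative to the dominant one.\<close>
  define \<kappa> where "\<kappa> = min (min (m / 16) (\<rho> * m / 4)) (e1 / 8)"
  have \<kappa>: "\<kappa> > 0" "\<kappa> \<le> m / 16" "\<kappa> \<le> \<rho> * m / 4" "\<kappa> \<le> e1 / 8"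
    using m \<rho> e1 by (auto simp: \<kappa>_def)
  have "((\<lambda>L. n * C * exp (- L * g)) \<longlongrightarrow> 0) at_top"
    using g by real_asymp
  hence "eventually (\<lambda>L. n * C * exp (- L * g) < \<kappa>) at_top"
    using \<kappa>(1) by (rule order_tendstoD)
  \<comment> \<open>This makes the dominant exponential vary by a factor t > 28 when \<mu> moves by
    \<open>r\<close> along the real axis. The comparison of three values below is contradictory as
    soon as t > 9.\<close>
  moreover have "eventually (\<lambda>L. L > ln 28 / (r * \<bar>d c1\<bar>)) at_top" by (rule eventually_gt_at_top)
  ultimately have "eventually (\<lambda>L. n * C * exp (- L * g) < \<kappa> \<and> L > ln 28 / (r * \<bar>d c1\<bar>) \<and> L > 0) at_top"
    using eventually_gt_at_top[of "0::real"] by eventually_elim auto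
  then obtain L0 where L0: "\<And>L. L \<ge> L0 \<Longrightarrow> n * C * exp (- L * g) < \<kappa> \<and> L > ln 28 / (r * \<bar>d c1\<bar>) \<and> L > 0"
    unfolding eventually_at_top_linorder by blast

  have sumE: "norm (\<Sum>c\<in>K. ee L c \<mu> * E c u) < \<kappa>" and sumQ: "norm (\<Sum>c\<in>K. ee L c \<mu> * Q c u) < \<kappa>"
    if "L \<ge> L0" "norm \<mu> \<le> r" "u \<in> cball u0 \<rho>" for L \<mu> u
  proof -
    have le: "norm (ee L c \<mu>) \<le> exp (- L * g)" if "c \<in> K" for c
      using X1[OF that \<open>norm \<mu> \<le> r\<close>] L0[OF \<open>L \<ge> L0\<close>] by (simp add: nee)
    have "norm (\<Sum>c\<in>K. ee L c \<mu> * E c u) \<le> (\<Sum>c\<in>K. exp (- L * g) * C)"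
      using C(2)[OF _ that(3)] C(1) le by (intro sum_norm_le) (auto simp: norm_mult intro!: mult_mono)
    also have "\<dots> = n * C * exp (- L * g)" by (simp add: n_def)
    finally show "norm (\<Sum>c\<in>K. ee L c \<mu> * E c u) < \<kappa>" using L0[OF \<open>L \<ge> L0\<close>] by simp
    have "norm (\<Sum>c\<in>K. ee L c \<mu> * Q c u) \<le> (\<Sum>c\<in>K. exp (- L * g) * C)"
      using C(2)[OF _ that(3)] C(1) le by (intro sum_norm_le) (auto simp: norm_mult intro!: mult_mono)
    also have "\<dots> = n * C * exp (- L * g)" by (simp add: n_def)
    finally show "norm (\<Sum>c\<in>K. ee L c \<mu> * Q c u) < \<kappa>" using L0[OF \<open>L \<ge> L0\<close>] by simp
  qed
  have Phi: "Phi L \<mu> u = E0 u + (\<Sum>c\<in>K. ee L c \<mu> * E c u)" for L \<mu> u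
    by (simp add: Phi_def ee_def)
  have holPhi: "Phi L \<mu> holomorphic_on UNIV" for L \<mu>
    unfolding Phi by (intro holomorphic_intros hol)
  have Q0lb: "norm (Q0 u) \<ge> m * (15/16)" if "u \<in> cball u0 \<rho>" for u
  proof -
    have "norm (Q0 u - Q0 u0) < m / 16" by (rule \<rho>(3)) (use that in \<open>simp add: dist_norm norm_minus_commute\<close>)
    thus ?thesis using norm_triangle_ineq2[of "Q0 u0" "Q0 u0 - Q0 u"]
      by (simp add: norm_minus_commute m_def)
  qed
  have circle: "norm (Phi L \<mu> u) > \<rho> * m / 2" if "L \<ge> L0" "norm \<mu> \<le> r" "norm (u0 - u) = \<rho>" for L \<mu> u
  proof -
    have u: "u \<in> cball u0 \<rho>" using that by (simp add: dist_norm)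
    have "norm (E0 u) = \<rho> * norm (Q0 u)" using that by (simp add: Q0 norm_mult norm_minus_commute)
    also have "\<dots> \<ge> \<rho> * (m * (15/16))" using Q0lb[OF u] \<rho> by (intro mult_left_mono) auto
    finally have "norm (E0 u) \<ge> \<rho> * m * (15/16)" by simp
    moreover have "norm (\<Sum>c\<in>K. ee L c \<mu> * E c u) < \<rho> * m / 4" using sumE[OF that(1,2) u] \<kappa> by simp
    moreover have "norm (Phi L \<mu> u) \<ge> norm (E0 u) - norm (\<Sum>c\<in>K. ee L c \<mu> * E c u)"
      unfolding Phi by (metis norm_diff_ineq)
    moreover have "\<rho> * m > 0" using \<rho> m by simp
    ultimately show ?thesis by linarith
  qed
  have exists: "\<exists>u. norm (u - u0) < \<rho> \<and> Phi L \<mu> u = 0" if "L \<ge> L0" "norm \<mu> \<le> r" for L \<mu>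
  proof -
    have "norm (Phi L \<mu> u0) < \<rho> * m / 2"
    proof -
      have "norm (\<Sum>c\<in>K. ee L c \<mu> * E c u0) < \<rho> * m / 4"
        using sumE[OF that, of u0] \<kappa> \<rho> by simp
      moreover have "\<rho> * m > 0" using \<rho> m by simp
      ultimately show ?thesis by (simp add: Phi E0)
    qed
    hence less: "norm (Phi L \<mu> u0) < norm (Phi L \<mu> z)" if "norm (u0 - z) = \<rho>" for z
      using circle[OF \<open>L \<ge> L0\<close> \<open>norm \<mu> \<le> r\<close> that] by simp
    have hb: "Phi L \<mu> holomorphic_on ball u0 \<rho>" "continuous_on (cball u0 \<rho>) (Phi L \<mu>)"
      using holPhi holomorphic_on_subset holomorphic_on_imp_continuous_on by blast+
    obtain z where "z \<in> ball u0 \<rho>" "Phi L \<mu> z = 0"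
      using holomorphic_contract_to_zero[OF hb(2,1) \<rho>(1) less] by blast
    thus ?thesis by (auto simp: dist_norm norm_minus_commute)
  qed
  define \<zeta> where "\<zeta> = (\<lambda>L \<mu>. - (ee L c1 \<mu> * E c1 u0) / Q0 u0)"
  have n\<zeta>: "norm (\<zeta> L \<mu>) = exp (- L * X c1 \<mu>) * e1 / m" for L \<mu>
    by (simp add: \<zeta>_def norm_divide norm_mult nee e1_def m_def)
  have asymp: "norm (u - u0 - \<zeta> L \<mu>) \<le> norm (\<zeta> L \<mu>) / 2"
    if "L \<ge> L0" "norm \<mu> \<le> r" "norm (u - u0) < \<rho>" "Phi L \<mu> u = 0" for L \<mu> u
  proof -
    have u: "u \<in> cball u0 \<rho>" using that by (simp add: dist_norm norm_minus_commute)
    \<comment> \<open>Splitting each term into its value at \<open>u0\<close> and (u - u0) times a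
      difference quotient turns the equation into one that is linear in u - u0, with coefficient
      \<open>J\<close> close to \<open>Q0 u0\<close>. \<theta> is the relative size of the
      non-dominant terms at \<open>u0\<close>.\<close>
    define J where "J = Q0 u + (\<Sum>c\<in>K. ee L c \<mu> * Q c u)"
    define \<theta> where "\<theta> = (\<Sum>c\<in>K - {c1}. ee L c \<mu> * E c u0) / ee L c1 \<mu>"
    have ne: "ee L c1 \<mu> \<noteq> 0" by (simp add: ee_def)
    have "0 = E0 u + (\<Sum>c\<in>K. ee L c \<mu> * E c u)" using that Phi by simp
    also have "(\<Sum>c\<in>K. ee L c \<mu> * E c u) = (\<Sum>c\<in>K. ee L c \<mu> * E c u0 + (u - u0) * (ee L c \<mu> * Q c u))"
    proof (rule sum.cong[OF refl])
      fix c assume c: "c \<in> K"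
      have "ee L c \<mu> * E c u = ee L c \<mu> * (E c u0 + (u - u0) * Q c u)" by (simp only: Q(2)[OF c, of u])
      also have "\<dots> = ee L c \<mu> * E c u0 + (u - u0) * (ee L c \<mu> * Q c u)"
        by (simp only: distrib_left mult.left_commute)
      finally show "ee L c \<mu> * E c u = ee L c \<mu> * E c u0 + (u - u0) * (ee L c \<mu> * Q c u)" .
    qed
    also have "\<dots> = (\<Sum>c\<in>K. ee L c \<mu> * E c u0) + (u - u0) * (\<Sum>c\<in>K. ee L c \<mu> * Q c u)"
      by (simp add: sum.distrib sum_distrib_left)
    also have "(\<Sum>c\<in>K. ee L c \<mu> * E c u0) = ee L c1 \<mu> * (E c1 u0 + \<theta>)"
      using ne by (subst sum.remove[OF K c1(1)]) (simp add: \<theta>_def distrib_left)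
    finally have eq: "(u - u0) * J = - (ee L c1 \<mu> * (E c1 u0 + \<theta>))"
      by (simp add: J_def Q0(2) algebra_simps eq_neg_iff_add_eq_0)
    have "norm (J - Q0 u0) \<le> norm (Q0 u - Q0 u0) + norm (\<Sum>c\<in>K. ee L c \<mu> * Q c u)"
      unfolding J_def by (metis add_diff_eq diff_add_eq norm_triangle_ineq)
    also have "\<dots> \<le> m / 16 + m / 16"
      using \<rho>(3)[of u] that sumQ[OF that(1,2) u] \<kappa> by (intro add_mono) auto
    finally have J: "norm (J - Q0 u0) \<le> m / 8" by simp
    have th: "norm \<theta> \<le> e1 / 8"
    proof -
      have "norm \<theta> \<le> (\<Sum>c\<in>K - {c1}. exp (- L * g) * C)"
        unfolding \<theta>_def sum_divide_distrib
      proof (rule sum_norm_le)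
        fix c assume c: "c \<in> K - {c1}"
        show "norm (ee L c \<mu> * E c u0 / ee L c1 \<mu>) \<le> exp (- L * g) * C"
        proof (cases "E c u0 = 0")
          case False
          have "norm (ee L c \<mu> * E c u0 / ee L c1 \<mu>) = exp (- L * X c \<mu> - (- L * X c1 \<mu>)) * norm (E c u0)"
            by (simp add: norm_mult norm_divide nee exp_diff exp_minus field_simps)
          also have "\<dots> \<le> exp (- L * g) * C"
          proof (intro mult_mono)
            have "L * (X c1 \<mu> + g) \<le> L * X c \<mu>"
              using X2[of c \<mu>] c False that(2) L0[OF that(1)] by (intro mult_left_mono) auto
            thus "exp (- L * X c \<mu> - (- L * X c1 \<mu>)) \<le> exp (- L * g)" by (simp add: algebra_simps)
          qed (use C(2)[of c u0] c \<rho> in auto)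
          finally show ?thesis .
        qed (use C in auto)
      qed
      also have "\<dots> \<le> n * C * exp (- L * g)"
        using K c1 C by (simp add: n_def card_Diff_singleton)
      finally show ?thesis using L0[OF that(1)] \<kappa> by linarith
    qed
    have Jlb: "norm J \<ge> m * (7/8)"
      using norm_triangle_ineq2[of "Q0 u0" "Q0 u0 - J"] J by (simp add: norm_minus_commute m_def)
    have J0: "J \<noteq> 0" using Jlb m by auto
    have Q00: "Q0 u0 \<noteq> 0" using m by (auto simp: m_def)
    have "(u - u0 - \<zeta> L \<mu>) * (J * Q0 u0) = - ee L c1 \<mu> * (E c1 u0 + \<theta>) * Q0 u0 + ee L c1 \<mu> * E c1 u0 * J"
    proof -
      have "(u - u0 - \<zeta> L \<mu>) * (J * Q0 u0) = ((u - u0) * J) * Q0 u0 - (\<zeta> L \<mu> * Q0 u0) * J"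
        by (simp add: algebra_simps)
      also have "\<zeta> L \<mu> * Q0 u0 = - (ee L c1 \<mu> * E c1 u0)" using Q00 by (simp add: \<zeta>_def)
      finally show ?thesis unfolding eq by simp
    qed
    also have "\<dots> = ee L c1 \<mu> * (E c1 u0 * (J - Q0 u0) - \<theta> * Q0 u0)" by (simp add: algebra_simps)
    finally have "norm (u - u0 - \<zeta> L \<mu>) * (norm J * m) = exp (- L * X c1 \<mu>) * norm (E c1 u0 * (J - Q0 u0) - \<theta> * Q0 u0)"
      by (metis m_def nee norm_mult)
    also have "norm (E c1 u0 * (J - Q0 u0) - \<theta> * Q0 u0) \<le> e1 * (m / 8) + (e1 / 8) * m"
      unfolding e1_def m_def
      by (intro order.trans[OF norm_triangle_ineq4] add_mono)
         (use J th e1 m in \<open>auto simp: norm_mult e1_def m_def intro!: mult_left_mono mult_right_mono\<close>)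
    finally have "norm (u - u0 - \<zeta> L \<mu>) * (norm J * m) \<le> exp (- L * X c1 \<mu>) * (e1 * m / 4)" by simp
    moreover have "norm (u - u0 - \<zeta> L \<mu>) * ((m * (7/8)) * m) \<le> norm (u - u0 - \<zeta> L \<mu>) * (norm J * m)"
      using Jlb m by (intro mult_left_mono mult_right_mono) auto
    ultimately have "norm (u - u0 - \<zeta> L \<mu>) * ((m * (7/8)) * m) \<le> exp (- L * X c1 \<mu>) * (e1 * m / 4)" by linarith
    hence "norm (u - u0 - \<zeta> L \<mu>) * m * (7/8) \<le> exp (- L * X c1 \<mu>) * e1 / 4"
      using m by (simp add: field_simps)
    hence "norm (u - u0 - \<zeta> L \<mu>) * (7/8) \<le> norm (\<zeta> L \<mu>) / 4"
      using m by (simp add: n\<zeta> field_simps)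
    thus ?thesis using norm_ge_zero[of "\<zeta> L \<mu>"] by linarith
  qed

  define S where "S = cball (0::complex) r"
  define Bd where "Bd = (\<lambda>L (y, y', y''). {\<mu>\<in>S. \<exists>u. norm (u - u0) < \<rho> \<and> Phi L \<mu> u = 0 \<and> y + \<mu> * y' + u * y'' = 0})"
  \<comment> \<open>A relation involving u forces u = A(\<mu>) with A affine, so \<mu> is a zero of
    an entire function. Such zeros are countable unless the function is constant, and then it would
    vanish identically.\<close>
  have cBd: "countable (Bd L (y, y', y''))" if L: "L \<ge> L0" and y: "y' \<noteq> 0 \<or> y'' \<noteq> 0" for L y y' y''
  proof (cases "y'' = 0")
    case True
    hence "Bd L (y, y', y'') \<subseteq> {- y / y'}" using y by (auto simp: Bd_def field_simps add_eq_0_iff)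
    thus ?thesis using countable_subset by blast
  next
    case False
    define A where "A = (\<lambda>\<mu>. - (y + \<mu> * y') / y'')"
    have A: "u = A \<mu>" if "y + \<mu> * y' + u * y'' = 0" for u \<mu>
    proof -
      have "u * y'' = - (y + \<mu> * y')" using that by (metis add.commute eq_neg_iff_add_eq_0)
      hence "u = - (y + \<mu> * y') / y''" using False by (metis nonzero_eq_divide_eq)
      thus ?thesis by (simp only: A_def)
    qed
    define \<phi> where "\<phi> = (\<lambda>\<mu>. Phi L \<mu> (A \<mu>))"
    have sub: "Bd L (y, y', y'') \<subseteq> {\<mu>\<in>UNIV. \<phi> \<mu> = 0}"
      using A by (auto simp: Bd_def \<phi>_def)
    have holA: "A holomorphic_on UNIV" unfolding A_def by (intro holomorphic_intros) (use False in auto)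
    have comp: "(\<lambda>\<mu>. f (A \<mu>)) holomorphic_on UNIV" if "f holomorphic_on UNIV" for f :: "complex \<Rightarrow> complex"
      using holomorphic_on_compose_gen[OF holA that] by (simp add: o_def)
    have hol\<phi>: "\<phi> holomorphic_on UNIV"
      unfolding \<phi>_def Phi ee_def by (intro holomorphic_intros comp hol)
    show ?thesis
    proof (cases "\<phi> constant_on UNIV")
      case nc: False
      have "countable {\<mu>\<in>UNIV. \<phi> \<mu> = 0}"
        by (rule holomorphic_countable_zeros[OF hol\<phi>]) (use nc in auto)
      thus ?thesis using sub countable_subset by blast
    next
      case True
      then obtain v where v: "\<And>\<mu>. \<phi> \<mu> = v" by (auto simp: constant_on_def)
      have "Bd L (y, y', y'') = {}"
      proof (rule ccontr)
        assume "Bd L (y, y', y'') \<noteq> {}"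
        then obtain \<mu>2 where \<mu>2: "\<mu>2 \<in> S" "\<phi> \<mu>2 = 0" "norm (A \<mu>2 - u0) < \<rho>"
          using A by (auto simp: Bd_def \<phi>_def)
        hence v0: "v = 0" using v by simp
        \<comment> \<open>Were A(\<mu>) a zero of \<open>Phi L \<mu>\<close> for all \<mu>, the
          connected set of its values on \<open>S\<close> could not cross the circle, on which there
          is no zero. It would stay in the disc where the asymptotic formula applies.\<close>
        have conn: "connected (A ` S)"
          unfolding S_def by (intro connected_continuous_image)
            (auto intro!: holomorphic_on_imp_continuous_on holomorphic_on_subset[OF holA])
        have "A ` S \<inter> frontier (ball u0 \<rho>) = {}"
        proof -
          have "norm (u0 - A \<mu>) \<noteq> \<rho>" if "\<mu> \<in> S" for \<mu>
          proof
            assume "norm (u0 - A \<mu>) = \<rho>"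
            from circle[OF L _ this] that have "norm (\<phi> \<mu>) > \<rho> * m / 2" by (simp add: S_def \<phi>_def)
            hence "\<rho> * m / 2 < 0" using v[of \<mu>] v0 by simp
            moreover have "\<rho> * m > 0" using \<rho>(1) m by (rule mult_pos_pos)
            ultimately show False by linarith
          qed
          thus ?thesis using \<rho>(1) by (auto simp: dist_norm)
        qed
        moreover have "A \<mu>2 \<in> A ` S \<inter> ball u0 \<rho>" using \<mu>2 by (auto simp: dist_norm norm_minus_commute)
        ultimately have "A ` S \<subseteq> ball u0 \<rho>"
          using connected_Int_frontier[OF conn, of "ball u0 \<rho>"] by blast
        hence inb: "norm (A \<mu> - u0) < \<rho>" if "\<mu> \<in> S" for \<mu> using that by (auto simp: dist_norm norm_minus_commute)
        have as: "norm (A \<mu> - u0 - \<zeta> L \<mu>) \<le> norm (\<zeta> L \<mu>) / 2" if "\<mu> \<in> S" for \<mu>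
        proof (rule asymp[OF L _ inb[OF that]])
          show "Phi L \<mu> (A \<mu>) = 0" using v[of \<mu>] v0 by (simp add: \<phi>_def)
        qed (use that in \<open>simp add: S_def\<close>)
        \<comment> \<open>Real shifts by w and -w divide and multiply the displacement size M by t.
          An affine A satisfies A(-w) = 2 A(0) - A(w), which cannot hold with sizes comparable to M
          t, M and M / t.\<close>
        define w where "w = sgn (d c1) * r"
        have wS: "of_real w \<in> S" "- of_real w \<in> S" "(0::complex) \<in> S"
        proof -
          have "\<bar>w\<bar> \<le> r" using r(1) c1(3) by (simp add: w_def abs_mult abs_sgn_eq)
          thus "of_real w \<in> S" "- of_real w \<in> S" "(0::complex) \<in> S" using r(1) by (simp_all add: S_def)
        qed
        have wd: "w * d c1 = r * \<bar>d c1\<bar>" by (simp add: w_def sgn_if)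
        define M where "M = exp (- L * Re (x c1)) * e1 / m"
        have M: "M > 0" using e1 m by (simp add: M_def)
        define t where "t = exp (L * (r * \<bar>d c1\<bar>))"
        have "L > ln 28 / (r * \<bar>d c1\<bar>)" "L > 0" using L0[OF L] by auto
        hence "ln 28 < L * (r * \<bar>d c1\<bar>)" using r c1(3) by (simp add: divide_less_eq mult.commute)
        hence t: "t > 28" unfolding t_def by (metis exp_less_mono exp_ln zero_less_numeral)
        have z0: "norm (\<zeta> L 0) = M" by (simp add: n\<zeta> X_def M_def)
        have zm: "norm (\<zeta> L (- of_real w)) = M * t"
          using wd by (simp add: n\<zeta> X_def M_def t_def exp_add[symmetric] algebra_simps)
        have zp: "norm (\<zeta> L (of_real w)) = M / t"
          using wd by (simp add: n\<zeta> X_def M_def t_def exp_diff algebra_simps)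
        have "A (- of_real w) = 2 * A 0 - A (of_real w)"
          using False by (simp add: A_def field_simps)
        hence "A (- of_real w) - u0 = 2 * (A 0 - u0) - (A (of_real w) - u0)" by simp
        hence "norm (A (- of_real w) - u0) \<le> norm (2 * (A 0 - u0)) + norm (A (of_real w) - u0)"
          by (metis norm_triangle_ineq4)
        also have "\<dots> = 2 * norm (A 0 - u0) + norm (A (of_real w) - u0)" by (simp only: norm_mult norm_numeral)
        finally have 1: "norm (A (- of_real w) - u0) \<le> 2 * norm (A 0 - u0) + norm (A (of_real w) - u0)" .
        have 2: "norm (A (- of_real w) - u0) \<ge> M * t / 2"
          using as[OF wS(2)] zm norm_triangle_ineq2[of "\<zeta> L (- of_real w)" "\<zeta> L (- of_real w) - (A (- of_real w) - u0)"]
          by (simp add: norm_minus_commute)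
        have 3: "norm (A 0 - u0) \<le> M * (3/2)"
          using as[OF wS(3)] z0 norm_triangle_sub[of "A 0 - u0" "\<zeta> L 0"] by simp
        have 4: "norm (A (of_real w) - u0) \<le> M * (3/2)"
        proof -
          have "M / t \<le> M" using M t by (simp add: divide_le_eq)
          thus ?thesis
            using as[OF wS(1)] zp norm_triangle_sub[of "A (of_real w) - u0" "\<zeta> L (of_real w)"] by linarith
        qed
        have "M * t / 2 \<le> M * (9/2)" using 1 2 3 4 by linarith
        thus False using M t by simp
      qed
      thus ?thesis by simp
    qed
  qed
  define Cb where "Cb = (\<Union>L\<in>{L\<in>LL. L \<ge> L0}. \<Union>b\<in>bad L. Bd L b)"
  have cCb: "countable Cb" unfolding Cb_def
  proof (intro countable_UN)
    show "countable {L \<in> LL. L0 \<le> L}" using LL(2) countable_subset[of "{L \<in> LL. L0 \<le> L}" LL] by auto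
    fix L b assume "L \<in> {L \<in> LL. L0 \<le> L}" "b \<in> bad L"
    thus "countable (Bd L b)" using cBd bad(2) by (cases b) auto
  qed (use bad in auto)
  \<comment> \<open>The true displacement differs from \<zeta> by at most half the modulus of
    \<zeta>, so under this condition its real part is positive.\<close>
  define al where "al = (\<lambda>L \<mu>. Re (\<zeta> L \<mu>) > norm (\<zeta> L \<mu>) / 2)"
  define O' where "O' = (\<lambda>B. {\<mu>\<in>S. \<exists>L\<in>LL. L > B \<and> L \<ge> L0 \<and> al L \<mu>})"
  have cont\<zeta>: "continuous_on UNIV (\<zeta> L)" for L
    unfolding \<zeta>_def ee_def by (intro continuous_intros) (use m in \<open>auto simp: m_def\<close>)
  have oO: "openin (top_of_set S) (O' B)" for B
  proof -
    have "open {\<mu>. al L \<mu>}" for L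
      unfolding al_def by (intro open_Collect_less continuous_on_divide continuous_on_norm continuous_on_Re continuous_on_const cont\<zeta>) auto
    hence "open (\<Union>L\<in>{L\<in>LL. L > B \<and> L \<ge> L0}. {\<mu>. al L \<mu>})" by blast
    moreover have "O' B = S \<inter> (\<Union>L\<in>{L\<in>LL. L > B \<and> L \<ge> L0}. {\<mu>. al L \<mu>})" by (auto simp: O'_def)
    ultimately show ?thesis by auto
  qed
  have ball_dense: "ball 0 r \<subseteq> closure (O' B)" for B
  proof
    fix \<mu> :: complex assume \<mu>: "\<mu> \<in> ball 0 r"
    show "\<mu> \<in> closure (O' B)" unfolding closure_approachable
    proof (intro allI impI)
      fix \<delta> :: real assume \<delta>: "\<delta> > 0"
      define \<delta>' where "\<delta>' = min \<delta> (r - norm \<mu>)"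
      have \<delta>': "\<delta>' > 0" "\<delta>' \<le> \<delta>" "\<delta>' \<le> r - norm \<mu>" using \<delta> \<mu> by (auto simp: \<delta>'_def)
      obtain L where L: "L \<in> LL" "L > max (max B L0) (4 / (\<delta>' * \<bar>d c1\<bar>))" using LL(1) by blast
      have Lpos: "L > 0" using L0[of L] L by auto
      \<comment> \<open>An imaginary shift of \<mu> by t rotates \<zeta> by the angle L d(c1) t and
        keeps its modulus. As L grows, an arbitrarily small shift makes \<zeta> a positive real
        number.\<close>
      define t where "t = Arg (\<zeta> L \<mu>) / (L * d c1)"
      have "\<bar>t\<bar> = \<bar>Arg (\<zeta> L \<mu>)\<bar> / (L * \<bar>d c1\<bar>)" using Lpos by (simp add: t_def abs_mult)
      also have "\<dots> \<le> 4 / (L * \<bar>d c1\<bar>)"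
        using mpi_less_Arg[of "\<zeta> L \<mu>"] Arg_le_pi[of "\<zeta> L \<mu>"] pi_less_4 Lpos by (intro divide_right_mono) auto
      also have "\<dots> < \<delta>'"
      proof -
        have "4 / (\<delta>' * \<bar>d c1\<bar>) < L" using L by simp
        thus ?thesis using Lpos \<delta>' c1(3) by (simp add: field_simps)
      qed
      finally have t: "\<bar>t\<bar> < \<delta>'" .
      define \<mu>' where "\<mu>' = \<mu> + \<i> * of_real t"
      have dist: "norm (\<mu>' - \<mu>) < \<delta>'" using t by (simp add: \<mu>'_def norm_mult)
      have "norm \<mu>' \<le> norm \<mu> + norm (\<mu>' - \<mu>)" using norm_triangle_ineq[of \<mu> "\<mu>' - \<mu>"] by simp
      hence "\<mu>' \<in> S" using dist \<delta>' by (simp add: S_def)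
      have "\<zeta> L \<mu>' = \<zeta> L \<mu> * exp (- (\<i> * of_real (L * d c1 * t)))"
        by (simp add: \<zeta>_def ee_def \<mu>'_def exp_add[symmetric] exp_diff[symmetric] algebra_simps)
      also have "L * d c1 * t = Arg (\<zeta> L \<mu>)" using Lpos c1(3) by (simp add: t_def)
      also have "\<zeta> L \<mu> * exp (- (\<i> * of_real (Arg (\<zeta> L \<mu>)))) = of_real (norm (\<zeta> L \<mu>))"
      proof -
        have "\<zeta> L \<mu> \<noteq> 0" using n\<zeta>[of L \<mu>] e1 m by auto
        hence "\<zeta> L \<mu> = of_real (norm (\<zeta> L \<mu>)) * exp (\<i> * of_real (Arg (\<zeta> L \<mu>)))" by (rule Arg_eq)
        hence "\<zeta> L \<mu> * exp (- (\<i> * of_real (Arg (\<zeta> L \<mu>)))) =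
          of_real (norm (\<zeta> L \<mu>)) * (exp (\<i> * of_real (Arg (\<zeta> L \<mu>))) * exp (- (\<i> * of_real (Arg (\<zeta> L \<mu>)))))"
          by (metis mult.assoc)
        thus ?thesis by (simp add: exp_minus_inverse)
      qed
      finally have "\<zeta> L \<mu>' = of_real (norm (\<zeta> L \<mu>))" .
      moreover have "norm (\<zeta> L \<mu>) > 0" using n\<zeta>[of L \<mu>] e1 m by simp
      ultimately have "al L \<mu>'" by (simp add: al_def)
      hence "\<mu>' \<in> O' B" using L \<open>\<mu>' \<in> S\<close> by (auto simp: O'_def)
      thus "\<exists>y\<in>O' B. dist y \<mu> < \<delta>" using dist \<delta>' by (intro bexI[of _ \<mu>']) (auto simp: dist_norm)
    qed
  qed
  have dO: "S \<subseteq> closure (O' B)" for B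
    using closure_mono[OF ball_dense[of B]] r(1) by (simp add: S_def)
  define GG where "GG = insert S (range (\<lambda>k::nat. O' (real k)) \<union> (\<lambda>\<mu>. S - {\<mu>}) ` Cb)"
  have "S \<subseteq> closure (\<Inter>GG)"
  proof (rule Baire)
    show "closed S" by (simp add: S_def)
    show "countable GG" using cCb by (auto simp: GG_def)
    fix T assume "T \<in> GG"
    then consider "T = S" | k where "T = O' (real k)" | \<mu> where "T = S - {\<mu>}" by (auto simp: GG_def)
    thus "openin (top_of_set S) T \<and> S \<subseteq> closure T"
    proof cases
      case 1 thus ?thesis using closure_subset by auto
    next
      case 2 thus ?thesis using oO dO by simp
    next
      case 3
      have "openin (top_of_set S) (S - {\<mu>})"
        by (metis Diff_eq Int_commute closed_singleton open_Compl openin_open_Int)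
      moreover have "S \<subseteq> closure (S - {\<mu>})"
      proof (cases "\<mu> \<in> S")
        case True
        have "0 \<in> S" "of_real r \<in> S" "of_real r \<noteq> (0::complex)" using r(1) by (auto simp: S_def)
        hence "\<nexists>z. S = {z}" by blast
        hence "\<mu> islimpt S" using connected_imp_perfect[of S \<mu>] True by (simp add: S_def)
        hence "\<mu> \<in> closure (S - {\<mu>})" by (simp add: islimpt_in_closure)
        thus ?thesis using closure_subset[of "S - {\<mu>}"] by auto
      next
        case False
        thus ?thesis using closure_subset[of S] by simp
      qed
      ultimately show ?thesis using 3 by simp
    qed
  qed
  hence "\<Inter>GG \<noteq> {}" using r(1) by (auto simp: S_def)
  then obtain \<mu> where \<mu>: "\<mu> \<in> \<Inter>GG" by blast
  have \<mu>S: "\<mu> \<in> S" using \<mu> by (auto simp: GG_def)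
  have \<mu>Cb: "\<mu> \<notin> Cb" using \<mu> by (auto simp: GG_def)
  have \<mu>r: "norm \<mu> \<le> r" using \<mu>S by (simp add: S_def)
  show ?thesis
  proof (intro exI[of _ \<mu>] conjI allI)
    show "norm \<mu> < \<epsilon>" using \<mu>r r by simp
    fix B :: real
    obtain k :: nat where k: "real k > B" using reals_Archimedean2 by blast
    have "\<mu> \<in> O' (real k)" using \<mu> by (auto simp: GG_def)
    then obtain L where L: "L \<in> LL" "L > real k" "L \<ge> L0" "al L \<mu>" by (auto simp: O'_def)
    obtain u where u: "norm (u - u0) < \<rho>" "Phi L \<mu> u = 0" using exists[OF L(3) \<mu>r] by blast
    have "Re u > 0"
    proof -
      have "\<bar>Re (u - u0 - \<zeta> L \<mu>)\<bar> \<le> norm (\<zeta> L \<mu>) / 2"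
        using asymp[OF L(3) \<mu>r u] abs_Re_le_cmod order_trans by blast
      hence "\<bar>Re u - Re u0 - Re (\<zeta> L \<mu>)\<bar> \<le> norm (\<zeta> L \<mu>) / 2" by simp
      thus ?thesis using L(4) u0 unfolding al_def by linarith
    qed
    moreover have "y + \<mu> * y' + u * y'' \<noteq> 0" if "(y, y', y'') \<in> bad L" for y y' y''
    proof
      assume "y + \<mu> * y' + u * y'' = 0"
      hence "\<mu> \<in> Bd L (y, y', y'')" using u \<mu>S by (auto simp: Bd_def)
      thus False using that L \<mu>Cb unfolding Cb_def by blast
    qed
    ultimately show "\<exists>L\<in>LL. B < L \<and> (\<exists>u. norm (u - u0) < \<rho>0 \<and> 0 < Re u \<and> Phi L \<mu> u = 0 \<and> (\<forall>(y, y', y'')\<in>bad L. y + \<mu> * y' + u * y'' \<noteq> 0))"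
      using L k u \<rho>(2) by (intro bexI[of _ L] conjI exI[of _ u]) auto
  qed
qed

text \<open>Moving the base point along the line separates the exponents, so that one term dominates.\<close>

lemma perturbed_zero:
  fixes E0 :: "complex \<Rightarrow> complex" and E :: "'k \<Rightarrow> complex \<Rightarrow> complex" and x :: "'k \<Rightarrow> complex"
    and d :: "'k \<Rightarrow> real" and bad :: "real \<Rightarrow> (complex \<times> complex \<times> complex) set"
  assumes K: "finite K" and hol: "E0 holomorphic_on UNIV" "\<And>c. c \<in> K \<Longrightarrow> E c holomorphic_on UNIV"
    and E0: "E0 u0 = 0" "deriv E0 u0 \<noteq> 0" and u0: "Re u0 \<ge> 0"
    and x: "\<And>c. c \<in> K \<Longrightarrow> Re (x c) > 0"
    and d: "inj_on d K" "\<And>c. c \<in> K \<Longrightarrow> d c \<noteq> 0" and ex: "\<exists>c\<in>K. E c u0 \<noteq> 0"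
    and LL: "\<And>B. \<exists>L\<in>LL. L > B" "countable LL"
    and bad: "\<And>L. L \<in> LL \<Longrightarrow> countable (bad L)"
      "\<And>L y y' y''. L \<in> LL \<Longrightarrow> (y, y', y'') \<in> bad L \<Longrightarrow> y' \<noteq> 0 \<or> y'' \<noteq> 0"
    and pos: "\<epsilon> > 0" "\<rho>0 > 0"
  shows "\<exists>\<mu>. norm \<mu> < \<epsilon> \<and> (\<forall>B. \<exists>L\<in>LL. L > B \<and> (\<exists>u. norm (u - u0) < \<rho>0 \<and> Re u > 0 \<and>
           E0 u + (\<Sum>c\<in>K. exp (- (of_real L * (x c + \<mu> * of_real (d c)))) * E c u) = 0 \<and>
           (\<forall>(y, y', y'')\<in>bad L. y + \<mu> * y' + u * y'' \<noteq> 0)))"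
proof -
  have "eventually (\<lambda>t. \<forall>c\<in>K. Re (x c) + t * d c > 0) (at_right (0::real))"
  proof (intro eventually_ball_finite K ballI)
    fix c assume c: "c \<in> K"
    have "((\<lambda>t. Re (x c) + t * d c) \<longlongrightarrow> Re (x c) + 0 * d c) (at_right 0)"
      by (intro tendsto_intros)
    thus "eventually (\<lambda>t. Re (x c) + t * d c > 0) (at_right (0::real))"
      using x[OF c] by (intro order_tendstoD(1)[of _ "Re (x c)"]) auto
  qed
  moreover have "eventually (\<lambda>t. t < \<epsilon> / 2) (at_right (0::real))"
    by (rule eventually_mono[OF eventually_at_right_real[of 0 "\<epsilon> / 2"]]) (use pos in auto)
  ultimately have "eventually (\<lambda>t. (\<forall>c\<in>K. Re (x c) + t * d c > 0) \<and> t < \<epsilon> / 2) (at_right (0::real))"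
    by (rule eventually_conj)
  then obtain b where b: "b > 0" "\<And>t. 0 < t \<Longrightarrow> t < b \<Longrightarrow> (\<forall>c\<in>K. Re (x c) + t * d c > 0) \<and> t < \<epsilon> / 2"
    by (auto simp: eventually_at_right_field)
  \<comment> \<open>The shifts at which two exponents get the same real part. The diagonal
    contributes only x / 0 = 0, which is outside the interval for t.\<close>
  define Ex where "Ex = (\<lambda>(c, c'). (Re (x c') - Re (x c)) / (d c - d c')) ` (K \<times> K)"
  have "finite Ex" unfolding Ex_def using K by auto
  moreover have "infinite {0<..<b}" using b(1) by (simp add: infinite_Ioo)
  ultimately obtain t where t: "t \<in> {0<..<b}" "t \<notin> Ex"
    by (meson finite_subset subsetI)
  define x' where "x' = (\<lambda>c. x c + of_real t * of_real (d c))"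
  have Rx': "Re (x' c) = Re (x c) + t * d c" for c by (simp add: x'_def)
  have dist: "Re (x' c) \<noteq> Re (x' c')" if "c \<in> K" "c' \<in> K" "c \<noteq> c'" for c c'
  proof
    assume "Re (x' c) = Re (x' c')"
    hence "t * (d c - d c') = Re (x c') - Re (x c)" by (simp add: Rx' algebra_simps)
    moreover have "d c - d c' \<noteq> 0" using d(1) that by (auto simp: inj_on_def)
    ultimately have "t = (Re (x c') - Re (x c)) / (d c - d c')" by (simp add: field_simps)
    thus False using t(2) that by (auto simp: Ex_def)
  qed
  define K1 where "K1 = {c\<in>K. E c u0 \<noteq> 0}"
  have K1: "finite K1" "K1 \<noteq> {}" using K ex by (auto simp: K1_def)
  obtain c1 where c1: "c1 \<in> K1" "\<And>c. c \<in> K1 \<Longrightarrow> Re (x' c1) \<le> Re (x' c)"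
    using arg_min_if_finite(1)[OF K1, of "\<lambda>c. Re (x' c)"] arg_min_least[OF K1, of _ "\<lambda>c. Re (x' c)"] by blast
  \<comment> \<open>The shift by t is absorbed into the constant term of each linear
    relation.\<close>
  define bad' where "bad' = (\<lambda>L. (\<lambda>(y, y', y''). (y + of_real t * y', y', y'')) ` bad L)"
  have "\<exists>\<mu>. norm \<mu> < \<epsilon> / 2 \<and> (\<forall>B. \<exists>L\<in>LL. L > B \<and> (\<exists>u. norm (u - u0) < \<rho>0 \<and> Re u > 0 \<and>
           E0 u + (\<Sum>c\<in>K. exp (- (of_real L * (x' c + \<mu> * of_real (d c)))) * E c u) = 0 \<and>
           (\<forall>(y, y', y'')\<in>bad' L. y + \<mu> * y' + u * y'' \<noteq> 0)))"
  proof (rule perturbed_zero_aux[OF K hol E0 u0 _ _ _ _ _ LL])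
    show "Re (x' c) > 0" if "c \<in> K" for c using b(2)[of t] t that by (simp add: Rx')
    show "c1 \<in> K" "E c1 u0 \<noteq> 0" using c1 by (auto simp: K1_def)
    thus "d c1 \<noteq> 0" using d by auto
    show "Re (x' c1) < Re (x' c)" if "c \<in> K" "c \<noteq> c1" "E c u0 \<noteq> 0" for c
      using c1(2)[of c] dist[of c c1] that c1(1) by (auto simp: K1_def)
    show "countable (bad' L)" if "L \<in> LL" for L unfolding bad'_def using bad(1)[OF that] by simp
    show "y' \<noteq> 0 \<or> y'' \<noteq> 0" if "L \<in> LL" "(y, y', y'') \<in> bad' L" for L y y' y''
      using bad(2)[OF that(1)] that(2) by (auto simp: bad'_def)
  qed (use pos in auto)
  then obtain \<mu> where \<mu>: "norm \<mu> < \<epsilon> / 2" "\<And>B. \<exists>L\<in>LL. L > B \<and> (\<exists>u. norm (u - u0) < \<rho>0 \<and> Re u > 0 \<and>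
           E0 u + (\<Sum>c\<in>K. exp (- (of_real L * (x' c + \<mu> * of_real (d c)))) * E c u) = 0 \<and>
           (\<forall>(y, y', y'')\<in>bad' L. y + \<mu> * y' + u * y'' \<noteq> 0))" by blast
  show ?thesis
  proof (intro exI[of _ "of_real t + \<mu>"] conjI allI)
    have "norm (of_real t + \<mu>) \<le> \<bar>t\<bar> + norm \<mu>" using norm_triangle_ineq[of "of_real t" \<mu>] by simp
    also have "\<dots> < \<epsilon>" using \<mu>(1) b(2)[of t] t by auto
    finally show "norm (of_real t + \<mu>) < \<epsilon>" .
    fix B
    obtain L u where L: "L \<in> LL" "L > B" "norm (u - u0) < \<rho>0" "Re u > 0"
      "E0 u + (\<Sum>c\<in>K. exp (- (of_real L * (x' c + \<mu> * of_real (d c)))) * E c u) = 0"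
      "\<forall>(y, y', y'')\<in>bad' L. y + \<mu> * y' + u * y'' \<noteq> 0" using \<mu>(2)[of B] by blast
    have "x' c + \<mu> * of_real (d c) = x c + (of_real t + \<mu>) * of_real (d c)" for c
      by (simp add: x'_def algebra_simps)
    hence eq: "E0 u + (\<Sum>c\<in>K. exp (- (of_real L * (x c + (of_real t + \<mu>) * of_real (d c)))) * E c u) = 0"
      using L(5) by simp
    have "y + (of_real t + \<mu>) * y' + u * y'' \<noteq> 0" if "(y, y', y'') \<in> bad L" for y y' y''
    proof -
      have "(y + of_real t * y', y', y'') \<in> bad' L" unfolding bad'_def using that by force
      thus ?thesis using L(6) by (auto simp: algebra_simps)
    qed
    thus "\<exists>L\<in>LL. B < L \<and> (\<exists>u. cmod (u - u0) < \<rho>0 \<and> 0 < Re u \<and>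
        E0 u + (\<Sum>c\<in>K. exp (- (of_real L * (x c + (of_real t + \<mu>) * of_real (d c)))) * E c u) = 0 \<and>
        (\<forall>(y, y', y'')\<in>bad L. y + (of_real t + \<mu>) * y' + u * y'' \<noteq> 0))"
      using L eq by (intro bexI[of _ L] conjI exI[of _ u]) auto
  qed
qed

section \<open>Geometry of a face\<close>

definition rvec :: "nat ^ 'n \<Rightarrow> real ^ ('n::finite)" where
  "rvec \<beta> = (\<chi> l. real (\<beta> $ l))"

definition cvec :: "real ^ 'n \<Rightarrow> complex ^ ('n::finite)" where
  "cvec \<sigma> = (\<chi> l. complex_of_real (\<sigma> $ l))"

lemma rvec_nth [simp]: "rvec \<beta> $ l = real (\<beta> $ l)" by (simp add: rvec_def)

lemma rvec_eq_0_iff [simp]: "rvec \<beta> = 0 \<longleftrightarrow> \<beta> = 0"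
  by (simp add: vec_eq_iff)

lemma sdot_cvec: "sdot (cvec \<sigma>) \<beta> = complex_of_real (\<sigma> \<bullet> rvec \<beta>)"
  by (simp add: sdot_def cvec_def inner_vec_def)

text \<open>Countably many hyperplanes form a null set.\<close>

lemma exists_generic_vector:
  fixes Y :: "(real ^ 'n::finite) set"
  assumes "countable Y" "0 \<notin> Y"
  shows "\<exists>x. \<forall>y\<in>Y. y \<bullet> x \<noteq> 0"
proof -
  have "negligible (\<Union>y\<in>Y. {x. y \<bullet> x = 0})"
    by (rule negligible_countable_Union) (use assms in \<open>auto intro!: negligible_hyperplane\<close>)
  hence "(\<Union>y\<in>Y. {x. y \<bullet> x = 0}) \<noteq> UNIV" by auto
  thus ?thesis by auto
qed

text \<open>All differences of exponents are projected orthogonally to w; a vector not orthogonal to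
  any of the countably many nonzero projections, itself projected, is the required
  direction.\<close>

lemma exists_generic_direction:
  fixes w :: "nat ^ 'n::finite"
  assumes "w \<noteq> 0"
  obtains \<Delta> :: "real ^ 'n" where "\<Delta> \<bullet> rvec w = 0"
    "\<And>\<beta> \<beta>'. \<Delta> \<bullet> rvec \<beta> = \<Delta> \<bullet> rvec \<beta>' \<Longrightarrow> \<exists>t. rvec \<beta> - rvec \<beta>' = t *\<^sub>R rvec w"
proof -
  define W where "W = rvec w"
  have WW: "W \<bullet> W \<noteq> 0" using assms by (simp add: W_def)
  define pr where "pr = (\<lambda>y. y - ((y \<bullet> W) / (W \<bullet> W)) *\<^sub>R W)"
  define Y where "Y = range (\<lambda>(\<beta>, \<beta>'). pr (rvec \<beta> - rvec \<beta>')) - {0}"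
  have "countable Y" "0 \<notin> Y" unfolding Y_def by (auto intro: countable_Diff)
  from exists_generic_vector[OF this] obtain x where x: "\<forall>y\<in>Y. y \<bullet> x \<noteq> 0" by blast
  have sym: "pr x \<bullet> y = x \<bullet> pr y" for y
    by (simp add: pr_def inner_diff_left inner_diff_right inner_commute mult.commute)
  show ?thesis
  proof (rule that[of "pr x"])
    show "pr x \<bullet> rvec w = 0" using WW by (simp add: pr_def W_def[symmetric] inner_diff_left)
    fix \<beta> \<beta>' assume "pr x \<bullet> rvec \<beta> = pr x \<bullet> rvec \<beta>'"
    hence "pr (rvec \<beta> - rvec \<beta>') \<bullet> x = 0" using sym[of "rvec \<beta> - rvec \<beta>'"] by (simp add: inner_diff_right inner_commute)
    moreover have "pr (rvec \<beta> - rvec \<beta>') \<in> Y \<or> pr (rvec \<beta> - rvec \<beta>') = 0" by (auto simp: Y_def)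
    ultimately have "pr (rvec \<beta> - rvec \<beta>') = 0" using x by auto
    thus "\<exists>t. rvec \<beta> - rvec \<beta>' = t *\<^sub>R rvec w" by (auto simp: pr_def W_def)
  qed
qed

section \<open>Primitive integer vectors\<close>

lemma bezout_vec:
  fixes w :: "nat ^ 'n::finite"
  shows "finite I \<Longrightarrow> \<exists>v. (\<Sum>l\<in>I. v l * int (w $ l)) = int (Gcd ((\<lambda>l. w $ l) ` I))"
proof (induction I rule: finite_induct)
  case (insert l I)
  then obtain v where v: "(\<Sum>l\<in>I. v l * int (w $ l)) = int (Gcd ((\<lambda>l. w $ l) ` I))" by blast
  obtain x y where xy: "x * int (w $ l) + y * int (Gcd ((\<lambda>l. w $ l) ` I)) = gcd (int (w $ l)) (int (Gcd ((\<lambda>l. w $ l) ` I)))"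
    using bezout_int by blast
  have "(\<Sum>k\<in>insert l I. (if k = l then x else y * v k) * int (w $ k)) =
      x * int (w $ l) + (\<Sum>k\<in>I. (if k = l then x else y * v k) * int (w $ k))"
    using insert by simp
  also have "(\<Sum>k\<in>I. (if k = l then x else y * v k) * int (w $ k)) = (\<Sum>k\<in>I. y * (v k * int (w $ k)))"
    by (rule sum.cong[OF refl]) (use insert in auto)
  also have "\<dots> = y * int (Gcd ((\<lambda>l. w $ l) ` I))" by (simp only: v sum_distrib_left[symmetric])
  also have "x * int (w $ l) + \<dots> = int (Gcd ((\<lambda>l. w $ l) ` insert l I))"
    unfolding xy by (simp only: Gcd_insert image_insert gcd_int_int_eq)
  finally show ?case by (rule exI[of _ "\<lambda>k. if k = l then x else y * v k"])
qed auto

definition vgcd :: "nat ^ 'n \<Rightarrow> nat" where "vgcd \<beta> = Gcd (range (\<lambda>l. \<beta> $ l))"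

lemma Gcd_nonzero_components: "Gcd {\<beta> $ l | l. \<beta> $ l \<noteq> 0} = vgcd (\<beta> :: nat ^ 'n)"
proof -
  have "range (\<lambda>l. \<beta> $ l) - {0} = {\<beta> $ l | l. \<beta> $ l \<noteq> 0}" by auto
  moreover have "Gcd (range (\<lambda>l. \<beta> $ l) - {0}) = Gcd (range (\<lambda>l. \<beta> $ l))" by (rule Gcd_remove0_nat[symmetric])
  ultimately show ?thesis by (simp add: vgcd_def)
qed

lemma vgcd_scale: "(\<And>l. \<beta> $ l = k * \<gamma> $ l) \<Longrightarrow> vgcd \<beta> = k * vgcd \<gamma>"
proof -
  assume "\<And>l. \<beta> $ l = k * \<gamma> $ l"
  hence "range (\<lambda>l. \<beta> $ l) = (*) k ` range (\<lambda>l. \<gamma> $ l)" by auto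
  thus ?thesis unfolding vgcd_def by (simp only: Gcd_mult) simp
qed

lemma vgcd_dvd: "vgcd \<beta> dvd \<beta> $ l"
  unfolding vgcd_def by (rule Gcd_dvd) simp

lemma vgcd_pos: "\<beta> \<noteq> 0 \<Longrightarrow> vgcd \<beta> > 0"
  using vgcd_dvd[of \<beta>] by (metis dvd_0_left gr0I vec_eq_iff zero_index)

text \<open>For uniqueness, a rational multiple is written as q v = p \<beta>. Comparing the
  greatest common divisors of both sides gives q = p times the gcd of \<beta>.\<close>

lemma primitive_vec:
  fixes \<beta> :: "nat ^ 'n::finite"
  assumes "\<beta> \<noteq> 0"
  shows "primitive_vec \<beta> = (\<chi> l. \<beta> $ l div vgcd \<beta>)"
  unfolding primitive_vec_def
proof (rule the_equality)
  let ?g = "vgcd \<beta>"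
  have g: "?g > 0" by (rule vgcd_pos[OF assms])
  have eq: "\<beta> $ l = ?g * (\<beta> $ l div ?g)" for l using vgcd_dvd[of \<beta> l] by simp
  show "(\<exists>c::rat. c > 0 \<and> (\<forall>l. of_nat ((\<chi> l. \<beta> $ l div ?g) $ l) = c * of_nat (\<beta> $ l))) \<and>
          Gcd {(\<chi> l. \<beta> $ l div ?g) $ l | l. (\<chi> l. \<beta> $ l div ?g) $ l \<noteq> 0} = 1"
  proof
    have "of_nat (\<beta> $ l div ?g) = (1 / of_nat ?g :: rat) * of_nat (\<beta> $ l)" for l
      using g arg_cong[OF eq[of l], of "of_nat :: nat \<Rightarrow> rat"] by (simp add: field_simps)
    thus "\<exists>c::rat. c > 0 \<and> (\<forall>l. of_nat ((\<chi> l. \<beta> $ l div ?g) $ l) = c * of_nat (\<beta> $ l))"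
      using g by (intro exI[of _ "1 / of_nat ?g"]) simp
    have "?g = ?g * vgcd (\<chi> l. \<beta> $ l div ?g)" by (rule vgcd_scale) (use eq in simp)
    thus "Gcd {(\<chi> l. \<beta> $ l div ?g) $ l | l. (\<chi> l. \<beta> $ l div ?g) $ l \<noteq> 0} = 1"
      using g unfolding Gcd_nonzero_components by simp
  qed
  fix v :: "nat ^ 'n"
  assume v: "(\<exists>c::rat. c > 0 \<and> (\<forall>l. of_nat (v $ l) = c * of_nat (\<beta> $ l))) \<and> Gcd {v $ l |l. v $ l \<noteq> 0} = 1"
  then obtain c :: rat where c: "c > 0" "\<And>l. of_nat (v $ l) = c * of_nat (\<beta> $ l)" by blast
  obtain p q where "quotient_of c = (p, q)" by (cases "quotient_of c")
  hence pq: "c = of_int p / of_int q" "q > 0" using quotient_of_div quotient_of_denom_pos by blast+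
  have "p > 0" using c(1) pq by (simp add: zero_less_divide_iff)
  have "of_int (q * int (v $ l)) = (of_int (p * int (\<beta> $ l)) :: rat)" for l
    using c(2)[of l] pq by (simp add: field_simps)
  hence rel: "q * int (v $ l) = p * int (\<beta> $ l)" for l by (simp only: of_int_eq_iff)
  have nrel: "nat q * v $ l = nat p * \<beta> $ l" for l
    using arg_cong[OF rel[of l], of nat] \<open>p > 0\<close> pq(2) by (simp add: nat_mult_distrib)
  define \<mu> where "\<mu> = (\<chi> l. nat q * v $ l)"
  have "vgcd \<mu> = nat q * vgcd v" by (rule vgcd_scale) (simp add: \<mu>_def)
  moreover have "vgcd \<mu> = nat p * vgcd \<beta>" by (rule vgcd_scale) (simp add: \<mu>_def nrel)
  moreover have "vgcd v = 1" using v Gcd_nonzero_components[of v] by simp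
  ultimately have "nat q = nat p * ?g" by simp
  hence "nat p * ?g * v $ l = nat p * \<beta> $ l" for l using nrel[of l] by simp
  hence "?g * v $ l = \<beta> $ l" for l using \<open>p > 0\<close> by (simp add: mult.assoc)
  hence "v $ l = \<beta> $ l div ?g" for l using g by (metis nonzero_mult_div_cancel_left not_gr0)
  thus "v = (\<chi> l. \<beta> $ l div ?g)" by (simp add: vec_eq_iff)
qed

section \<open>The relative interior of a face\<close>

lemma closure_W_0: "closure (W r \<alpha> 0 :: (complex ^ 'n::finite) set) \<subseteq> {s. \<forall>j\<in>{1..r}. Re (sdot s (\<alpha> j)) \<ge> 0}"
proof (rule closure_minimal)
  show "W r \<alpha> 0 \<subseteq> {s. \<forall>j\<in>{1..r}. Re (sdot s (\<alpha> j)) \<ge> 0}" by (auto simp: W_def less_imp_le)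
  have "{s. \<forall>j\<in>{1..r}. Re (sdot s (\<alpha> j)) \<ge> 0} = (\<Inter>j\<in>{1..r}. {s. Re (sdot s (\<alpha> j)) \<ge> 0})" by auto
  also have "closed \<dots>"
    by (intro closed_INT ballI closed_Collect_le continuous_intros) (simp add: sdot_def continuous_intros)
  finally show "closed {s. \<forall>j\<in>{1..r}. Re (sdot s (\<alpha> j)) \<ge> 0}" .
qed

text \<open>If an exponent not parallel to the normal vanished on the whole face, the face would lie
  in the intersection of two distinct hyperplanes and have codimension two. So each such exponent is
  positive at some point of the face, and the sum of these points serves all of them.\<close>

lemma face_interior:
  fixes \<alpha> :: "nat \<Rightarrow> nat ^ 'n::finite"
  assumes nz: "\<And>j. j \<in> {1..r} \<Longrightarrow> \<alpha> j \<noteq> 0" and face: "is_face r \<alpha> e"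
  obtains \<sigma> :: "real ^ 'n" where "\<sigma> \<bullet> rvec (\<alpha> e) = 0"
    "\<And>j. j \<in> {1..r} \<Longrightarrow> (\<nexists>t. rvec (\<alpha> j) = t *\<^sub>R rvec (\<alpha> e)) \<Longrightarrow> \<sigma> \<bullet> rvec (\<alpha> j) > 0"
proof -
  have e: "e \<in> {1..r}" using face by (simp add: is_face_def)
  define S where "S = {\<sigma> :: real ^ 'n. cvec \<sigma> \<in> face_set r \<alpha> e}"
  have dimS: "aff_dim S = int CARD('n) - 1"
    using face by (simp add: is_face_def S_def cvec_def)
  note closure_W_0[of r \<alpha>]
  hence S1: "\<sigma> \<bullet> rvec (\<alpha> j) \<ge> 0" if "\<sigma> \<in> S" "j \<in> {1..r}" for \<sigma> j
    using that by (force simp: S_def face_set_def sdot_cvec)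
  have S2: "rvec (\<alpha> e) \<bullet> \<sigma> = 0" if "\<sigma> \<in> S" for \<sigma>
    using that by (simp add: S_def face_set_def sdot_cvec inner_commute)
  define J where "J = {j\<in>{1..r}. \<nexists>t. rvec (\<alpha> j) = t *\<^sub>R rvec (\<alpha> e)}"
  have "\<exists>\<sigma>\<in>S. \<sigma> \<bullet> rvec (\<alpha> j) > 0" if j: "j \<in> J" for j
  proof (rule ccontr)
    assume "\<not> ?thesis"
    hence z: "rvec (\<alpha> j) \<bullet> \<sigma> = 0" if "\<sigma> \<in> S" for \<sigma>
      using S1[OF that, of j] that j by (force simp: J_def inner_commute)
    define A where "A = rvec (\<alpha> e)"
    define B where "B = rvec (\<alpha> j)"
    have A: "A \<noteq> 0" using nz[OF e] by (simp add: A_def)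
    define T0 where "T0 = {x. A \<bullet> x = 0}"
    have dT0: "aff_dim T0 = int CARD('n) - 1" unfolding T0_def using A by (simp add: aff_dim_hyperplane)
    define x where "x = B - ((A \<bullet> B) / (A \<bullet> A)) *\<^sub>R A"
    have "x \<in> T0" using A by (simp add: T0_def x_def inner_diff_right)
    have "\<not> T0 \<subseteq> {v. B \<bullet> v = 0}"
    proof
      assume "T0 \<subseteq> {v. B \<bullet> v = 0}"
      hence "B \<bullet> x = 0" "A \<bullet> x = 0" using \<open>x \<in> T0\<close> by (auto simp: T0_def)
      hence "x \<bullet> x = 0" by (subst x_def) (simp add: inner_diff_left)
      hence "B = ((A \<bullet> B) / (A \<bullet> A)) *\<^sub>R A" by (simp add: x_def)
      thus False using j by (auto simp: J_def A_def B_def)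
    qed
    moreover have "0 \<in> T0 \<inter> {v. B \<bullet> v = 0}" by (simp add: T0_def)
    moreover have "affine T0" unfolding T0_def by (rule affine_hyperplane)
    ultimately have "aff_dim (T0 \<inter> {v. B \<bullet> v = 0}) = aff_dim T0 - 1"
      using aff_dim_affine_Int_hyperplane[of T0 B 0] by auto
    moreover have "S \<subseteq> T0 \<inter> {v. B \<bullet> v = 0}" using z S2 by (auto simp: T0_def A_def B_def)
    hence "aff_dim S \<le> aff_dim (T0 \<inter> {v. B \<bullet> v = 0})" by (rule aff_dim_subset)
    ultimately show False using dimS dT0 by simp
  qed
  then obtain \<tau> where \<tau>: "\<And>j. j \<in> J \<Longrightarrow> \<tau> j \<in> S \<and> \<tau> j \<bullet> rvec (\<alpha> j) > 0" by metis
  have finJ: "finite J" by (simp add: J_def)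
  show ?thesis
  proof (rule that[of "\<Sum>j\<in>J. \<tau> j"])
    show "(\<Sum>j\<in>J. \<tau> j) \<bullet> rvec (\<alpha> e) = 0"
      using S2 \<tau> by (simp add: inner_sum_left inner_commute)
    fix j assume j: "j \<in> {1..r}" "\<nexists>t. rvec (\<alpha> j) = t *\<^sub>R rvec (\<alpha> e)"
    hence jJ: "j \<in> J" by (simp add: J_def)
    have "0 < (\<Sum>i\<in>J. \<tau> i \<bullet> rvec (\<alpha> j))"
      by (rule sum_pos2[OF finJ jJ]) (use \<tau> S1 j jJ in auto)
    thus "(\<Sum>j\<in>J. \<tau> j) \<bullet> rvec (\<alpha> j) > 0" by (simp add: inner_sum_left)
  qed
qed

section \<open>Zeros of the Euler factors near a face\<close>

text \<open>The lattice vector \<open>w\<close> spans the normal of the face; \<open>v\<close> is an integral vector dual to \<open>w\<close>, and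
  \<open>\<Delta>\<close> a generic direction in the face. Exponents are classified by their pairing with \<open>\<Delta>\<close>: two
  exponents have the same pairing iff they differ by a multiple of \<open>w\<close>.\<close>

locale face_frame =
  fixes r :: nat and a :: "nat \<Rightarrow> int" and \<alpha> :: "nat \<Rightarrow> nat ^ ('n::finite)"
    and w :: "nat ^ 'n" and v :: "'n \<Rightarrow> int" and \<Delta> :: "real ^ 'n"
  assumes inj: "inj_on \<alpha> {1..r}" and nz: "\<And>j. j \<in> {1..r} \<Longrightarrow> \<alpha> j \<noteq> 0"
    and bez: "(\<Sum>l\<in>UNIV. v l * int (w $ l)) = 1"
    and Dw: "\<Delta> \<bullet> rvec w = 0"
    and gen: "\<And>\<beta> \<beta>'. \<Delta> \<bullet> rvec \<beta> = \<Delta> \<bullet> rvec \<beta>' \<Longrightarrow> \<exists>t. rvec \<beta> - rvec \<beta>' = t *\<^sub>R rvec w"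
begin

section \<open>Coordinates of exponents and points in the frame\<close>

definition v_dot :: "nat ^ 'n \<Rightarrow> int" where "v_dot \<beta> = (\<Sum>l\<in>UNIV. v l * int (\<beta> $ l))"

definition Delta_dot :: "nat ^ 'n \<Rightarrow> real" where "Delta_dot \<beta> = \<Delta> \<bullet> rvec \<beta>"

definition v_vec :: "complex ^ 'n" where "v_vec = (\<chi> l. of_int (v l))"

lemma v_dot_w: "v_dot w = 1" using bez by (simp add: v_dot_def)

lemma Delta_dot_w: "Delta_dot w = 0" using Dw by (simp add: Delta_dot_def)

lemma Delta_dot_0 [simp]: "Delta_dot 0 = 0" by (simp add: Delta_dot_def rvec_def inner_vec_def)

lemma v_dot_0 [simp]: "v_dot 0 = 0" by (simp add: v_dot_def)

lemma sdot_v_vec: "sdot v_vec \<beta> = of_int (v_dot \<beta>)"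
  by (simp add: sdot_def v_vec_def v_dot_def)

lemma sdot_Delta: "sdot (cvec \<Delta>) \<beta> = of_real (Delta_dot \<beta>)"
  by (simp add: sdot_cvec Delta_dot_def)

text \<open>Genericity gives a real multiple of w, and pairing with the dual vector identifies the
  multiplier as an integer.\<close>

lemma same_class:
  assumes "Delta_dot \<beta> = Delta_dot \<beta>'"
  shows "int (\<beta> $ l) - int (\<beta>' $ l) = (v_dot \<beta> - v_dot \<beta>') * int (w $ l)"
proof -
  obtain t where t: "rvec \<beta> - rvec \<beta>' = t *\<^sub>R rvec w" using gen assms by (auto simp: Delta_dot_def)
  have tl: "real (\<beta> $ l) - real (\<beta>' $ l) = t * real (w $ l)" for l
    using arg_cong[OF t, of "\<lambda>x. x $ l"] by simp
  have "real_of_int (v_dot \<beta> - v_dot \<beta>') = (\<Sum>l\<in>UNIV. of_int (v l) * (real (\<beta> $ l) - real (\<beta>' $ l)))"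
    by (simp add: v_dot_def right_diff_distrib sum_subtractf)
  also have "\<dots> = t * real_of_int (\<Sum>l\<in>UNIV. v l * int (w $ l))"
    by (simp add: tl sum_distrib_left mult_ac)
  finally have "t = real_of_int (v_dot \<beta> - v_dot \<beta>')" using bez by simp
  hence "real_of_int (int (\<beta> $ l) - int (\<beta>' $ l)) = real_of_int ((v_dot \<beta> - v_dot \<beta>') * int (w $ l))"
    using tl[of l] by simp
  thus ?thesis by (simp only: of_int_eq_iff)
qed

lemma w_nonzero: "w \<noteq> 0" using v_dot_w by auto

lemma parallel:
  assumes "Delta_dot \<beta> = 0"
  shows "\<beta> $ l = nat (v_dot \<beta>) * w $ l" "v_dot \<beta> \<ge> 0" "\<beta> \<noteq> 0 \<Longrightarrow> v_dot \<beta> \<ge> 1"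
proof -
  have eq: "int (\<beta> $ l) = v_dot \<beta> * int (w $ l)" for l using same_class[of \<beta> 0 l] assms by simp
  obtain k where k: "w $ k \<noteq> 0" using w_nonzero by (auto simp: vec_eq_iff)
  show ge: "v_dot \<beta> \<ge> 0"
  proof (rule ccontr)
    assume "\<not> v_dot \<beta> \<ge> 0"
    hence "v_dot \<beta> * int (w $ k) < 0" using k by (intro mult_neg_pos) auto
    thus False using eq[of k] by simp
  qed
  show "\<beta> $ l = nat (v_dot \<beta>) * w $ l"
    using arg_cong[OF eq[of l], of nat] ge by (simp add: nat_mult_distrib)
  show "v_dot \<beta> \<ge> 1" if "\<beta> \<noteq> 0"
  proof (rule ccontr)
    assume "\<not> v_dot \<beta> \<ge> 1"
    hence "v_dot \<beta> = 0" using ge by simp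
    hence "\<beta> = 0" using eq by (simp add: vec_eq_iff)
    thus False using that by simp
  qed
qed

lemma class_dot:
  assumes "sdot b w = 0" "Delta_dot \<beta> = Delta_dot \<beta>'"
  shows "sdot b \<beta> = sdot b \<beta>'"
proof -
  have "sdot b \<beta> - sdot b \<beta>' = (\<Sum>l\<in>UNIV. b $ l * of_int (int (\<beta> $ l) - int (\<beta>' $ l)))"
    by (simp add: sdot_def sum_subtractf right_diff_distrib)
  also have "\<dots> = of_int (v_dot \<beta> - v_dot \<beta>') * sdot b w"
    unfolding same_class[OF assms(2)] by (simp add: sdot_def sum_distrib_left mult_ac)
  finally show ?thesis using assms(1) by simp
qed

definition exponent_class :: "real \<Rightarrow> nat set" where "exponent_class c = {j\<in>{1..r}. Delta_dot (\<alpha> j) = c}"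

definition K :: "real set" where "K = (\<lambda>j. Delta_dot (\<alpha> j)) ` {1..r} - {0}"

definition class_sum :: "real \<Rightarrow> complex \<Rightarrow> complex" where
  "class_sum c u = (\<Sum>j\<in>exponent_class c. of_int (a j) * exp (- (u * of_int (v_dot (\<alpha> j)))))"

definition E0 :: "complex \<Rightarrow> complex" where "E0 u = 1 + class_sum 0 u"

text \<open>The representative is immaterial when b pairs to 0 with w, since the members of a class
  differ by multiples of w.\<close>

definition class_exponent :: "complex ^ 'n \<Rightarrow> real \<Rightarrow> complex" where
  "class_exponent b c = sdot b (\<alpha> (SOME j. j \<in> exponent_class c))"

lemma class_exponent_eq:
  assumes "sdot b w = 0" "j \<in> exponent_class c"
  shows "class_exponent b c = sdot b (\<alpha> j)"
proof -
  have "(SOME j. j \<in> exponent_class c) \<in> exponent_class c" using assms(2) by (rule someI)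
  thus ?thesis unfolding class_exponent_def using assms by (intro class_dot) (auto simp: exponent_class_def)
qed

lemma finite_K: "finite K" by (simp add: K_def)

lemma K_exponent_class: "c \<in> K \<Longrightarrow> \<exists>j. j \<in> exponent_class c" by (auto simp: K_def exponent_class_def)

text \<open>For b pairing to 0 with w, the parameter z is the pairing of the point with w, and l
  moves the point without changing it. The sign of Re z therefore tells on which side of the face
  the point lies.\<close>

definition frame_point :: "complex ^ 'n \<Rightarrow> complex \<Rightarrow> complex \<Rightarrow> complex ^ 'n" where
  "frame_point b l z = b + l *s cvec \<Delta> + z *s v_vec"

lemma sdot_frame_point: "sdot (frame_point b l z) \<beta> = sdot b \<beta> + l * of_real (Delta_dot \<beta>) + z * of_int (v_dot \<beta>)"
  by (simp add: frame_point_def sdot_line sdot_v_vec sdot_Delta)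

text \<open>The coordinates \<open>v_dot\<close> are integers, so replacing z log p by u modulo
  2\<pi>i does not change the monomials. Each class other than that of 0 acquires a common
  exponential factor in log p.\<close>

lemma euler_factor_formula:
  assumes p: "prime p" and b: "sdot b w = 0" and z: "z = (u + 2 * pi * \<i> * of_int m) / of_real (ln (real p))"
  shows "euler_factor (h_poly r a \<alpha>) p (frame_point b l z) =
     E0 u + (\<Sum>c\<in>K. exp (- (of_real (ln (real p)) * (class_exponent b c + l * of_real c))) * class_sum c u)"
proof -
  define L where "L = complex_of_real (ln (real p))"
  have "real p > 1" using prime_gt_1_nat[OF p] by simp
  hence L0: "L \<noteq> 0" by (simp add: L_def)
  have Lz: "L * z = u + 2 * pi * \<i> * of_int m" using L0 by (simp add: z L_def)
  have trm: "mono_val (prime_point p (frame_point b l z)) (\<alpha> j) =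
      exp (- (L * (sdot b (\<alpha> j) + l * of_real (Delta_dot (\<alpha> j))))) * exp (- (u * of_int (v_dot (\<alpha> j))))" for j
  proof -
    have e1: "exp (- (2 * pi * \<i> * of_int m * of_int (v_dot (\<alpha> j)))) = (1 :: complex)"
      using exp_integer_2pi[of "of_int (- m * v_dot (\<alpha> j))"] by (simp add: mult_ac)
    have "L * sdot (frame_point b l z) (\<alpha> j) = L * (sdot b (\<alpha> j) + l * of_real (Delta_dot (\<alpha> j))) + (L * z) * of_int (v_dot (\<alpha> j))"
      by (simp add: sdot_frame_point algebra_simps)
    hence eq: "- (L * sdot (frame_point b l z) (\<alpha> j)) = - (L * (sdot b (\<alpha> j) + l * of_real (Delta_dot (\<alpha> j)))) + (- (u * of_int (v_dot (\<alpha> j))) + - (2 * pi * \<i> * of_int m * of_int (v_dot (\<alpha> j))))"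
      unfolding Lz by (simp add: algebra_simps)
    have "mono_val (prime_point p (frame_point b l z)) (\<alpha> j) = exp (- (L * sdot (frame_point b l z) (\<alpha> j)))"
      unfolding L_def using prime_gt_0_nat[OF p] by (rule mono_val_prime_point)
    thus ?thesis by (simp only: eq exp_add e1 mult_1_right)
  qed
  define f where "f = (\<lambda>j. of_int (a j) * mono_val (prime_point p (frame_point b l z)) (\<alpha> j))"
  have cl: "(\<Sum>j\<in>exponent_class c. f j) = exp (- (L * (class_exponent b c + l * of_real c))) * class_sum c u" for c
    unfolding class_sum_def sum_distrib_left
  proof (rule sum.cong[OF refl])
    fix j assume j: "j \<in> exponent_class c"
    hence "Delta_dot (\<alpha> j) = c" by (simp add: exponent_class_def)
    thus "f j = exp (- (L * (class_exponent b c + l * of_real c))) * (of_int (a j) * exp (- (u * of_int (v_dot (\<alpha> j)))))"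
      unfolding f_def trm class_exponent_eq[OF b j] by simp
  qed
  have "(\<Sum>j=1..r. f j) = (\<Sum>c\<in>insert 0 K. \<Sum>j\<in>{j\<in>{1..r}. Delta_dot (\<alpha> j) = c}. f j)"
    by (rule sum.group[symmetric]) (auto simp: K_def)
  also have "\<dots> = (\<Sum>j\<in>exponent_class 0. f j) + (\<Sum>c\<in>K. \<Sum>j\<in>exponent_class c. f j)"
    by (subst sum.insert) (auto simp: finite_K K_def exponent_class_def)
  also have "(\<Sum>j\<in>exponent_class 0. f j) = class_sum 0 u" unfolding class_sum_def
  proof (rule sum.cong[OF refl])
    fix j assume j: "j \<in> exponent_class 0"
    hence d: "Delta_dot (\<alpha> j) = 0" by (simp add: exponent_class_def)
    have "sdot b (\<alpha> j) = 0" using class_dot[OF b, of "\<alpha> j" 0] d by simp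
    thus "f j = of_int (a j) * exp (- (u * of_int (v_dot (\<alpha> j))))" unfolding f_def trm d by simp
  qed
  finally have "(\<Sum>j=1..r. f j) = class_sum 0 u + (\<Sum>c\<in>K. exp (- (L * (class_exponent b c + l * of_real c))) * class_sum c u)"
    unfolding cl .
  moreover have "euler_factor (h_poly r a \<alpha>) p (frame_point b l z) = 1 + (\<Sum>j=1..r. f j)"
    unfolding euler_factor_def f_def by (rule eval_h_poly) (use inj nz in auto)
  ultimately show ?thesis by (simp add: E0_def L_def)
qed

section \<open>Zeros of Euler factors accumulating at a point of the face\<close>

definition zeta_poles_zeros :: "complex set" where "zeta_poles_zeros = insert 1 {s. Re s > 0 \<and> zeta_reg s = 0}"

lemma countable_zeta_poles_zeros: "countable zeta_poles_zeros" unfolding zeta_poles_zeros_def using countable_zeta_reg_zeros by simp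

lemma holomorphic_class_sum: "class_sum c holomorphic_on S" unfolding class_sum_def by (intro holomorphic_intros)

lemma holomorphic_E0: "E0 holomorphic_on S" unfolding E0_def by (intro holomorphic_intros holomorphic_class_sum)

text \<open>The alternative is whether some other class is nonzero at \<open>u0\<close>. If so,
  \<open>perturbed_zero\<close> supplies zeros avoiding countably many affine relations; if not, Re
  u0 > 0 and the zeros are explicit, so that counting replaces genericity.\<close>

lemma many_zeros:
  assumes b: "sdot b w = 0" and Reb: "\<And>j. j \<in> {1..r} \<Longrightarrow> Delta_dot (\<alpha> j) \<noteq> 0 \<Longrightarrow> Re (sdot b (\<alpha> j)) > 0"
    and u0: "E0 u0 = 0" "deriv E0 u0 \<noteq> 0" "Re u0 \<ge> 0" "Re u0 = 0 \<Longrightarrow> \<exists>c\<in>K. class_sum c u0 \<noteq> 0"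
    and "\<epsilon> > 0"
  shows "\<exists>l. norm l < \<epsilon> \<and> (\<forall>\<delta>>0. \<exists>p z. prime p \<and> Re z > 0 \<and> norm (z - \<i> * of_real t0) < \<delta> \<and>
            euler_factor (h_poly r a \<alpha>) p (frame_point b l z) = 0 \<and> (\<forall>\<beta>. \<beta> \<noteq> 0 \<longrightarrow> sdot (frame_point b l z) \<beta> \<notin> zeta_poles_zeros))"
proof -
  \<comment> \<open>Rounding chooses the multiple of 2\<pi>i that places the zero within O(1/L) of
    the prescribed point on the imaginary axis.\<close>
  define mm where "mm = (\<lambda>L::real. \<lfloor>(t0 * L - Im u0) / (2 * pi)\<rfloor>)"
  define zz where "zz = (\<lambda>L u. (u + 2 * pi * \<i> * of_int (mm L)) / of_real L :: complex)"
  define C where "C = 1 + \<bar>Re u0\<bar> + 2 * pi"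
  have C: "C > 0" by (simp add: C_def add_pos_nonneg)
  have close: "norm (zz L u - \<i> * of_real t0) \<le> C / L" if "L > 0" "norm (u - u0) \<le> 1" for L u
  proof -
    define q where "q = (t0 * L - Im u0) / (2 * pi)"
    have "t0 * L - Im u0 = 2 * pi * q" by (simp add: q_def)
    hence "Im u0 + 2 * pi * of_int (mm L) - t0 * L = 2 * pi * (of_int (mm L) - q)" by (simp add: algebra_simps)
    moreover have "\<bar>of_int (mm L) - q\<bar> \<le> 1" unfolding mm_def q_def[symmetric] by linarith
    ultimately have im: "\<bar>Im u0 + 2 * pi * of_int (mm L) - t0 * L\<bar> \<le> 2 * pi"
      by (simp add: abs_mult mult_le_cancel_left1)
    have "zz L u - \<i> * of_real t0 = ((u - u0) + of_real (Re u0) + \<i> * of_real (Im u0 + 2 * pi * of_int (mm L) - t0 * L)) / of_real L"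
    proof -
      have "u0 = of_real (Re u0) + \<i> * of_real (Im u0)" by (rule complex_eq)
      hence eq: "(u - u0) + of_real (Re u0) + \<i> * of_real (Im u0 + 2 * pi * of_int (mm L) - t0 * L) =
         u + 2 * pi * \<i> * of_int (mm L) - \<i> * of_real t0 * of_real L" by (simp add: algebra_simps)
      have "zz L u - \<i> * of_real t0 = (u + 2 * pi * \<i> * of_int (mm L) - \<i> * of_real t0 * of_real L) / of_real L"
        using that by (simp add: zz_def diff_divide_distrib)
      thus ?thesis by (simp only: eq)
    qed
    also have "norm \<dots> = norm ((u - u0) + of_real (Re u0) + \<i> * of_real (Im u0 + 2 * pi * of_int (mm L) - t0 * L)) / L"
      using that by (simp add: norm_divide)
    also have "\<dots> \<le> C / L"
    proof (rule divide_right_mono)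
      have "norm (\<i> * of_real (Im u0 + 2 * pi * of_int (mm L) - t0 * L)) \<le> 2 * pi"
        using im by (simp only: norm_mult norm_ii norm_of_real mult_1)
      thus "norm ((u - u0) + of_real (Re u0) + \<i> * of_real (Im u0 + 2 * pi * of_int (mm L) - t0 * L)) \<le> C"
        unfolding C_def using that by (intro norm_triangle_le add_mono) auto
    qed (use that in auto)
    finally show ?thesis .
  qed
  define LL where "LL = (\<lambda>p::nat. ln (real p)) ` {p. prime p}"
  have LLpos: "L > 0" if L: "L \<in> LL" for L   proof -
    obtain p where "prime p" "L = ln (real p)" using L by (auto simp: LL_def)
    thus ?thesis using prime_gt_1_nat[of p] by simp
  qed
  have LLinf: "\<exists>L\<in>LL. L > B" for B
  proof -
    obtain N :: nat where N: "real N > exp B" using reals_Archimedean2 by blast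
    obtain p where p: "prime p" "p > N" using bigger_prime by blast
    hence "real p > exp B" using N by simp
    hence "ln (real p) > B" by (metis exp_gt_zero ln_exp ln_less_cancel_iff order_less_trans)
    thus ?thesis using p by (auto simp: LL_def)
  qed
  have cLL: "countable LL" unfolding LL_def by simp
  show ?thesis
  proof (cases "\<exists>c\<in>K. class_sum c u0 \<noteq> 0")
    case True
    \<comment> \<open>The condition that \<beta> pairs with the point to \<rho>, written as y + l y'
      + u y'' = 0. For \<beta> \<noteq> 0 the coefficients y' and y'' cannot both vanish, because an
      exponent of class 0 is a multiple of w.\<close>
    define bad where "bad = (\<lambda>L::real. (\<lambda>(\<beta>, \<rho>). (sdot b \<beta> + 2 * pi * \<i> * of_int (mm L) / of_real L * of_int (v_dot \<beta>) - \<rho>,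
        complex_of_real (Delta_dot \<beta>), of_int (v_dot \<beta>) / complex_of_real L)) ` ((UNIV - {0}) \<times> zeta_poles_zeros))"
    have "\<exists>\<mu>. norm \<mu> < \<epsilon> \<and> (\<forall>B. \<exists>L\<in>LL. L > B \<and> (\<exists>u. norm (u - u0) < 1 \<and> Re u > 0 \<and>
           E0 u + (\<Sum>c\<in>K. exp (- (of_real L * (class_exponent b c + \<mu> * of_real c))) * class_sum c u) = 0 \<and>
           (\<forall>(y, y', y'')\<in>bad L. y + \<mu> * y' + u * y'' \<noteq> 0)))"
    proof (rule perturbed_zero[OF finite_K holomorphic_E0 holomorphic_class_sum u0(1-3) _ _ _ True LLinf cLL])
      show "Re (class_exponent b c) > 0" if c: "c \<in> K" for c
      proof -
        obtain j where j: "j \<in> exponent_class c" using K_exponent_class[OF c] by blast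
        show ?thesis unfolding class_exponent_eq[OF b j] using j c by (intro Reb) (auto simp: exponent_class_def K_def)
      qed
      show "inj_on (\<lambda>c. c) K" by simp
      show "c \<noteq> 0" if "c \<in> K" for c using that by (simp add: K_def)
      show "countable (bad L)" for L unfolding bad_def using countable_zeta_poles_zeros by simp
      show "y' \<noteq> 0 \<or> y'' \<noteq> 0" if L: "L \<in> LL" and y: "(y, y', y'') \<in> bad L" for L y y' y''
      proof -
        obtain \<beta> where "\<beta> \<noteq> 0" "y' = complex_of_real (Delta_dot \<beta>)" "y'' = of_int (v_dot \<beta>) / complex_of_real L"
          using y by (auto simp: bad_def)
        thus ?thesis using parallel(3)[of \<beta>] LLpos[OF L] by auto
      qed
    qed (use \<open>\<epsilon> > 0\<close> in auto)
    then obtain l where l: "norm l < \<epsilon>" "\<And>B. \<exists>L\<in>LL. L > B \<and> (\<exists>u. norm (u - u0) < 1 \<and> Re u > 0 \<and>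
           E0 u + (\<Sum>c\<in>K. exp (- (of_real L * (class_exponent b c + l * of_real c))) * class_sum c u) = 0 \<and>
           (\<forall>(y, y', y'')\<in>bad L. y + l * y' + u * y'' \<noteq> 0))" by blast
    show ?thesis
    proof (intro exI[of _ l] conjI allI impI l(1))
      fix \<delta> :: real assume "\<delta> > 0"
      obtain L u where L: "L \<in> LL" "L > C / \<delta>" and u: "norm (u - u0) < 1" "Re u > 0"
        "E0 u + (\<Sum>c\<in>K. exp (- (of_real L * (class_exponent b c + l * of_real c))) * class_sum c u) = 0"
        "\<forall>(y, y', y'')\<in>bad L. y + l * y' + u * y'' \<noteq> 0" using l(2)[of "C / \<delta>"] by blast
      obtain p where p: "prime p" "L = ln (real p)" using L by (auto simp: LL_def)
      have Lp: "L > 0" by (rule LLpos[OF L(1)])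
      define z where "z = zz L u"
      have "C / L < \<delta>" using L(2) Lp \<open>\<delta> > 0\<close> by (simp add: field_simps)
      hence zc: "norm (z - \<i> * of_real t0) < \<delta>" unfolding z_def using close[OF Lp, of u] u(1) by simp
      have "Re z = Re u / L" by (simp add: z_def zz_def Re_divide_of_real)
      hence zR: "Re z > 0" using u(2) Lp by simp
      have "euler_factor (h_poly r a \<alpha>) p (frame_point b l z) = 0"
        unfolding euler_factor_formula[OF p(1) b, of z u "mm L" l, unfolded p(2)[symmetric], OF z_def[unfolded zz_def]] by (rule u(3))
      moreover have "sdot (frame_point b l z) \<beta> \<notin> zeta_poles_zeros" if \<beta>: "\<beta> \<noteq> 0" for \<beta>
      proof
        assume R: "sdot (frame_point b l z) \<beta> \<in> zeta_poles_zeros"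
        define y where "y = sdot b \<beta> + 2 * pi * \<i> * of_int (mm L) / of_real L * of_int (v_dot \<beta>) - sdot (frame_point b l z) \<beta>"
        have "(y, complex_of_real (Delta_dot \<beta>), of_int (v_dot \<beta>) / complex_of_real L) \<in> bad L"
          unfolding bad_def y_def using \<beta> R by force
        hence "y + l * of_real (Delta_dot \<beta>) + u * (of_int (v_dot \<beta>) / of_real L) \<noteq> 0" using u(4) by blast
        moreover have "y + l * of_real (Delta_dot \<beta>) + u * (of_int (v_dot \<beta>) / of_real L) = 0"
          using Lp by (simp add: y_def sdot_frame_point z_def zz_def field_simps)
        ultimately show False by (rule notE)
      qed
      ultimately show "\<exists>p z. prime p \<and> Re z > 0 \<and> norm (z - \<i> * of_real t0) < \<delta> \<and>
            euler_factor (h_poly r a \<alpha>) p (frame_point b l z) = 0 \<and> (\<forall>\<beta>. \<beta> \<noteq> 0 \<longrightarrow> sdot (frame_point b l z) \<beta> \<notin> zeta_poles_zeros)"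
        using p(1) zR zc by blast
    qed
  next
    case False
    hence EE0: "class_sum c u0 = 0" if "c \<in> K" for c using that by blast
    have Ru: "Re u0 > 0" using u0(3,4) False by fastforce
    define wp where "wp = (\<lambda>p::nat. zz (ln (real p)) u0)"
    \<comment> \<open>The zeros \<open>wp p\<close> do not depend on l, so a generic l disposes of
      every \<beta> not parallel to w. A nonzero \<beta> parallel to w pairs to k
      \<open>wp p\<close> with k \<ge> 1, whatever l is, and is left to
      \<open>zeta_factors_miss_zeros\<close>.\<close>
    define Bd where "Bd = (\<Union>p\<in>{p::nat. prime p}. \<Union>\<beta>\<in>{\<beta>. Delta_dot \<beta> \<noteq> 0}. \<Union>\<rho>\<in>zeta_poles_zeros. {l. sdot (frame_point b l (wp p)) \<beta> = \<rho>})"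
    have "countable Bd" unfolding Bd_def
    proof (intro countable_UN countable_zeta_poles_zeros)
      fix p \<beta> \<rho> assume "\<beta> \<in> {\<beta>. Delta_dot \<beta> \<noteq> 0}"
      hence d: "Delta_dot \<beta> \<noteq> 0" by simp
      have "{l. sdot (frame_point b l (wp p)) \<beta> = \<rho>} \<subseteq> {(\<rho> - sdot b \<beta> - wp p * of_int (v_dot \<beta>)) / of_real (Delta_dot \<beta>)}"
        using d by (auto simp: sdot_frame_point field_simps)
      thus "countable {l. sdot (frame_point b l (wp p)) \<beta> = \<rho>}" using countable_subset by blast
    qed auto
    moreover have "uncountable (ball (0::complex) \<epsilon>)" using \<open>\<epsilon> > 0\<close> by (rule uncountable_ball)
    ultimately obtain l where l: "l \<in> ball 0 \<epsilon>" "l \<notin> Bd" by (meson countable_subset subsetI)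
    show ?thesis
    proof (intro exI[of _ l] conjI allI impI)
      show "norm l < \<epsilon>" using l by simp
      fix \<delta> :: real assume "\<delta> > 0"
      obtain P0 :: nat where P0: "real P0 > exp (C / \<delta>)" using reals_Archimedean2 by blast
      have near: "norm (wp p - \<i> * of_real t0) < \<delta>" if p: "prime p" "p \<ge> P0" for p
      proof -
        have "real p > exp (C / \<delta>)" using P0 p by (meson less_le_trans of_nat_le_iff)
        hence "ln (real p) > C / \<delta>" by (metis exp_gt_zero ln_exp ln_less_cancel_iff order_less_trans)
        moreover have lp: "ln (real p) > 0" using prime_gt_1_nat[OF p(1)] by simp
        ultimately have "C / ln (real p) < \<delta>" using \<open>\<delta> > 0\<close> by (simp add: field_simps)
        thus ?thesis unfolding wp_def using close[OF lp, of u0] by simp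
      qed
      have "\<exists>p\<ge>P0. prime p \<and> (\<forall>k::nat. k \<ge> 1 \<longrightarrow>
          of_nat k * ((u0 + 2 * pi * \<i> * of_int (mm (ln (real p)))) / of_real (ln (real p))) \<noteq> 1 \<and>
          zeta_reg (of_nat k * ((u0 + 2 * pi * \<i> * of_int (mm (ln (real p)))) / of_real (ln (real p)))) \<noteq> 0)"
      proof (rule zeta_factors_miss_zeros[OF Ru, of P0 _ "\<bar>t0\<bar> + \<delta>"])
        fix p :: nat assume p: "prime p" "p \<ge> P0"
        have "\<bar>Im (wp p - \<i> * of_real t0)\<bar> \<le> \<delta>"
          using near[OF p] abs_Im_le_cmod[of "wp p - \<i> * of_real t0"] by linarith
        hence "\<bar>Im (wp p) - t0\<bar> \<le> \<delta>" by simp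
        hence "\<bar>Im (wp p)\<bar> \<le> \<bar>t0\<bar> + \<delta>" by linarith
        thus "\<bar>Im ((u0 + 2 * pi * \<i> * of_int (mm (ln (real p)))) / of_real (ln (real p)))\<bar> \<le> \<bar>t0\<bar> + \<delta>"
          unfolding wp_def zz_def .
      qed
      then obtain p where p: "p \<ge> P0" "prime p" "\<And>k::nat. k \<ge> 1 \<Longrightarrow> of_nat k * wp p \<noteq> 1 \<and> zeta_reg (of_nat k * wp p) \<noteq> 0"
        unfolding wp_def zz_def by blast
      have lp: "ln (real p) > 0" using prime_gt_1_nat[OF p(2)] by simp
      have "Re (wp p) = Re u0 / ln (real p)" by (simp add: wp_def zz_def Re_divide_of_real)
      hence zR: "Re (wp p) > 0" using Ru lp by simp
      have "euler_factor (h_poly r a \<alpha>) p (frame_point b l (wp p)) = 0"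
        unfolding euler_factor_formula[OF p(2) b, of "wp p" u0 "mm (ln (real p))" l, OF wp_def[THEN fun_cong, unfolded zz_def]]
        using EE0 u0(1) by simp
      moreover have "sdot (frame_point b l (wp p)) \<beta> \<notin> zeta_poles_zeros" if \<beta>: "\<beta> \<noteq> 0" for \<beta>
      proof (cases "Delta_dot \<beta> = 0")
        case True
        have k: "nat (v_dot \<beta>) \<ge> 1" "v_dot \<beta> \<ge> 0" using parallel(2,3)[OF True] \<beta> by auto
        have "sdot b \<beta> = 0" using class_dot[OF b, of \<beta> 0] True by simp
        hence "sdot (frame_point b l (wp p)) \<beta> = of_nat (nat (v_dot \<beta>)) * wp p"
          using True k by (simp add: sdot_frame_point mult.commute)
        thus ?thesis using p(3)[OF k(1)] by (auto simp: zeta_poles_zeros_def)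
      next
        case False
        thus ?thesis using l(2) p(2) by (auto simp: Bd_def)
      qed
      ultimately show "\<exists>p z. prime p \<and> Re z > 0 \<and> norm (z - \<i> * of_real t0) < \<delta> \<and>
            euler_factor (h_poly r a \<alpha>) p (frame_point b l z) = 0 \<and> (\<forall>\<beta>. \<beta> \<noteq> 0 \<longrightarrow> sdot (frame_point b l z) \<beta> \<notin> zeta_poles_zeros)"
        using p(2) zR near[OF p(2,1)] by blast
    qed
  qed
qed

end

text \<open>Near a point in the relative interior of the face, \<open>W(0)\<close> is the half-space
  Re (s \<sdot> w) > 0. There a slice in the direction \<open>v_vec\<close> is found that meets the
  face close by and contains a point where the numerator is nonzero. The zeros from
  \<open>many_zeros\<close> accumulate on this slice at the face, contradicting the one-variable
  identity theorem.\<close>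

lemma (in face_frame) no_extension:
  assumes \<sigma>: "\<sigma> \<bullet> rvec w = 0" "\<And>j. j \<in> {1..r} \<Longrightarrow> Delta_dot (\<alpha> j) \<noteq> 0 \<Longrightarrow> \<sigma> \<bullet> rvec (\<alpha> j) > 0"
    and s0: "Re (sdot s0 w) = 0" "\<And>j. j \<in> {1..r} \<Longrightarrow> Re (sdot s0 (\<alpha> j)) \<ge> 0" and "\<rho> > 0"
    and Z: "euler_extension r a \<alpha> Z"
    and F: "meromorphic_several F (ball s0 \<rho>)" "coincide_on (ball s0 \<rho> \<inter> W r \<alpha> 0) F Z"
    and u0: "E0 u0 = 0" "deriv E0 u0 \<noteq> 0" "Re u0 \<ge> 0" "Re u0 = 0 \<Longrightarrow> \<exists>c\<in>K. class_sum c u0 \<noteq> 0"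
  shows False
proof -
  define U1 where "U1 = {s :: complex ^ 'n. \<forall>j\<in>{1..r}. Delta_dot (\<alpha> j) \<noteq> 0 \<longrightarrow> Re (sdot s (\<alpha> j)) > 0}"
  have sdc: "continuous_on S (\<lambda>s. sdot s \<beta>)" for S and \<beta> :: "nat ^ 'n"
    by (simp add: sdot_def continuous_intros)
  have oU1: "open U1"
  proof -
    have "U1 = (\<Inter>j\<in>{j\<in>{1..r}. Delta_dot (\<alpha> j) \<noteq> 0}. {s. Re (sdot s (\<alpha> j)) > 0})" by (auto simp: U1_def)
    also have "open \<dots>"
      by (intro open_INT ballI open_Collect_less continuous_intros sdc) auto
    finally show ?thesis .
  qed
  have inW: "s \<in> W r \<alpha> 0" if "s \<in> U1" "Re (sdot s w) > 0" for s
  proof -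
    have "Re (sdot s (\<alpha> j)) > 0" if j: "j \<in> {1..r}" for j
    proof (cases "Delta_dot (\<alpha> j) = 0")
      case True
      have k: "nat (v_dot (\<alpha> j)) \<ge> 1" using parallel(3)[OF True] nz[OF j] by simp
      have "sdot s (\<alpha> j) = of_nat (nat (v_dot (\<alpha> j))) * sdot s w"
        by (simp add: sdot_def parallel(1)[OF True] sum_distrib_left mult_ac)
      hence "Re (sdot s (\<alpha> j)) = real (nat (v_dot (\<alpha> j))) * Re (sdot s w)" by simp
      thus ?thesis using k that \<open>Re (sdot s w) > 0\<close> by simp
    next
      case False
      thus ?thesis using \<open>s \<in> U1\<close> j by (simp add: U1_def)
    qed
    thus ?thesis by (simp add: W_def)
  qed
  define t1 where "t1 = \<rho> / (2 * (1 + norm (cvec \<sigma>)))"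
  have nn: "1 + norm (cvec \<sigma>) > 0" by (simp add: add_pos_nonneg)
  have t1: "t1 > 0" using \<open>\<rho> > 0\<close> nn by (simp add: t1_def)
  \<comment> \<open>A small move along \<sigma> takes \<open>s0\<close> into the relative interior
    of the face and stays in the ball.\<close>
  define s1 where "s1 = s0 + t1 *\<^sub>R cvec \<sigma>"
  have "norm (t1 *\<^sub>R cvec \<sigma>) < \<rho>"
  proof -
    have "norm (t1 *\<^sub>R cvec \<sigma>) = t1 * norm (cvec \<sigma>)" using t1 by simp
    also have "\<dots> \<le> t1 * (1 + norm (cvec \<sigma>))" using t1 by (intro mult_left_mono) auto
    also have "\<dots> = \<rho> / 2" using nn by (simp add: t1_def field_simps)
    finally show ?thesis using \<open>\<rho> > 0\<close> by simp
  qed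
  hence s1B: "s1 \<in> ball s0 \<rho>" by (simp add: s1_def dist_norm)
  have sd1: "Re (sdot s1 \<beta>) = Re (sdot s0 \<beta>) + t1 * (\<sigma> \<bullet> rvec \<beta>)" for \<beta>
    by (simp add: s1_def sdot_add_left sdot_scaleR_left sdot_cvec)
  have s1w: "Re (sdot s1 w) = 0" using sd1 s0 \<sigma> by simp
  have s1U: "s1 \<in> U1" unfolding U1_def
  proof (intro CollectI ballI impI)
    fix j assume j: "j \<in> {1..r}" "Delta_dot (\<alpha> j) \<noteq> 0"
    have "t1 * (\<sigma> \<bullet> rvec (\<alpha> j)) > 0" using t1 \<sigma>(2)[OF j] by simp
    thus "Re (sdot s1 (\<alpha> j)) > 0" using sd1 s0(2)[OF j(1)] by simp
  qed
  define n1 where "n1 = 1 + norm v_vec"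
  have n1: "n1 > 0" by (simp add: n1_def add_pos_nonneg)
  have s1cl: "s1 \<in> closure (W r \<alpha> 0)"
    unfolding closure_approachable
  proof (intro allI impI)
    fix e :: real assume "e > 0"
    obtain d where d: "d > 0" "ball s1 d \<subseteq> U1" using oU1 s1U openE by blast
    define t where "t = min d e / (2 * n1)"
    have t: "t > 0" using d \<open>e > 0\<close> n1 by (simp add: t_def)
    have "norm (t *\<^sub>R v_vec) \<le> t * n1" using t by (simp add: n1_def)
    also have "\<dots> = min d e / 2" using n1 by (simp add: t_def)
    also have "\<dots> < min d e"
    proof -
      have "min d e > 0" using d \<open>e > 0\<close> by simp
      thus ?thesis by linarith
    qed
    finally have nt: "norm (t *\<^sub>R v_vec) < min d e" .
    hence "s1 + t *\<^sub>R v_vec \<in> U1" using d(2) by (auto simp: dist_norm subset_iff)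
    moreover have "Re (sdot (s1 + t *\<^sub>R v_vec) w) = t" using s1w v_dot_w by (simp add: sdot_add_left sdot_scaleR_left sdot_v_vec)
    ultimately have "s1 + t *\<^sub>R v_vec \<in> W r \<alpha> 0" using t by (intro inW) auto
    thus "\<exists>y\<in>W r \<alpha> 0. dist y s1 < e" using nt by (intro bexI[of _ "s1 + t *\<^sub>R v_vec"]) (auto simp: dist_norm)
  qed
  obtain \<eta> f where f: "\<eta> > 0" "holomorphic_several f (ball s1 \<eta>)" "\<exists>x\<in>ball s1 \<eta>. f x \<noteq> 0"
    "\<And>s p. s \<in> ball s1 \<eta> \<Longrightarrow> s \<in> W r \<alpha> 0 \<Longrightarrow> prime p \<Longrightarrow> euler_factor (h_poly r a \<alpha>) p s = 0 \<Longrightarrow>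
       \<forall>\<beta>. \<beta> \<noteq> 0 \<longrightarrow> Re (sdot s \<beta>) > 0 \<longrightarrow> sdot s \<beta> \<noteq> 1 \<and> zeta_reg (sdot s \<beta>) \<noteq> 0 \<Longrightarrow> f s = 0"
  proof (rule meromorphic_extension_zeros[OF inj nz Z F(1) open_ball F(2) s1B s1cl])
    fix \<eta> f
    assume "0 < \<eta>" "ball s1 \<eta> \<subseteq> ball s0 \<rho>" "holomorphic_several f (ball s1 \<eta>)"
      "\<exists>x\<in>ball s1 \<eta>. f x \<noteq> 0"
      "\<And>s p. s \<in> ball s1 \<eta> \<Longrightarrow> s \<in> W r \<alpha> 0 \<Longrightarrow> prime p \<Longrightarrow> euler_factor (h_poly r a \<alpha>) p s = 0 \<Longrightarrow>
         \<forall>\<beta>. \<beta> \<noteq> 0 \<longrightarrow> Re (sdot s \<beta>) > 0 \<longrightarrow> sdot s \<beta> \<noteq> 1 \<and> zeta_reg (sdot s \<beta>) \<noteq> 0 \<Longrightarrow> f s = 0"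
    from that[OF this(1,3,4,5)] show thesis .
  qed
  \<comment> \<open>Projection onto the face along \<open>v_vec\<close>. The point q is picked with
    nonzero numerator among the points whose projection is still in the good neighbourhood.\<close>
  define \<pi> where "\<pi> = (\<lambda>q :: complex ^ 'n. q - Re (sdot q w) *\<^sub>R v_vec)"
  have cpi: "continuous_on UNIV \<pi>" unfolding \<pi>_def by (intro continuous_intros sdc)
  have "open (\<pi> -` (ball s1 \<eta> \<inter> U1))"
    using continuous_open_vimage[OF _ continuous_on_eq_continuous_at[THEN iffD1, OF open_UNIV cpi, rule_format]] oU1
    by (metis Int_commute UNIV_I open_Int open_ball)
  moreover have "s1 \<in> \<pi> -` (ball s1 \<eta> \<inter> U1)" using s1w s1U f(1) by (simp add: \<pi>_def)
  ultimately have oA: "open (ball s1 \<eta> \<inter> \<pi> -` (ball s1 \<eta> \<inter> U1))" "s1 \<in> ball s1 \<eta> \<inter> \<pi> -` (ball s1 \<eta> \<inter> U1)"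
    using f(1) by auto
  obtain q where q: "q \<in> ball s1 \<eta>" "\<pi> q \<in> ball s1 \<eta>" "\<pi> q \<in> U1" "f q \<noteq> 0"
  proof -
    have "\<exists>q\<in>ball s1 \<eta> \<inter> \<pi> -` (ball s1 \<eta> \<inter> U1). f q \<noteq> 0"
    proof (rule ccontr)
      assume "\<not> ?thesis"
      hence "f x = 0" if "x \<in> ball s1 \<eta>" for x
        using holomorphic_several_identity[OF f(2) open_ball connected_ball oA(1) _ _ _ that] oA(2) by blast
      thus False using f(3) by blast
    qed
    thus ?thesis using that by blast
  qed
  define s2 where "s2 = \<pi> q"
  define \<kappa> where "\<kappa> = Re (sdot q w)"
  have q2: "q = s2 + \<kappa> *\<^sub>R v_vec" by (simp add: s2_def \<pi>_def \<kappa>_def)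
  have s2w: "Re (sdot s2 w) = 0"
  proof -
    have "sdot q w = sdot s2 w + of_real \<kappa>" unfolding q2 by (simp add: sdot_add_left sdot_scaleR_left sdot_v_vec v_dot_w of_real_def)
    hence "Re (sdot q w) = Re (sdot s2 w) + \<kappa>" by (metis plus_complex.sel(1) Re_complex_of_real)
    thus ?thesis unfolding \<kappa>_def by linarith
  qed
  define t0 where "t0 = Im (sdot s2 w)"
  have s2w': "sdot s2 w = \<i> * of_real t0" using s2w by (simp add: t0_def complex_eq_iff)
  \<comment> \<open>Subtracting the height makes b pair to 0 with w, as the frame lemmas require.
    Only imaginary parts of pairings change.\<close>
  define b where "b = s2 - (\<i> * of_real t0) *s v_vec"
  have sb: "sdot b \<beta> = sdot s2 \<beta> - \<i> * of_real t0 * of_int (v_dot \<beta>)" for \<beta>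
  proof -
    have "b = s2 + (- (\<i> * of_real t0)) *s v_vec" by (simp add: b_def vec_eq_iff)
    hence "sdot b \<beta> = sdot s2 \<beta> + (- (\<i> * of_real t0)) * sdot v_vec \<beta>" by (simp only: sdot_line)
    thus ?thesis by (simp add: sdot_v_vec)
  qed
  have bw: "sdot b w = 0" by (simp add: sb s2w' v_dot_w)
  have Reb: "Re (sdot b (\<alpha> j)) > 0" if "j \<in> {1..r}" "Delta_dot (\<alpha> j) \<noteq> 0" for j
    using q(3) that by (simp add: sb U1_def s2_def)
  have p0: "frame_point b 0 (\<i> * of_real t0) = s2" by (simp add: frame_point_def b_def vec_eq_iff)
  have p1: "frame_point b 0 (\<i> * of_real t0 + of_real \<kappa>) = q"
    unfolding q2 vec_eq_iff frame_point_def b_def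
    by (simp only: vector_add_component vector_minus_component vector_smult_component vector_scaleR_component)
       (simp add: scaleR_conv_of_real algebra_simps)
  have cpt: "continuous_on UNIV (\<lambda>x. frame_point b (fst x) (snd x))"
    unfolding frame_point_def vector_scalar_mult_def by (intro continuous_intros continuous_on_vec_lambda)
  have opn: "\<exists>e>0. \<forall>l z. norm l < e \<and> norm (z - z0) < e \<longrightarrow> frame_point b l z \<in> T"
    if T: "open T" "frame_point b 0 z0 \<in> T" for T z0
  proof -
    have "open ((\<lambda>x. frame_point b (fst x) (snd x)) -` T)"
      using open_vimage[OF T(1) cpt] .
    moreover have "(0, z0) \<in> (\<lambda>x. frame_point b (fst x) (snd x)) -` T" using T by simp
    ultimately obtain e where e: "e > 0" "ball (0, z0) e \<subseteq> (\<lambda>x. frame_point b (fst x) (snd x)) -` T" using openE by blast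
    have "frame_point b l z \<in> T" if "norm l < e / 2" "norm (z - z0) < e / 2" for l z
    proof -
      have "norm (l, z - z0) \<le> norm l + norm (z - z0)" by (rule norm_Pair_le)
      hence "dist (l, z) (0, z0) < e" using that by (simp add: dist_norm)
      hence "(l, z) \<in> ball (0, z0) e" by (simp add: dist_commute)
      thus ?thesis using e(2) by auto
    qed
    thus ?thesis using e(1) by (intro exI[of _ "e / 2"]) auto
  qed
  have oF: "open (ball s1 \<eta> \<inter> {x. f x \<noteq> 0})" by (rule open_Int_nonzero[OF f(2)]) auto
  \<comment> \<open>Small l keep both ends of the slice: near the face it stays in \<open>U1\<close>
    and in the ball, and at the far end the numerator stays nonzero.\<close>
  obtain e1 where e1: "e1 > 0" "\<And>l z. norm l < e1 \<Longrightarrow> norm (z - \<i> * of_real t0) < e1 \<Longrightarrow> frame_point b l z \<in> ball s1 \<eta> \<inter> U1"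
    using opn[of "ball s1 \<eta> \<inter> U1" "\<i> * of_real t0"] oU1 q(2,3) unfolding p0 s2_def by blast
  obtain e2 where e2: "e2 > 0" "\<And>l z. norm l < e2 \<Longrightarrow> norm (z - (\<i> * of_real t0 + of_real \<kappa>)) < e2 \<Longrightarrow> frame_point b l z \<in> ball s1 \<eta> \<inter> {x. f x \<noteq> 0}"
    using opn[OF oF, of "\<i> * of_real t0 + of_real \<kappa>"] q(1,4) unfolding p1 by blast
  have "\<exists>l. norm l < min e1 e2 \<and> (\<forall>\<delta>>0. \<exists>p z. prime p \<and> Re z > 0 \<and> norm (z - \<i> * of_real t0) < \<delta> \<and>
            euler_factor (h_poly r a \<alpha>) p (frame_point b l z) = 0 \<and> (\<forall>\<beta>. \<beta> \<noteq> 0 \<longrightarrow> sdot (frame_point b l z) \<beta> \<notin> zeta_poles_zeros))"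
    by (rule many_zeros[OF bw Reb u0]) (use e1 e2 in auto)
  then obtain l where l: "norm l < e1" "norm l < e2" and zeros: "\<And>\<delta>. \<delta> > 0 \<Longrightarrow> \<exists>p z. prime p \<and> Re z > 0 \<and> norm (z - \<i> * of_real t0) < \<delta> \<and>
            euler_factor (h_poly r a \<alpha>) p (frame_point b l z) = 0 \<and> (\<forall>\<beta>. \<beta> \<noteq> 0 \<longrightarrow> sdot (frame_point b l z) \<beta> \<notin> zeta_poles_zeros)" by auto
  define S where "S = {z. frame_point b l z \<in> ball s1 \<eta>}"
  define \<phi> where "\<phi> = (\<lambda>z. f (frame_point b l z))"
  have holS: "\<phi> holomorphic_on S"
    using holomorphic_several_imp_line_holomorphic[OF f(2)] unfolding line_holomorphic_def \<phi>_def S_def frame_point_def by blast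
  have oS: "open S" unfolding S_def frame_point_def by (rule open_line_preimage) simp
  have cS: "connected S" unfolding S_def frame_point_def by (intro convex_connected convex_line_preimage) simp
  have subS: "{z\<in>S. \<phi> z = 0} \<subseteq> S" by auto
  have tS: "\<i> * of_real t0 \<in> S" using e1(2)[OF l(1), of "\<i> * of_real t0"] e1(1) by (simp add: S_def)
  have lim: "\<i> * of_real t0 islimpt {z\<in>S. \<phi> z = 0}"
    unfolding islimpt_approachable
  proof (intro allI impI)
    fix e :: real assume "e > 0"
    hence "min e e1 > 0" using e1(1) by simp
    from zeros[OF this] obtain p z where z: "prime p" "Re z > 0" "norm (z - \<i> * of_real t0) < min e e1"
      "euler_factor (h_poly r a \<alpha>) p (frame_point b l z) = 0" "\<And>\<beta>. \<beta> \<noteq> 0 \<Longrightarrow> sdot (frame_point b l z) \<beta> \<notin> zeta_poles_zeros" by blast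
    have m: "frame_point b l z \<in> ball s1 \<eta>" "frame_point b l z \<in> U1" using e1(2)[OF l(1), of z] z(3) by auto
    have "sdot (frame_point b l z) w = z" by (simp add: sdot_frame_point bw Delta_dot_w v_dot_w)
    hence "frame_point b l z \<in> W r \<alpha> 0" using m z(2) by (intro inW) auto
    hence "\<phi> z = 0" unfolding \<phi>_def
      by (rule f(4)[OF m(1) _ z(1,4)]) (use z(5) in \<open>auto simp: zeta_poles_zeros_def\<close>)
    moreover have "z \<in> S" using m by (simp add: S_def)
    moreover have "z \<noteq> \<i> * of_real t0" using z(2) by auto
    ultimately show "\<exists>x'\<in>{z\<in>S. \<phi> z = 0}. x' \<noteq> \<i> * of_real t0 \<and> dist x' (\<i> * of_real t0) < e"
      using z(3) by (intro bexI[of _ z]) (auto simp: dist_norm)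
  qed
  have en: "frame_point b l (\<i> * of_real t0 + of_real \<kappa>) \<in> ball s1 \<eta> \<inter> {x. f x \<noteq> 0}"
    by (rule e2(2)[OF l(2)]) (use e2(1) in simp)
  have "\<i> * of_real t0 + of_real \<kappa> \<in> S" using en by (simp add: S_def)
  hence "\<phi> (\<i> * of_real t0 + of_real \<kappa>) = 0"
    by (rule analytic_continuation[OF holS oS cS subS tS lim, rotated]) simp
  thus False using en by (simp add: \<phi>_def)
qed

section \<open>Cyclotomic factors\<close>

text \<open>The modulus of the leading coefficient times the moduli of the roots, with multiplicity,
  is the modulus of the constant coefficient, that is 1. All these factors are at least 1, hence
  equal to 1.\<close>

lemma roots_outside_disc_imp_unit:
  fixes H :: "int poly"
  assumes H0: "coeff H 0 = 1"
    and roots: "\<And>z::complex. poly (map_poly of_int H) z = 0 \<Longrightarrow> norm z \<ge> 1"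
    and z: "poly (map_poly of_int H) z = 0"
  shows "norm (z::complex) = 1"
proof -
  define Hc where "Hc = (map_poly of_int H :: complex poly)"
  have Hc0: "coeff Hc 0 = 1" using H0 by (simp add: Hc_def coeff_map_poly)
  hence Hcn: "Hc \<noteq> 0" by auto
  define R where "R = {z. poly Hc z = 0}"
  have finR: "finite R" unfolding R_def using Hcn by (rule poly_roots_finite)
  have nR: "norm z \<ge> 1" if "z \<in> R" for z using roots that by (simp add: R_def Hc_def)
  have dec: "smult (lead_coeff Hc) (\<Prod>z\<in>R. [:-z, 1:] ^ order z Hc) = Hc"
    unfolding R_def by (rule complex_poly_decompose)
  have "poly Hc 0 = 1" using Hc0 by (simp add: poly_0_coeff_0)
  moreover have "poly Hc 0 = lead_coeff Hc * (\<Prod>z\<in>R. (- z) ^ order z Hc)"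
    by (subst (1) dec[symmetric]) (simp add: poly_prod)
  ultimately have "norm (lead_coeff Hc * (\<Prod>z\<in>R. (- z) ^ order z Hc)) = 1" by simp
  hence eq: "norm (lead_coeff Hc) * (\<Prod>z\<in>R. norm z ^ order z Hc) = 1"
    by (simp add: norm_mult norm_power flip: prod_norm)
  have deg: "degree Hc = degree H" by (simp add: Hc_def degree_map_poly)
  have "H \<noteq> 0" using H0 by auto
  have "lead_coeff Hc = of_int (lead_coeff H)" unfolding deg by (simp add: Hc_def coeff_map_poly)
  moreover have "\<bar>lead_coeff H\<bar> \<ge> 1"
  proof -
    have "lead_coeff H \<noteq> 0" using \<open>H \<noteq> 0\<close> by simp
    thus ?thesis by linarith
  qed
  hence "1 \<le> \<bar>real_of_int (lead_coeff H)\<bar>" by linarith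
  ultimately have l1: "norm (lead_coeff Hc) \<ge> 1" by simp
  have zR: "z \<in> R" using z by (simp add: R_def Hc_def)
  have rest: "(\<Prod>z\<in>R - {z}. norm z ^ order z Hc) \<ge> 1"
    by (rule prod_ge_1) (use nR in \<open>auto intro: one_le_power\<close>)
  have "order z Hc \<ge> 1" using zR Hcn by (simp add: R_def order_root Suc_le_eq)
  hence "norm z ^ 1 \<le> norm z ^ order z Hc" using nR[OF zR] by (intro power_increasing) auto
  hence "norm z * 1 \<le> norm z ^ order z Hc * (\<Prod>z\<in>R - {z}. norm z ^ order z Hc)"
    using rest by (intro mult_mono) auto
  also have "\<dots> = (\<Prod>z\<in>R. norm z ^ order z Hc)" using finR zR by (simp add: prod.remove)
  finally have "norm z \<le> (\<Prod>z\<in>R. norm z ^ order z Hc)" by simp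
  moreover have "1 * (\<Prod>z\<in>R. norm z ^ order z Hc) \<le> norm (lead_coeff Hc) * (\<Prod>z\<in>R. norm z ^ order z Hc)"
    using l1 by (intro mult_right_mono prod_nonneg) auto
  ultimately have "norm z \<le> 1" using eq by simp
  thus ?thesis using nR[OF zR] by simp
qed

section \<open>Monomials in the polynomial ring\<close>

lemma mono_pow_add: "mono_pow (\<mu> + \<nu>) = mono_pow \<mu> * mono_pow \<nu>"
  by (simp add: mono_pow_def mult_single)

lemma mono_pow_0: "mono_pow 0 = 1"
  by (simp add: mono_pow_def)

lemma mono_pow_power: "mono_pow \<mu> ^ n = mono_pow (\<chi> l. n * \<mu> $ l)"
proof (induction n)
  case 0
  have "(\<chi> l. 0 * \<mu> $ l) = 0" by (simp add: vec_eq_iff)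
  thus ?case by (simp add: mono_pow_0)
next
  case (Suc n)
  have "(\<chi> l. Suc n * \<mu> $ l) = \<mu> + (\<chi> l. n * \<mu> $ l)" by (simp add: vec_eq_iff)
  thus ?case using Suc by (simp add: mono_pow_add)
qed

lemma single_eq_of_int_mult: "Poly_Mapping.single \<mu> c = of_int c * mono_pow \<mu>"
proof -
  have nat: "Poly_Mapping.single \<mu> (int n) = of_nat n * mono_pow \<mu>" for n
    by (induction n) (simp_all add: mono_pow_def single_add distrib_right)
  show ?thesis
  proof (cases "c \<ge> 0")
    case True
    thus ?thesis using nat[of "nat c"] by simp
  next
    case False
    thus ?thesis using nat[of "nat (- c)"] by (simp add: single_uminus)
  qed
qed

context face_frame
begin

definition H :: "int poly" where
  "H = 1 + (\<Sum>j\<in>exponent_class 0. monom (a j) (nat (v_dot (\<alpha> j))))"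

lemma finite_exponent_class: "finite (exponent_class c)" by (simp add: exponent_class_def)

lemma cls0: "j \<in> exponent_class 0 \<Longrightarrow> v_dot (\<alpha> j) \<ge> 1"
  using parallel(3)[of "\<alpha> j"] nz by (auto simp: exponent_class_def)

lemma coeff_H_0: "coeff H 0 = 1"
proof -
  have "coeff H 0 = 1 + (\<Sum>j\<in>exponent_class 0. if nat (v_dot (\<alpha> j)) = 0 then a j else 0)"
    by (simp add: H_def coeff_sum)
  also have "(\<Sum>j\<in>exponent_class 0. if nat (v_dot (\<alpha> j)) = 0 then a j else 0) = 0"
    by (rule sum.neutral) (use cls0 in force)
  finally show ?thesis by simp
qed

lemma int_eval_H: "int_eval H (exp (- u)) = E0 u"
proof -
  have "int_eval H (exp (- u)) = 1 + (\<Sum>j\<in>exponent_class 0. of_int (a j) * exp (- u) ^ nat (v_dot (\<alpha> j)))"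
    by (simp add: H_def int_eval_add int_eval_sum int_eval_monom)
  also have "(\<Sum>j\<in>exponent_class 0. of_int (a j) * exp (- u) ^ nat (v_dot (\<alpha> j))) = class_sum 0 u"
    unfolding class_sum_def
  proof (rule sum.cong[OF refl])
    fix j assume "j \<in> exponent_class 0"
    hence "of_nat (nat (v_dot (\<alpha> j))) = (of_int (v_dot (\<alpha> j)) :: complex)" using cls0[of j] by simp
    thus "of_int (a j) * exp (- u) ^ nat (v_dot (\<alpha> j)) = of_int (a j) * exp (- (u * of_int (v_dot (\<alpha> j))))"
      by (simp add: exp_of_nat_mult[symmetric] mult.commute)
  qed
  finally show ?thesis by (simp add: E0_def)
qed

text \<open>\<open>E0\<close> is \<open>H\<close> composed with exp (- u), whose derivative never
  vanishes, so a simple root of \<open>H\<close> gives a simple zero of \<open>E0\<close>.\<close>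

lemma deriv_E0_nonzero:
  assumes simple: "order (exp (- u)) (map_poly of_int H) \<le> 1" and E0: "E0 u = 0"
  shows "deriv E0 u \<noteq> 0"
proof -
  define Hc where "Hc = (map_poly of_int H :: complex poly)"
  define z where "z = exp (- u)"
  have Hcn: "Hc \<noteq> 0" using coeff_H_0 by (metis Hc_def coeff_0 coeff_map_poly of_int_0 of_int_1 zero_neq_one)
  have root: "poly Hc z = 0" using int_eval_H[of u] E0 by (simp add: int_eval_def Hc_def z_def)
  have "poly (pderiv Hc) z \<noteq> 0"
  proof
    assume p0: "poly (pderiv Hc) z = 0"
    obtain q where q: "Hc = [:-z, 1:] * q" using root by (auto simp: poly_eq_0_iff_dvd)
    have "poly (pderiv Hc) z = poly q z" unfolding q pderiv_mult by (simp add: pderiv_pCons)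
    hence "poly q z = 0" using p0 by simp
    then obtain q' where "q = [:-z, 1:] * q'" by (auto simp: poly_eq_0_iff_dvd)
    hence "Hc = [:-z, 1:] ^ 2 * q'" unfolding q by (simp only: power2_eq_square mult.assoc)
    hence "[:-z, 1:] ^ 2 dvd Hc" by simp
    hence "2 \<le> order z Hc" using Hcn by (simp add: order_divides)
    thus False using simple by (simp add: Hc_def z_def)
  qed
  moreover have "(E0 has_field_derivative (poly (pderiv Hc) z * (- z))) (at u)"
  proof -
    have "((\<lambda>u. poly Hc (exp (- u))) has_field_derivative (poly (pderiv Hc) z * (- z))) (at u)"
      unfolding z_def by (rule DERIV_chain2[OF poly_DERIV]) (auto intro!: derivative_eq_intros)
    moreover have "(\<lambda>u. poly Hc (exp (- u))) = E0" using int_eval_H by (simp add: fun_eq_iff int_eval_def Hc_def)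
    ultimately show ?thesis by simp
  qed
  ultimately show ?thesis by (simp add: DERIV_imp_deriv z_def)
qed

text \<open>Substituting X^w into \<open>H\<close> gives the class-0 part of h, and substituting
  into its product formula shows that this part is cyclotomic. Every other class is a monomial times
  P(X^w), where P vanishes at the roots of \<open>H\<close> and is therefore a multiple of
  \<open>H\<close>.\<close>

lemma unit_roots_cyclotomic_factor:
  assumes e: "e \<in> exponent_class 0" "a e \<noteq> 0"
    and unit: "\<And>z::complex. poly (map_poly of_int H) z = 0 \<Longrightarrow> norm z = 1"
    and class_sum: "\<And>(z::complex) c. poly (map_poly of_int H) z = 0 \<Longrightarrow> c \<in> K \<Longrightarrow> class_sum c (- Ln z) = 0"
    and simple: "\<And>z::complex. order z (map_poly of_int H) \<le> 1"
  shows "has_cyclotomic_factor (h_poly r a \<alpha>)"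
proof -
  define x :: "'n int_mpoly" where "x = mono_pow w"
  define kw where "kw = (\<lambda>k::nat. (\<chi> l. k * w $ l) :: nat ^ 'n)"
  have xk: "x ^ k = mono_pow (kw k)" for k by (simp add: x_def kw_def mono_pow_power)
  have vkw: "v_dot (kw k) = int k" for k
  proof -
    have "v_dot (kw k) = int k * v_dot w" by (simp add: v_dot_def kw_def sum_distrib_left mult_ac)
    thus ?thesis by (simp add: v_dot_w)
  qed
  define Q where "Q = int_eval H x"
  have Q: "Q = 1 + (\<Sum>j\<in>exponent_class 0. Poly_Mapping.single (\<alpha> j) (a j))"
  proof -
    have "Q = 1 + (\<Sum>j\<in>exponent_class 0. of_int (a j) * x ^ nat (v_dot (\<alpha> j)))"
      by (simp add: Q_def H_def int_eval_add int_eval_sum int_eval_monom)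
    also have "(\<Sum>j\<in>exponent_class 0. of_int (a j) * x ^ nat (v_dot (\<alpha> j))) = (\<Sum>j\<in>exponent_class 0. Poly_Mapping.single (\<alpha> j) (a j))"
    proof (rule sum.cong[OF refl])
      fix j assume "j \<in> exponent_class 0"
      hence "kw (nat (v_dot (\<alpha> j))) = \<alpha> j" using parallel(1)[of "\<alpha> j"] by (simp add: kw_def exponent_class_def vec_eq_iff)
      thus "of_int (a j) * x ^ nat (v_dot (\<alpha> j)) = Poly_Mapping.single (\<alpha> j) (a j)"
        by (simp add: xk single_eq_of_int_mult)
    qed
    finally show ?thesis .
  qed
  obtain M \<gamma> where cyc: "H * wprod (\<lambda>k. nat (- \<gamma> k)) M = wprod (\<lambda>k. nat (\<gamma> k)) M"
    using unit_roots_cyclotomic[OF coeff_H_0 unit] by blast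
  have ev: "int_eval (wprod ex M) x = (\<Prod>\<mu>\<in>kw ` {1..<M}. (1 - mono_pow \<mu>) ^ ex (nat (v_dot \<mu>)))" for ex
  proof -
    have "inj_on kw {1..<M}" by (rule inj_onI) (metis vkw of_nat_eq_iff)
    thus ?thesis
      by (subst prod.reindex) (simp_all add: wprod_def int_eval_prod int_eval_power int_eval_diff int_eval_monom xk vkw)
  qed
  have "cyclotomic_mpoly Q" unfolding cyclotomic_mpoly_def
  proof (intro exI conjI)
    show "finite (kw ` {1..<M})" by simp
    show "0 \<notin> kw ` {1..<M}"
    proof
      assume "0 \<in> kw ` {1..<M}"
      then obtain k where "k \<ge> 1" "kw k = 0" by auto
      thus False using vkw[of k] by simp
    qed
    have "int_eval (H * wprod (\<lambda>k. nat (- \<gamma> k)) M) x = int_eval (wprod (\<lambda>k. nat (\<gamma> k)) M) x" by (simp only: cyc)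
    thus "Q * (\<Prod>\<mu>\<in>kw ` {1..<M}. (1 - mono_pow \<mu>) ^ nat (- (\<gamma> (nat (v_dot \<mu>))))) =
       (\<Prod>\<mu>\<in>kw ` {1..<M}. (1 - mono_pow \<mu>) ^ nat (\<gamma> (nat (v_dot \<mu>))))"
      by (simp only: int_eval_mult ev Q_def)
  qed
  moreover have "nonconstant Q"
  proof -
    have er: "e \<in> {1..r}" using e by (simp add: exponent_class_def)
    have "Poly_Mapping.lookup Q (\<alpha> e) = (\<Sum>j\<in>exponent_class 0. Poly_Mapping.lookup (Poly_Mapping.single (\<alpha> j) (a j)) (\<alpha> e))"
      using nz[OF er] by (simp add: Q lookup_add lookup_sum lookup_one)
    also have "\<dots> = (\<Sum>j\<in>exponent_class 0. if j = e then a j else 0)"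
    proof (rule sum.cong[OF refl])
      fix j assume "j \<in> exponent_class 0"
      hence "\<alpha> j = \<alpha> e \<longleftrightarrow> j = e" using inj er by (auto simp: exponent_class_def dest: inj_onD)
      thus "Poly_Mapping.lookup (Poly_Mapping.single (\<alpha> j) (a j)) (\<alpha> e) = (if j = e then a j else 0)"
        by (simp add: lookup_single when_def)
    qed
    also have "\<dots> = a e" using e finite_exponent_class by simp
    finally have "\<alpha> e \<in> Poly_Mapping.keys Q" using e by (simp add: in_keys_iff)
    thus ?thesis using nz[OF er] by (auto simp: nonconstant_def)
  qed
  moreover have "Q dvd h_poly r a \<alpha>"
  proof -
    have cdvd: "Q dvd (\<Sum>j\<in>exponent_class c. Poly_Mapping.single (\<alpha> j) (a j))" if c: "c \<in> K" for c
    proof -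
      have ne: "exponent_class c \<noteq> {}" using K_exponent_class[OF c] by auto
      \<comment> \<open>Outside class 0 the coordinate \<open>v_dot\<close> may be negative.
        Dividing by the member of least coordinate leaves a genuine polynomial, and dropping that
        power loses no zeros, as the roots of \<open>H\<close> are nonzero.\<close>
      obtain j0 where j0: "j0 \<in> exponent_class c" "\<And>j. j \<in> exponent_class c \<Longrightarrow> v_dot (\<alpha> j0) \<le> v_dot (\<alpha> j)"
        using arg_min_if_finite(1)[OF finite_exponent_class ne, of "\<lambda>j. v_dot (\<alpha> j)"]
          arg_min_least[OF finite_exponent_class ne, of _ "\<lambda>j. v_dot (\<alpha> j)"] by blast
      define m where "m = (\<lambda>j. nat (v_dot (\<alpha> j) - v_dot (\<alpha> j0)))"
      define P where "P = (\<Sum>j\<in>exponent_class c. monom (a j) (m j))"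
      have "H dvd P"
      proof (rule unit_roots_dvd[OF coeff_H_0 unit simple])
        fix z :: complex assume z: "poly (map_poly of_int H) z = 0"
        have z0: "z \<noteq> 0" using unit[OF z] by auto
        have "0 = class_sum c (- Ln z)" using class_sum[OF z c] by simp
        also have "\<dots> = (\<Sum>j\<in>exponent_class c. exp (Ln z * of_int (v_dot (\<alpha> j0))) * (of_int (a j) * z ^ m j))"
          unfolding class_sum_def
        proof (rule sum.cong[OF refl])
          fix j assume j: "j \<in> exponent_class c"
          have "of_int (v_dot (\<alpha> j)) = (of_int (v_dot (\<alpha> j0)) + of_nat (m j) :: complex)"
            using j0(2)[OF j] by (simp add: m_def)
          hence "exp (- (- Ln z * of_int (v_dot (\<alpha> j)))) = exp (Ln z * of_int (v_dot (\<alpha> j0))) * exp (of_nat (m j) * Ln z)"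
            by (simp add: exp_add[symmetric] algebra_simps)
          also have "exp (of_nat (m j) * Ln z) = z ^ m j" using z0 by (simp add: exp_of_nat_mult)
          finally show "of_int (a j) * exp (- (- Ln z * of_int (v_dot (\<alpha> j)))) =
              exp (Ln z * of_int (v_dot (\<alpha> j0))) * (of_int (a j) * z ^ m j)" by simp
        qed
        also have "\<dots> = exp (Ln z * of_int (v_dot (\<alpha> j0))) * int_eval P z"
          by (simp add: P_def int_eval_sum int_eval_monom sum_distrib_left)
        finally show "poly (map_poly of_int P) z = 0" by (simp add: int_eval_def)
      qed
      then obtain P' where "P = H * P'" by (elim dvdE)
      hence "int_eval P x = Q * int_eval P' x" by (simp add: int_eval_mult Q_def)
      hence "Q dvd mono_pow (\<alpha> j0) * int_eval P x" by simp
      also have "mono_pow (\<alpha> j0) * int_eval P x = (\<Sum>j\<in>exponent_class c. mono_pow (\<alpha> j0) * (of_int (a j) * x ^ m j))"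
        by (simp add: P_def int_eval_sum int_eval_monom sum_distrib_left)
      also have "\<dots> = (\<Sum>j\<in>exponent_class c. Poly_Mapping.single (\<alpha> j) (a j))"
      proof (rule sum.cong[OF refl])
        fix j assume j: "j \<in> exponent_class c"
        have "\<alpha> j = \<alpha> j0 + kw (m j)"
        proof -
          have "\<alpha> j $ l = \<alpha> j0 $ l + m j * w $ l" for l
          proof -
            have "int (\<alpha> j $ l) - int (\<alpha> j0 $ l) = (v_dot (\<alpha> j) - v_dot (\<alpha> j0)) * int (w $ l)"
              by (rule same_class) (use j j0 in \<open>simp add: exponent_class_def\<close>)
            also have "v_dot (\<alpha> j) - v_dot (\<alpha> j0) = int (m j)" using j0(2)[OF j] by (simp add: m_def)
            finally have "int (\<alpha> j $ l) = int (\<alpha> j0 $ l + m j * w $ l)" by simp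
            thus ?thesis by (simp only: of_nat_eq_iff)
          qed
          thus ?thesis by (simp add: vec_eq_iff kw_def)
        qed
        thus "mono_pow (\<alpha> j0) * (of_int (a j) * x ^ m j) = Poly_Mapping.single (\<alpha> j) (a j)"
          by (simp add: single_eq_of_int_mult xk mono_pow_add mult_ac)
      qed
      finally show ?thesis .
    qed
    have "(\<Sum>j=1..r. Poly_Mapping.single (\<alpha> j) (a j)) = (\<Sum>c\<in>insert 0 K. \<Sum>j\<in>{j\<in>{1..r}. Delta_dot (\<alpha> j) = c}. Poly_Mapping.single (\<alpha> j) (a j))"
      by (rule sum.group[symmetric]) (auto simp: K_def)
    also have "\<dots> = (\<Sum>j\<in>exponent_class 0. Poly_Mapping.single (\<alpha> j) (a j)) + (\<Sum>c\<in>K. \<Sum>j\<in>exponent_class c. Poly_Mapping.single (\<alpha> j) (a j))"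
      by (subst sum.insert) (auto simp: finite_K K_def exponent_class_def)
    finally have "h_poly r a \<alpha> = Q + (\<Sum>c\<in>K. \<Sum>j\<in>exponent_class c. Poly_Mapping.single (\<alpha> j) (a j))"
      by (simp add: h_poly_def Q add.assoc)
    thus ?thesis using dvd_add[OF dvd_refl dvd_sum[OF cdvd]] by simp
  qed
  ultimately show ?thesis unfolding has_cyclotomic_factor_def by blast
qed

end

section \<open>The natural boundary\<close>

theorem mainTheorem1:
  fixes r e :: nat
    and a :: "nat \<Rightarrow> int"
    and \<alpha> :: "nat \<Rightarrow> nat ^ 'n"
    and Z :: "complex ^ 'n \<Rightarrow> complex"
    and s0 :: "complex ^ 'n"
    and \<rho> :: real
  assumes "r \<ge> 1"
    and "\<And>j. j \<in> {1..r} \<Longrightarrow> a j \<noteq> 0"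
    and "\<And>j. j \<in> {1..r} \<Longrightarrow> \<alpha> j \<noteq> 0"
    and "inj_on \<alpha> {1..r}"
    and "\<not> cyclotomic_mpoly (h_poly r a \<alpha>)"
    and "\<not> has_cyclotomic_factor (h_poly r a \<alpha>)"
    and "euler_extension r a \<alpha> Z"
    and "is_face r \<alpha> e"
    and "nondegenerate_face r a \<alpha> e"
    and "s0 \<in> face_set r \<alpha> e"
    and "\<rho> > 0"
  shows "\<not> (\<exists>F. meromorphic_several F (ball s0 \<rho>) \<and> coincide_on (ball s0 \<rho> \<inter> W r \<alpha> 0) F Z)"
proof
  assume "\<exists>F. meromorphic_several F (ball s0 \<rho>) \<and> coincide_on (ball s0 \<rho> \<inter> W r \<alpha> 0) F Z"
  then obtain F where F: "meromorphic_several F (ball s0 \<rho>)" "coincide_on (ball s0 \<rho> \<inter> W r \<alpha> 0) F Z" by blast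
  note nz = assms(3) and inj = assms(4)
  have e: "e \<in> {1..r}" using assms(8) by (simp add: is_face_def)
  define w where "w = primitive_vec (\<alpha> e)"
  define g where "g = vgcd (\<alpha> e)"
  have g: "g > 0" unfolding g_def by (rule vgcd_pos[OF nz[OF e]])
  have \<alpha>e: "\<alpha> e $ l = g * w $ l" for l
    unfolding w_def primitive_vec[OF nz[OF e]] g_def using vgcd_dvd[of "\<alpha> e" l] by simp
  have "g = g * vgcd w" unfolding g_def by (rule vgcd_scale) (use \<alpha>e g_def in simp)
  hence "vgcd w = 1" using g by simp
  then obtain v where v: "(\<Sum>l\<in>UNIV. v l * int (w $ l)) = 1"
    using bezout_vec[of UNIV w] by (auto simp: vgcd_def)
  have w0: "w \<noteq> 0" using v by auto
  obtain \<Delta> :: "real ^ 'n" where \<Delta>: "\<Delta> \<bullet> rvec w = 0"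
    "\<And>\<beta> \<beta>'. \<Delta> \<bullet> rvec \<beta> = \<Delta> \<bullet> rvec \<beta>' \<Longrightarrow> \<exists>t. rvec \<beta> - rvec \<beta>' = t *\<^sub>R rvec w"
    using exists_generic_direction[OF w0] by blast
  interpret face_frame r a \<alpha> w v \<Delta>
    by unfold_locales (use inj nz v \<Delta> in auto)
  have re: "rvec (\<alpha> e) = real g *\<^sub>R rvec w" by (simp add: vec_eq_iff \<alpha>e)
  have de: "Delta_dot (\<alpha> e) = 0" by (simp add: Delta_dot_def re \<Delta>(1))
  have par_iff: "(\<exists>t. rvec (\<alpha> j) = t *\<^sub>R rvec (\<alpha> e)) \<Longrightarrow> Delta_dot (\<alpha> j) = 0" for j
    by (auto simp: Delta_dot_def re \<Delta>(1))
  have in_span: "in_rat_span (\<alpha> j) (\<alpha> e) \<longleftrightarrow> Delta_dot (\<alpha> j) = 0" for j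
  proof
    assume "in_rat_span (\<alpha> j) (\<alpha> e)"
    then obtain c :: rat where c: "\<And>l. of_nat (\<alpha> j $ l) = c * of_nat (\<alpha> e $ l)" by (auto simp: in_rat_span_def)
    have "real (\<alpha> j $ l) = of_rat c * real (\<alpha> e $ l)" for l
      using arg_cong[OF c[of l], of "of_rat :: rat \<Rightarrow> real"] by (simp add: of_rat_mult)
    hence "rvec (\<alpha> j) = of_rat c *\<^sub>R rvec (\<alpha> e)" by (simp add: vec_eq_iff)
    thus "Delta_dot (\<alpha> j) = 0" by (intro par_iff) blast
  next
    assume d: "Delta_dot (\<alpha> j) = 0"
    have "of_nat (\<alpha> j $ l) = (of_nat (nat (v_dot (\<alpha> j))) / of_nat g :: rat) * of_nat (\<alpha> e $ l)" for l
      using g by (simp add: parallel(1)[OF d, of l] \<alpha>e)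
    thus "in_rat_span (\<alpha> j) (\<alpha> e)" unfolding in_rat_span_def by blast
  qed
  have ray: "ray_index (\<alpha> e) (\<alpha> j) = nat (v_dot (\<alpha> j))" if j: "j \<in> {1..r}" "Delta_dot (\<alpha> j) = 0" for j
    unfolding ray_index_def w_def[symmetric]
  proof (rule the_equality)
    show "1 \<le> nat (v_dot (\<alpha> j)) \<and> (\<forall>l. \<alpha> j $ l = nat (v_dot (\<alpha> j)) * w $ l)"
      using parallel(1,3)[OF j(2)] nz[OF j(1)] by auto
    fix q assume q: "1 \<le> q \<and> (\<forall>l. \<alpha> j $ l = q * w $ l)"
    obtain l where "w $ l \<noteq> 0" using w0 by (auto simp: vec_eq_iff)
    moreover have "q * w $ l = nat (v_dot (\<alpha> j)) * w $ l" using q parallel(1)[OF j(2), of l] by simp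
    ultimately show "q = nat (v_dot (\<alpha> j))" by simp
  qed
  \<comment> \<open>Being in the rational span of the face vector means having class 0, and the ray
    index is then the coordinate \<open>v_dot\<close>. This carries the non-degeneracy hypothesis
    over to \<open>H\<close>.\<close>
  have face: "face_poly r a \<alpha> e = H"
    unfolding face_poly_def H_def in_span
    by (intro arg_cong2[where f = "(+)"] sum.cong refl) (auto simp: exponent_class_def ray)
  have simple: "order z (map_poly of_int H) \<le> 1" for z :: complex
    using assms(9) by (simp add: nondegenerate_face_def face)
  obtain \<sigma> where \<sigma>: "\<sigma> \<bullet> rvec (\<alpha> e) = 0"
    "\<And>j. j \<in> {1..r} \<Longrightarrow> (\<nexists>t. rvec (\<alpha> j) = t *\<^sub>R rvec (\<alpha> e)) \<Longrightarrow> \<sigma> \<bullet> rvec (\<alpha> j) > 0"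
    using face_interior[OF nz assms(8)] by blast
  have \<sigma>w: "\<sigma> \<bullet> rvec w = 0" using \<sigma>(1) g by (simp add: re)
  have \<sigma>j: "\<sigma> \<bullet> rvec (\<alpha> j) > 0" if "j \<in> {1..r}" "Delta_dot (\<alpha> j) \<noteq> 0" for j
    using \<sigma>(2)[OF that(1)] par_iff[of j] that(2) by blast
  have s0cl: "s0 \<in> closure (W r \<alpha> 0)" and s0e: "Re (sdot s0 (\<alpha> e)) = 0"
    using assms(10) by (auto simp: face_set_def)
  have "sdot s0 (\<alpha> e) = of_nat g * sdot s0 w"
    by (simp add: sdot_def \<alpha>e sum_distrib_left mult_ac)
  hence s0w: "Re (sdot s0 w) = 0" using s0e g by simp
  have s0j: "Re (sdot s0 (\<alpha> j)) \<ge> 0" if "j \<in> {1..r}" for j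
    using closure_W_0[of r \<alpha>] s0cl that by blast
  have no_ext: False if "E0 u = 0" "deriv E0 u \<noteq> 0" "Re u \<ge> 0" "Re u = 0 \<longrightarrow> (\<exists>c\<in>K. class_sum c u \<noteq> 0)" for u
  proof (rule no_extension[OF \<sigma>w _ s0w _ assms(11,7) F that(1-3)])
    show "\<sigma> \<bullet> rvec (\<alpha> j) > 0" if "j \<in> {1..r}" "Delta_dot (\<alpha> j) \<noteq> 0" for j by (rule \<sigma>j[OF that])
    show "Re (sdot s0 (\<alpha> j)) \<ge> 0" if "j \<in> {1..r}" for j by (rule s0j[OF that])
    show "\<exists>c\<in>K. class_sum c u \<noteq> 0" if "Re u = 0" using \<open>Re u = 0 \<longrightarrow> _\<close> that by blast
  qed
  \<comment> \<open>For u = - Ln z the real part is - ln |z|, so a root in the closed unit disc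
    meets the sign condition of \<open>no_ext\<close>. Only unimodular roots that annihilate all
    other classes escape the contradiction.\<close>
  have small_root: "norm z = 1 \<and> (\<forall>c\<in>K. class_sum c (- Ln z) = 0)"
    if z: "poly (map_poly of_int H) z = 0" "norm z \<le> 1" for z :: complex
  proof -
    have z0: "z \<noteq> 0"
    proof
      assume "z = 0"
      hence "coeff H 0 = 0" using z(1) by (simp add: poly_0_coeff_0 coeff_map_poly)
      thus False using coeff_H_0 by simp
    qed
    define u where "u = - Ln z"
    have eu: "exp (- u) = z" using z0 by (simp add: u_def)
    have Eu: "E0 u = 0" using int_eval_H[of u] z(1) by (simp add: eu int_eval_def)
    have du: "deriv E0 u \<noteq> 0" by (rule deriv_E0_nonzero[OF _ Eu]) (rule simple)
    have Ru: "Re u = - ln (norm z)" using z0 by (simp add: u_def)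
    hence Ru0: "Re u \<ge> 0" using z0 z(2) by simp
    have "\<not> (Re u = 0 \<longrightarrow> (\<exists>c\<in>K. class_sum c u \<noteq> 0))" using no_ext[OF Eu du Ru0] by blast
    hence "Re u = 0" "\<forall>c\<in>K. class_sum c u = 0" by auto
    moreover from this have "norm z = 1" using Ru z0 by simp
    ultimately show ?thesis by (simp add: u_def)
  qed
  have unit: "norm z = 1" if "poly (map_poly of_int H) z = 0" for z :: complex
    by (rule roots_outside_disc_imp_unit[OF coeff_H_0 _ that]) (use small_root in \<open>metis linear\<close>)
  have "has_cyclotomic_factor (h_poly r a \<alpha>)"
  proof (rule unit_roots_cyclotomic_factor[of e])
    show "e \<in> exponent_class 0" using e de by (simp add: exponent_class_def)
    show "a e \<noteq> 0" by (rule assms(2)[OF e])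
    show "norm z = 1" if "poly (map_poly of_int H) z = 0" for z :: complex by (rule unit[OF that])
    show "class_sum c (- Ln z) = 0" if "poly (map_poly of_int H) z = 0" "c \<in> K" for z :: complex and c
      using small_root[OF that(1)] unit[OF that(1)] that(2) by simp
    show "order z (map_poly of_int H) \<le> 1" for z :: complex by (rule simple)
  qed
  thus False using assms(6) by blast
qed

end
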